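(* Given an integral NMDA $\mathcal{A}$ over $\Sigma$ and a threshold $\nu\in\mathbb{Q}$, it is decidable in polynomial time whether there exists a nonempty finite word $u\in\Sigma^+$ with $\mathcal{A}(u)\leq\nu$.
   Context: An NMDA over a finite alphabet $\Sigma$ is a tuple $\mathcal{A}=\langle \Sigma,Q,\iota,\delta,\gamma,\rho\rangle$ with finite state set $Q$, initial states $\iota\subseteq Q$, transition relation $\delta\subseteq Q\times\Sigma\times Q$, weight function $\gamma:\delta\to\mathbb{Q}$ and discount-factor function $\rho:\delta\to\mathbb{Q}\cap(1,\infty)$; NMDAs are assumed complete (every state has at least one outgoing transition on every letter). An NMDA is integral if all discount factors are integers. A run on $u=\sigma_0\cdots\sigma_{n-1}$ is $p_0,\sigma_0,p_1,\ldots,p_n$ with $p_0\in\iota$ and $t_i=(p_i,\sigma_i,p_{i+1})\in\delta$; its value is $\sum_{i=0}^{n-1}\gamma(t_i)\prod_{j<i}\frac{1}{\rho(t_j)}$, and $\mathcal{A}(u)$ is the minimum of values of runs on $u$. Input size is measured by the maximum of the number of transitions and the maximal binary length of any weight, discount factor, or of the threshold. *)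

theory Defs
  imports "HOL-Library.Extended_Real" "HOL-Computational_Algebra.Polynomial"
begin

section \<open>Nondeterministic discounted-sum automata with multiple discount factors\<close>

record ('q, 'a) nmda =
  alphabet :: "'a set"
  states :: "'q set"
  initial :: "'q set"
  trans :: "('q \<times> 'a \<times> 'q) set"
  weight :: "'q \<times> 'a \<times> 'q \<Rightarrow> rat"
  discount :: "'q \<times> 'a \<times> 'q \<Rightarrow> rat"

text \<open>The functions \<open>weight\<close> and \<open>discount\<close> are total in HOL, but only their values
  on \<open>trans\<close> are ever used.\<close>

definition is_nmda :: "('q, 'a) nmda \<Rightarrow> bool" where
  "is_nmda A \<longleftrightarrow>
     finite (alphabet A) \<and> finite (states A) \<and>
     initial A \<subseteq> states A \<and>
     trans A \<subseteq> states A \<times> alphabet A \<times> states A \<and>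
     (\<forall>t\<in>trans A. discount A t > 1) \<and>
     (\<forall>p\<in>states A. \<forall>a\<in>alphabet A. \<exists>q\<in>states A. (p, a, q) \<in> trans A)"

definition integral_nmda :: "('q, 'a) nmda \<Rightarrow> bool" where
  "integral_nmda A \<longleftrightarrow> is_nmda A \<and> (\<forall>t\<in>trans A. discount A t \<in> \<int>)"

text \<open>A run on \<open>u\<close> is given by its sequence of states \<open>p\<^sub>0, \<dots>, p\<^sub>n\<close>, where \<open>n\<close> is the
  length of \<open>u\<close>.\<close>

definition run_trans :: "'a list \<Rightarrow> 'q list \<Rightarrow> nat \<Rightarrow> 'q \<times> 'a \<times> 'q" where
  "run_trans u ps i = (ps ! i, u ! i, ps ! Suc i)"

definition runs :: "('q, 'a) nmda \<Rightarrow> 'a list \<Rightarrow> 'q list set" where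
  "runs A u = {ps. length ps = Suc (length u) \<and> ps ! 0 \<in> initial A \<and>
                   (\<forall>i<length u. run_trans u ps i \<in> trans A)}"

definition run_value :: "('q, 'a) nmda \<Rightarrow> 'a list \<Rightarrow> 'q list \<Rightarrow> rat" where
  "run_value A u ps =
     (\<Sum>i<length u. weight A (run_trans u ps i) * (\<Prod>j<i. 1 / discount A (run_trans u ps j)))"

text \<open>By completeness, a word over the alphabet has no run only if there is no initial state;
  the minimum over the empty set is then \<open>\<infinity>\<close>.\<close>

definition nmda_value :: "('q, 'a) nmda \<Rightarrow> 'a list \<Rightarrow> ereal" where
  "nmda_value A u =
     (if runs A u = {} then \<infinity> else ereal (of_rat (Min (run_value A u ` runs A u))))"


section \<open>Turing machines and polynomial time\<close>

text \<open>Deterministic machines with finitely many two-way infinite tapes. Control states are the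
  numbers below \<open>num_states\<close>, tape symbols the numbers below \<open>num_symbols\<close>, and \<open>0\<close> is the
  blank. The function \<open>next_move\<close> maps a state and the list of scanned symbols (one per tape)
  to the new state and the list of actions (one per tape: symbol written and head move).\<close>

datatype move = Left | Stay | Right

record tm =
  num_tapes :: nat
  num_symbols :: nat
  num_states :: nat
  start_state :: nat
  accept_state :: nat
  reject_state :: nat
  next_move :: "nat \<Rightarrow> nat list \<Rightarrow> nat \<times> (nat \<times> move) list"

definition is_tm :: "tm \<Rightarrow> bool" where
  "is_tm M \<longleftrightarrow>
     num_tapes M \<ge> 1 \<and> num_symbols M \<ge> 1 \<and>
     start_state M < num_states M \<and> accept_state M < num_states M \<and>
     reject_state M < num_states M \<and> accept_state M \<noteq> reject_state M \<and>
     (\<forall>q < num_states M. \<forall>xs. length xs = num_tapes M \<and> set xs \<subseteq> {..<num_symbols M} \<longrightarrow>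
        (case next_move M q xs of (q', acts) \<Rightarrow>
           q' < num_states M \<and> length acts = num_tapes M \<and>
           (\<forall>(s, m)\<in>set acts. s < num_symbols M)))"

text \<open>A tape is its contents together with the head position.\<close>

type_synonym tape = "(int \<Rightarrow> nat) \<times> int"
type_synonym config = "nat \<times> tape list"

fun read_tape :: "tape \<Rightarrow> nat" where
  "read_tape (c, h) = c h"

fun shift :: "move \<Rightarrow> int \<Rightarrow> int" where
  "shift Left h = h - 1"
| "shift Stay h = h"
| "shift Right h = h + 1"

fun act_tape :: "nat \<times> move \<Rightarrow> tape \<Rightarrow> tape" where
  "act_tape (s, m) (c, h) = (c(h := s), shift m h)"

fun tm_step :: "tm \<Rightarrow> config \<Rightarrow> config" where
  "tm_step M (q, tps) =
     (if q = accept_state M \<or> q = reject_state M then (q, tps)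
      else case next_move M q (map read_tape tps) of (q', acts) \<Rightarrow> (q', map2 act_tape acts tps))"

definition input_tape :: "nat list \<Rightarrow> tape" where
  "input_tape w = (\<lambda>i. if 0 \<le> i \<and> i < int (length w) then w ! nat i else 0, 0)"

definition init_config :: "tm \<Rightarrow> nat list \<Rightarrow> config" where
  "init_config M w = (start_state M, input_tape w # replicate (num_tapes M - 1) (input_tape []))"

definition accepts_within :: "tm \<Rightarrow> nat list \<Rightarrow> nat \<Rightarrow> bool" where
  "accepts_within M w n \<longleftrightarrow> fst ((tm_step M ^^ n) (init_config M w)) = accept_state M"

definition rejects_within :: "tm \<Rightarrow> nat list \<Rightarrow> nat \<Rightarrow> bool" where
  "rejects_within M w n \<longleftrightarrow> fst ((tm_step M ^^ n) (init_config M w)) = reject_state M"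

text \<open>A decision problem consists of its instances \<open>I\<close>, a size measure \<open>sz\<close> on them, a relation
  \<open>enc\<close> between instances and the words that present them to a machine, and the set of
  instances with answer ``yes'', given by \<open>Yes\<close>. An instance may be presented by several words
  (the elements of a finite set can be listed in any order); the machine has to be correct and
  fast on all of them.\<close>

definition decidable_in_polytime ::
  "'i set \<Rightarrow> ('i \<Rightarrow> nat) \<Rightarrow> ('i \<Rightarrow> nat list \<Rightarrow> bool) \<Rightarrow> ('i \<Rightarrow> bool) \<Rightarrow> bool" where
  "decidable_in_polytime I sz enc Yes \<longleftrightarrow>
     (\<exists>M (p :: nat poly). is_tm M \<and>
        (\<forall>x\<in>I. \<forall>w. enc x w \<longrightarrow>
           set w \<subseteq> {1..<num_symbols M} \<and>
           (if Yes x then accepts_within M w (poly p (sz x))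
            else rejects_within M w (poly p (sz x)))))"


section \<open>Presenting an automaton and a threshold to a machine\<close>

text \<open>Binary notation, most significant digit first, without leading zeros; \<open>0\<close> is written with
  the single digit 0.\<close>

fun binary :: "nat \<Rightarrow> bool list" where
  "binary n = (if n < 2 then [n = 1] else binary (n div 2) @ [odd n])"

declare binary.simps [simp del]

text \<open>\<open>quotient_of\<close> yields numerator and positive denominator in lowest terms.\<close>

definition binary_length :: "rat \<Rightarrow> nat" where
  "binary_length r = (case quotient_of r of (a, b) \<Rightarrow>
     length (binary (nat \<bar>a\<bar>)) + length (binary (nat b)))"

datatype symbol = Digit bool | Minus | Slash | Comma | Semicolon | Bar

fun symbol_code :: "symbol \<Rightarrow> nat" where
  "symbol_code (Digit False) = 1"
| "symbol_code (Digit True) = 2"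
| "symbol_code Minus = 3"
| "symbol_code Slash = 4"
| "symbol_code Comma = 5"
| "symbol_code Semicolon = 6"
| "symbol_code Bar = 7"

definition write_nat :: "nat \<Rightarrow> symbol list" where
  "write_nat n = map Digit (binary n)"

definition write_rat :: "rat \<Rightarrow> symbol list" where
  "write_rat r = (case quotient_of r of (a, b) \<Rightarrow>
     (if a < 0 then [Minus] else []) @ write_nat (nat \<bar>a\<bar>) @ [Slash] @ write_nat (nat b))"

fun write_trans :: "(nat, nat) nmda \<Rightarrow> nat \<times> nat \<times> nat \<Rightarrow> symbol list" where
  "write_trans A (p, a, q) =
     write_nat p @ [Comma] @ write_nat a @ [Comma] @ write_nat q @ [Comma] @
     write_rat (weight A (p, a, q)) @ [Comma] @ write_rat (discount A (p, a, q)) @ [Semicolon]"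

text \<open>States and letters are numbered consecutively from \<open>0\<close>.\<close>

definition numbered :: "(nat, nat) nmda \<Rightarrow> bool" where
  "numbered A \<longleftrightarrow> (\<exists>n k. states A = {..<n} \<and> alphabet A = {..<k})"

text \<open>The threshold, a listing of the transitions with their weights and discount factors, a
  listing of the initial states, the number of states and the number of letters. The order
  matters when the alphabet is empty: the size below then does not bound the number of states,
  and that there are no transitions has to be visible before the initial states are read.\<close>

definition write_instance ::
  "(nat, nat) nmda \<Rightarrow> rat \<Rightarrow> (nat \<times> nat \<times> nat) list \<Rightarrow> nat list \<Rightarrow> symbol list" where
  "write_instance A \<nu> ts qs =
     write_rat \<nu> @ [Bar] @ concat (map (write_trans A) ts) @ [Bar] @
     concat (map (\<lambda>q. write_nat q @ [Semicolon]) qs) @ [Bar] @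
     write_nat (card (states A)) @ [Bar] @ write_nat (card (alphabet A))"

fun encodes :: "(nat, nat) nmda \<times> rat \<Rightarrow> nat list \<Rightarrow> bool" where
  "encodes (A, \<nu>) w \<longleftrightarrow>
     (\<exists>ts qs. distinct ts \<and> set ts = trans A \<and> distinct qs \<and> set qs = initial A \<and>
              w = map symbol_code (write_instance A \<nu> ts qs))"

fun input_size :: "('q, 'a) nmda \<times> rat \<Rightarrow> nat" where
  "input_size (A, \<nu>) =
     Max ({card (trans A), binary_length \<nu>} \<union>
          (\<lambda>t. binary_length (weight A t)) ` trans A \<union>
          (\<lambda>t. binary_length (discount A t)) ` trans A)"

end

theory Submission
  imports Defs
begin

text \<open>A word of value at most \<open>\<nu>\<close> exists iff some nonempty path from an initial state has value at most
  \<open>\<nu>\<close>. In a shortest such path of great length some cycle occurs early. Removing the cycle pushes the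
  value above \<open>\<nu>\<close>, so repeating it forever gives a value below \<open>\<nu>\<close>; as discount factors are integers,
  that value and \<open>\<nu>\<close> have a common denominator of polynomial length, and as discount factors are at
  least \<open>2\<close>, polynomially many repetitions already get below \<open>\<nu>\<close>. Paths of polynomial length therefore
  suffice, and value iteration in exact rational arithmetic finds the best of them; without reducing
  fractions the numbers grow only by a fixed number of bits per round.

  For the machine, tapes are used as stacks of binary trees. The functions on tree-coded data that such
  programs compute in polynomial time are closed under composition, branching and iteration over
  lists as long as the intermediate results stay small, so that polynomial running time reduces to size
  bounds on functions of the logic.\<close>

section \<open>Structured programs as Turing machines\<close>

text \<open>Two measures of size have to be reconciled: the machine sees a word, while the time
  bound speaks about \<open>input_size\<close>. Completeness ties them together. Once there is a
  transition, there are at most as many states, and at most as many letters, as transitions, and the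
  word has at most quadratic length. Without transitions nothing bounds the number of states, so the
  answer has to be found from the threshold alone; hence the early rejection built into the machine.
  Iteration needs explicit size bounds because a loop body that doubles the size of its state is
  polynomial while its iteration is not. In value iteration, choosing a minimum creates no new
  numbers, and a round multiplies denominators by bounded factors only. Repetitions are sought among
  edges, and values are tabulated by first edge, which builds the nonemptiness of paths into the
  table. The repeated edge is taken from the first \<open>m + 1\<close> edges, so that the product
  of the discount factors before and inside the cycle, and with it the common denominator, has
  polynomial bit length.\<close>

datatype com =
    Halt bool
  | Skip
  | Basic "nat list \<Rightarrow> (nat \<times> move) list"
  | Seq com com  (infixr ";;" 60)
  | Cond "nat list \<Rightarrow> bool" com com
  | Loop "nat list \<Rightarrow> bool" com

definition nop :: "nat list \<Rightarrow> (nat \<times> move) list" where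
  "nop xs = map (\<lambda>x. (x, Stay)) xs"

fun cstep :: "com \<Rightarrow> nat list \<Rightarrow> com \<times> (nat \<times> move) list" where
  "cstep (Halt b) xs = (Halt b, nop xs)"
| "cstep Skip xs = (Skip, nop xs)"
| "cstep (Basic f) xs = (Skip, f xs)"
| "cstep (c ;; d) xs = (if c = Skip then (d, nop xs) else (fst (cstep c xs) ;; d, snd (cstep c xs)))"
| "cstep (Cond b c d) xs = (if b xs then c else d, nop xs)"
| "cstep (Loop b c) xs = (if b xs then c ;; Loop b c else Skip, nop xs)"

text \<open>Analogue of the partial derivatives of a regular expression: unfolding a
  \<open>Loop\<close> yields larger commands, yet all of them come from this finite set.\<close>

fun derivs :: "com \<Rightarrow> com set" where
  "derivs (Halt b) = {Halt b}"
| "derivs Skip = {Skip}"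
| "derivs (Basic f) = {Basic f, Skip}"
| "derivs (c ;; d) = (\<lambda>c'. c' ;; d) ` derivs c \<union> derivs d"
| "derivs (Cond b c d) = {Cond b c d} \<union> derivs c \<union> derivs d"
| "derivs (Loop b c) = {Loop b c, Skip} \<union> (\<lambda>c'. c' ;; Loop b c) ` derivs c"

lemma finite_derivs: "finite (derivs c)"
  by (induction c) auto

lemma derivs_refl: "c \<in> derivs c"
  by (induction c) auto

lemma derivs_step: "c' \<in> derivs c \<Longrightarrow> fst (cstep c' xs) \<in> derivs c"
proof (induction c arbitrary: c')
  case (Seq c d)
  then show ?case using derivs_refl[of d] by auto
next
  case (Cond b c d)
  then show ?case using derivs_refl[of c] derivs_refl[of d] by auto
next
  case (Loop b c)
  consider "c' = Loop b c" | "c' = Skip" | e where "c' = e ;; Loop b c" "e \<in> derivs c"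
    using Loop.prems by auto
  then show ?case
    using Loop.IH derivs_refl[of c] by cases auto
qed auto

definition in_range :: "nat \<Rightarrow> nat \<Rightarrow> nat list \<Rightarrow> bool" where
  "in_range k n xs \<longleftrightarrow> length xs = k \<and> set xs \<subseteq> {..<n}"

definition ok_act :: "nat \<Rightarrow> nat \<Rightarrow> (nat list \<Rightarrow> (nat \<times> move) list) \<Rightarrow> bool" where
  "ok_act k n f \<longleftrightarrow> (\<forall>xs. in_range k n xs \<longrightarrow> in_range k n (map fst (f xs)))"

fun ok_com :: "nat \<Rightarrow> nat \<Rightarrow> com \<Rightarrow> bool" where
  "ok_com k n (Halt b) = True"
| "ok_com k n Skip = True"
| "ok_com k n (Basic f) = ok_act k n f"
| "ok_com k n (c ;; d) = (ok_com k n c \<and> ok_com k n d)"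
| "ok_com k n (Cond b c d) = (ok_com k n c \<and> ok_com k n d)"
| "ok_com k n (Loop b c) = ok_com k n c"

lemma ok_com_derivs: "ok_com k n c \<Longrightarrow> derivs c \<subseteq> Collect (ok_com k n)"
  by (induction c) auto

lemma map_fst_nop [simp]: "map fst (nop xs) = xs"
  by (induction xs) (simp_all add: nop_def)

lemma ok_com_step:
  "ok_com k n c \<Longrightarrow> in_range k n xs \<Longrightarrow> in_range k n (map fst (snd (cstep c xs)))"
  by (induction c) (simp_all add: ok_act_def)

section \<open>Step-counted execution of commands and its simulation by a machine\<close>

type_synonym ccfg = "com \<times> tape list"

fun com_step :: "ccfg \<Rightarrow> ccfg" where
  "com_step (c, tps) =
     (fst (cstep c (map read_tape tps)), map2 act_tape (snd (cstep c (map read_tape tps))) tps)"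

lemma act_tape_Stay [simp]: "act_tape (read_tape tp, Stay) tp = tp"
  by (cases tp) simp

lemma act_nop [simp]: "map2 act_tape (nop (map read_tape tps)) tps = tps"
  by (induction tps) (auto simp: nop_def)

text \<open>No step is counted from \<open>Skip\<close>. Only so can an execution of
  \<open>c\<close> be replayed step by step inside \<open>c ;; d\<close>, where a finished
  \<open>c\<close> hands over to \<open>d\<close> instead of idling.\<close>

inductive nsteps :: "nat \<Rightarrow> ccfg \<Rightarrow> ccfg \<Rightarrow> bool" where
  nsteps_0: "nsteps 0 x x"
| nsteps_Suc: "fst x \<noteq> Skip \<Longrightarrow> nsteps t (com_step x) y \<Longrightarrow> nsteps (Suc t) x y"

lemma nsteps_trans: "nsteps s x y \<Longrightarrow> nsteps t y z \<Longrightarrow> nsteps (s + t) x z"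
  by (induction rule: nsteps.induct) (simp_all add: nsteps_Suc)

lemma nsteps_funpow: "nsteps t x y \<Longrightarrow> (com_step ^^ t) x = y"
  by (induction rule: nsteps.induct) (simp_all add: funpow_swap1)

lemma nsteps_Seq:
  "nsteps t x y \<Longrightarrow> nsteps t (fst x ;; d, snd x) (fst y ;; d, snd y)"
proof (induction rule: nsteps.induct)
  case (nsteps_0 x)
  show ?case by (rule nsteps.nsteps_0)
next
  case (nsteps_Suc x t y)
  have "com_step (fst x ;; d, snd x) = (fst (com_step x) ;; d, snd (com_step x))"
    using nsteps_Suc(1) by (cases x) auto
  with nsteps_Suc show ?case by (intro nsteps.nsteps_Suc) auto
qed

text \<open>The states of the machine are the finitely many commands into which the program can evolve.\<close>

definition prog_states :: "com \<Rightarrow> com set" where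
  "prog_states c = derivs c \<union> {Halt True, Halt False}"

definition state_number :: "com \<Rightarrow> com \<Rightarrow> nat" where
  "state_number c = (SOME e. bij_betw e (prog_states c) {..<card (prog_states c)})"

definition tm_of :: "nat \<Rightarrow> nat \<Rightarrow> com \<Rightarrow> tm" where
  "tm_of k n c =
     \<lparr> num_tapes = k, num_symbols = n, num_states = card (prog_states c),
       start_state = state_number c c,
       accept_state = state_number c (Halt True),
       reject_state = state_number c (Halt False),
       next_move = (\<lambda>q xs. let r = cstep (inv_into (prog_states c) (state_number c) q) xs
                           in (state_number c (fst r), snd r)) \<rparr>"

lemma state_number_bij: "bij_betw (state_number c) (prog_states c) {..<card (prog_states c)}"
proof -
  have "finite (prog_states c)"
    by (simp add: prog_states_def finite_derivs)
  from ex_bij_betw_finite_nat[OF this] have "\<exists>e. bij_betw e (prog_states c) {..<card (prog_states c)}"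
    by (simp add: atLeast0LessThan)
  then show ?thesis
    unfolding state_number_def by (rule someI_ex)
qed

lemma state_number_less: "d \<in> prog_states c \<Longrightarrow> state_number c d < card (prog_states c)"
  using state_number_bij[of c] by (auto simp: bij_betw_def)

lemma state_number_eq:
  "d \<in> prog_states c \<Longrightarrow> d' \<in> prog_states c \<Longrightarrow> state_number c d = state_number c d' \<longleftrightarrow> d = d'"
  using state_number_bij[of c] by (auto simp: bij_betw_def inj_on_def)

lemma inv_state_number:
  "d \<in> prog_states c \<Longrightarrow> inv_into (prog_states c) (state_number c) (state_number c d) = d"
  using state_number_bij[of c] by (simp add: bij_betw_def)

lemma prog_states_simps [simp]: "c \<in> prog_states c" "Halt b \<in> prog_states c"
  by (cases b; simp add: prog_states_def derivs_refl)+

lemma prog_states_step: "d \<in> prog_states c \<Longrightarrow> fst (cstep d xs) \<in> prog_states c"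
  using derivs_step[of d c] by (auto simp: prog_states_def)

lemma is_tm_of:
  assumes "ok_com k n c" "k \<ge> 1" "n \<ge> 1"
  shows "is_tm (tm_of k n c)"
proof -
  have range: "in_range k n (map fst (snd (cstep d xs)))"
    if "d \<in> prog_states c" "length xs = k" "set xs \<subseteq> {..<n}" for d xs
  proof (rule ok_com_step)
    show "ok_com k n d"
      using that(1) ok_com_derivs[OF assms(1)] by (auto simp: prog_states_def)
  qed (use that in \<open>simp add: in_range_def\<close>)
  have inv: "inv_into (prog_states c) (state_number c) q \<in> prog_states c"
    if "q < card (prog_states c)" for q
    using that state_number_bij[of c] by (metis bij_betw_def inv_into_into lessThan_iff)
  have "s < n" if "q < card (prog_states c)" "length xs = k" "set xs \<subseteq> {..<n}"
    "(s, m) \<in> set (snd (cstep (inv_into (prog_states c) (state_number c) q) xs))" for q xs s m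
    using range[OF inv[OF that(1)] that(2,3)] that(4) by (force simp: in_range_def)
  moreover have "length (snd (cstep (inv_into (prog_states c) (state_number c) q) xs)) = k"
    if "q < card (prog_states c)" "length xs = k" "set xs \<subseteq> {..<n}" for q xs
    using range[OF inv[OF that(1)] that(2,3)] by (simp add: in_range_def)
  ultimately show ?thesis
    using assms(2,3) inv
    by (auto simp: is_tm_def tm_of_def Let_def state_number_less state_number_eq prog_states_step)
qed

text \<open>Machine and program run in lockstep, one step for one step. At \<open>Halt b\<close> the
  machine is frozen and the program steps to itself without changing the tapes.\<close>

lemma tm_step_tm_of:
  assumes "d \<in> prog_states c"
  shows "tm_step (tm_of k n c) (state_number c d, tps) = apfst (state_number c) (com_step (d, tps))"
proof (cases "\<exists>b. d = Halt b")
  case True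
  then obtain b where "d = Halt b" by blast
  then show ?thesis
    by (cases b) (auto simp: tm_of_def)
next
  case False
  then have "state_number c d \<noteq> state_number c (Halt b)" for b
    using assms by (auto simp: state_number_eq)
  then show ?thesis
    using assms by (simp add: tm_of_def Let_def inv_state_number)
qed

lemma tm_steps_tm_of:
  assumes "d \<in> prog_states c"
  shows "(tm_step (tm_of k n c) ^^ t) (state_number c d, tps)
       = apfst (state_number c) ((com_step ^^ t) (d, tps)) \<and> fst ((com_step ^^ t) (d, tps)) \<in> prog_states c"
proof (induction t)
  case 0
  then show ?case using assms by simp
next
  case (Suc t)
  obtain d' tps' where 1: "(com_step ^^ t) (d, tps) = (d', tps')" by fastforce
  with Suc have "d' \<in> prog_states c"
    "(tm_step (tm_of k n c) ^^ t) (state_number c d, tps) = (state_number c d', tps')"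
    by auto
  then show ?case
    using tm_step_tm_of[of d' c k n tps'] prog_states_step[of d' c] 1 by auto
qed

text \<open>\<open>accepts_within\<close> inspects the configuration after exactly \<open>n\<close>
  steps; as \<open>Halt b\<close> is a fixed point, every \<open>t\<close> beyond the halting time
  shows the same verdict.\<close>

lemma tm_of_halts:
  assumes "nsteps s (c, snd (init_config (tm_of k n c) w)) (Halt b, tps)" "s \<le> t"
  shows "fst ((tm_step (tm_of k n c) ^^ t) (init_config (tm_of k n c) w)) = state_number c (Halt b)"
proof -
  have halt: "(com_step ^^ m) (Halt b, tps) = (Halt b, tps)" for m
    by (induction m) auto
  obtain m where m: "t = m + s" using assms(2) by (metis add.commute le_Suc_ex)
  have "(com_step ^^ t) (c, snd (init_config (tm_of k n c) w)) = (Halt b, tps)"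
    using nsteps_funpow[OF assms(1)] halt[of m] by (simp add: m funpow_add)
  moreover have "init_config (tm_of k n c) w
      = (state_number c c, snd (init_config (tm_of k n c) w))"
    by (simp add: init_config_def tm_of_def)
  ultimately show ?thesis
    using tm_steps_tm_of[of c c t k n "snd (init_config (tm_of k n c) w)"] by simp
qed

section \<open>Tapes as stacks\<close>

text \<open>The head position stays a parameter because pushing and popping move it. All cells left
  of the head are blank, which is why a pop erases before it moves.\<close>

definition stack_tape :: "nat list \<Rightarrow> int \<Rightarrow> tape" where
  "stack_tape xs h = (\<lambda>i. if h \<le> i \<and> nat (i - h) < length xs then xs ! nat (i - h) else 0, h)"

fun top_of :: "nat list \<Rightarrow> nat" where
  "top_of [] = 0"
| "top_of (x # xs) = x"

lemma input_tape_eq: "input_tape w = stack_tape w 0"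
  by (auto simp: input_tape_def stack_tape_def fun_eq_iff)

lemma read_stack_tape [simp]: "read_tape (stack_tape xs h) = top_of xs"
  by (cases xs) (auto simp: stack_tape_def)

lemma act_pop: "act_tape (0, Right) (stack_tape xs h) = stack_tape (tl xs) (h + 1)"
proof (cases xs)
  case (Cons x ys)
  have "nat (i - h) = Suc (nat (i - (h + 1)))" if "h + 1 \<le> i" for i
    using that by linarith
  then show ?thesis
    by (auto simp: stack_tape_def Cons fun_eq_iff)
qed (auto simp: stack_tape_def)

text \<open>An action writes before it moves, so a push takes two actions: rewrite the old top
  unchanged and step left onto a blank, then write there.\<close>

lemma act_push: "act_tape (top_of xs, Left) (stack_tape xs h) = stack_tape (0 # xs) (h - 1)"
proof -
  have "nat (i - (h - 1)) = Suc (nat (i - h))" if "h \<le> i" for i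
    using that by linarith
  moreover have "i = h - 1" if "h - 1 \<le> i" "\<not> h \<le> i" for i
    using that by linarith
  ultimately show ?thesis
    by (cases xs) (auto simp: stack_tape_def fun_eq_iff)
qed

lemma act_write: "act_tape (a, Stay) (stack_tape (x # xs) h) = stack_tape (a # xs) h"
proof -
  have "nat (i - h) = Suc (nat (i - (h + 1)))" if "h \<le> i" "i \<noteq> h" for i
    using that by linarith
  then show ?thesis
    by (auto simp: stack_tape_def fun_eq_iff)
qed

text \<open>Every tape serves as a stack that grows to the left, with its top under the head; the initial
  configuration is then the input word as a stack next to three empty stacks.\<close>

type_synonym stacks = "nat \<Rightarrow> nat list"

definition rep :: "tape list \<Rightarrow> stacks \<Rightarrow> bool" where
  "rep tps \<sigma> \<longleftrightarrow> (\<exists>hs. tps = map (\<lambda>i. stack_tape (\<sigma> i) (hs i)) [0..<4])"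

definition tops :: "stacks \<Rightarrow> nat list" where
  "tops \<sigma> = map (\<lambda>i. top_of (\<sigma> i)) [0..<4]"

lemma tops_nth [simp]: "i < 4 \<Longrightarrow> tops \<sigma> ! i = top_of (\<sigma> i)"
  by (simp add: tops_def)

lemma length_tops [simp]: "length (tops \<sigma>) = 4"
  by (simp add: tops_def)

lemma rep_read: "rep tps \<sigma> \<Longrightarrow> map read_tape tps = tops \<sigma>"
  by (auto simp: rep_def tops_def)

text \<open>All head positions are covered at once by \<open>rep\<close>, and \<open>t\<close> is
  only an upper bound, so that bounds can be rounded up freely.\<close>

definition terminates :: "com \<Rightarrow> stacks \<Rightarrow> stacks \<Rightarrow> nat \<Rightarrow> bool" where
  "terminates c \<sigma> \<sigma>' t \<longleftrightarrow>
     (\<forall>tps. rep tps \<sigma> \<longrightarrow> (\<exists>t' tps'. t' \<le> t \<and> rep tps' \<sigma>' \<and> nsteps t' (c, tps) (Skip, tps')))"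

definition halts :: "com \<Rightarrow> stacks \<Rightarrow> bool \<Rightarrow> nat \<Rightarrow> bool" where
  "halts c \<sigma> b t \<longleftrightarrow>
     (\<forall>tps. rep tps \<sigma> \<longrightarrow> (\<exists>t' tps'. t' \<le> t \<and> nsteps t' (c, tps) (Halt b, tps')))"

section \<open>Time bounds for sequencing, branching and looping\<close>

lemma terminates_mono: "terminates c \<sigma> \<sigma>' t \<Longrightarrow> t \<le> u \<Longrightarrow> terminates c \<sigma> \<sigma>' u"
  unfolding terminates_def by (meson order_trans)

lemma halts_mono: "halts c \<sigma> b t \<Longrightarrow> t \<le> u \<Longrightarrow> halts c \<sigma> b u"
  unfolding halts_def by (meson order_trans)

lemma terminates_Skip: "terminates Skip \<sigma> \<sigma> 0"
  unfolding terminates_def using nsteps_0 by blast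

lemma halts_Halt: "halts (Halt b) \<sigma> b 0"
  unfolding halts_def using nsteps_0 by blast

lemma nsteps_Seq_trans:
  assumes "nsteps s (c, x) (Skip, y)" "nsteps t (d, y) z"
  shows "nsteps (Suc (s + t)) (c ;; d, x) z"
proof -
  have "nsteps s (c ;; d, x) (Skip ;; d, y)"
    using nsteps_Seq[OF assms(1), of d] by simp
  moreover have "nsteps (Suc t) (Skip ;; d, y) z"
    using assms(2) by (intro nsteps_Suc) simp_all
  ultimately show ?thesis
    using nsteps_trans by fastforce
qed

lemma terminates_Seq:
  assumes "terminates c \<sigma> \<sigma>1 t1" "terminates d \<sigma>1 \<sigma>2 t2"
  shows "terminates (c ;; d) \<sigma> \<sigma>2 (t1 + t2 + 1)"
  unfolding terminates_def
proof (intro allI impI)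
  fix tps assume "rep tps \<sigma>"
  then obtain u1 tps1 where 1: "u1 \<le> t1" "rep tps1 \<sigma>1" "nsteps u1 (c, tps) (Skip, tps1)"
    using assms(1) unfolding terminates_def by blast
  then obtain u2 tps2 where 2: "u2 \<le> t2" "rep tps2 \<sigma>2" "nsteps u2 (d, tps1) (Skip, tps2)"
    using assms(2) unfolding terminates_def by blast
  have "Suc (u1 + u2) \<le> t1 + t2 + 1" using 1 2 by simp
  then show "\<exists>t' tps'. t' \<le> t1 + t2 + 1 \<and> rep tps' \<sigma>2 \<and> nsteps t' (c ;; d, tps) (Skip, tps')"
    using 2(2) nsteps_Seq_trans[OF 1(3) 2(3)] by blast
qed

lemma halts_Seq:
  assumes "terminates c \<sigma> \<sigma>1 t1" "halts d \<sigma>1 b t2"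
  shows "halts (c ;; d) \<sigma> b (t1 + t2 + 1)"
  unfolding halts_def
proof (intro allI impI)
  fix tps assume "rep tps \<sigma>"
  then obtain u1 tps1 where 1: "u1 \<le> t1" "rep tps1 \<sigma>1" "nsteps u1 (c, tps) (Skip, tps1)"
    using assms(1) unfolding terminates_def by blast
  then obtain u2 tps2 where 2: "u2 \<le> t2" "nsteps u2 (d, tps1) (Halt b, tps2)"
    using assms(2) unfolding halts_def by blast
  have "Suc (u1 + u2) \<le> t1 + t2 + 1" using 1 2 by simp
  then show "\<exists>t' tps'. t' \<le> t1 + t2 + 1 \<and> nsteps t' (c ;; d, tps) (Halt b, tps')"
    using nsteps_Seq_trans[OF 1(3) 2(2)] by blast
qed

text \<open>Common core of entering a \<open>Cond\<close> and of entering or leaving a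
  \<open>Loop\<close>: one step that changes the command but no tape.\<close>

lemma terminates_step:
  assumes "terminates d \<sigma> \<sigma>' t" "c \<noteq> Skip" "cstep c (tops \<sigma>) = (d, nop (tops \<sigma>))"
  shows "terminates c \<sigma> \<sigma>' (t + 1)"
  unfolding terminates_def
proof (intro allI impI)
  fix tps assume r: "rep tps \<sigma>"
  then obtain u tps' where 1: "u \<le> t" "rep tps' \<sigma>'" "nsteps u (d, tps) (Skip, tps')"
    using assms(1) unfolding terminates_def by blast
  have "com_step (c, tps) = (d, tps)"
    using rep_read[OF r] assms(3) act_nop[of tps] by simp
  then have "nsteps (Suc u) (c, tps) (Skip, tps')"
    using assms(2) 1(3) by (intro nsteps_Suc) simp_all
  then show "\<exists>t' tps'. t' \<le> t + 1 \<and> rep tps' \<sigma>' \<and> nsteps t' (c, tps) (Skip, tps')"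
    using 1 by (intro exI[of _ "Suc u"] exI[of _ tps']) simp
qed

lemma halts_step:
  assumes "halts d \<sigma> b t" "c \<noteq> Skip" "cstep c (tops \<sigma>) = (d, nop (tops \<sigma>))"
  shows "halts c \<sigma> b (t + 1)"
  unfolding halts_def
proof (intro allI impI)
  fix tps assume r: "rep tps \<sigma>"
  then obtain u tps' where 1: "u \<le> t" "nsteps u (d, tps) (Halt b, tps')"
    using assms(1) unfolding halts_def by blast
  have "com_step (c, tps) = (d, tps)"
    using rep_read[OF r] assms(3) act_nop[of tps] by simp
  then have "nsteps (Suc u) (c, tps) (Halt b, tps')"
    using assms(2) 1(2) by (intro nsteps_Suc) simp_all
  then show "\<exists>t' tps'. t' \<le> t + 1 \<and> nsteps t' (c, tps) (Halt b, tps')"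
    using 1 by (intro exI[of _ "Suc u"] exI[of _ tps']) simp
qed

lemma terminates_Cond_True:
  "b (tops \<sigma>) \<Longrightarrow> terminates c \<sigma> \<sigma>' t \<Longrightarrow> terminates (Cond b c d) \<sigma> \<sigma>' (t + 1)"
  by (erule terminates_step[of c]) simp_all

lemma terminates_Cond_False:
  "\<not> b (tops \<sigma>) \<Longrightarrow> terminates d \<sigma> \<sigma>' t \<Longrightarrow> terminates (Cond b c d) \<sigma> \<sigma>' (t + 1)"
  by (erule terminates_step[of d]) simp_all

lemma halts_Cond_True:
  "b (tops \<sigma>) \<Longrightarrow> halts c \<sigma> v t \<Longrightarrow> halts (Cond b c d) \<sigma> v (t + 1)"
  by (erule halts_step[of c]) simp_all

lemma halts_Cond_False:
  "\<not> b (tops \<sigma>) \<Longrightarrow> halts d \<sigma> v t \<Longrightarrow> halts (Cond b c d) \<sigma> v (t + 1)"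
  by (erule halts_step[of d]) simp_all

lemma terminates_Loop_exit: "\<not> b (tops \<sigma>) \<Longrightarrow> terminates (Loop b c) \<sigma> \<sigma> 1"
  using terminates_step[OF terminates_Skip, of "Loop b c" \<sigma>] by simp

text \<open>Besides the body, a round costs two steps: one for testing and unfolding, one for
  passing from the finished body back to the loop.\<close>

lemma terminates_Loop_step:
  assumes "b (tops \<sigma>)" "terminates c \<sigma> \<sigma>1 t1" "terminates (Loop b c) \<sigma>1 \<sigma>2 t2"
  shows "terminates (Loop b c) \<sigma> \<sigma>2 (t1 + t2 + 2)"
  using terminates_step[OF terminates_Seq[OF assms(2,3)], of "Loop b c"] assms(1)
  by simp

section \<open>Pushing, popping and moving between stacks\<close>

definition act_on :: "nat \<Rightarrow> (nat list \<Rightarrow> nat \<times> move) \<Rightarrow> com" where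
  "act_on i g = Basic (\<lambda>xs. (nop xs)[i := g xs])"

lemma ok_act_on:
  assumes "i < k" "\<And>xs. in_range k n xs \<Longrightarrow> fst (g xs) < n"
  shows "ok_com k n (act_on i g)"
  unfolding act_on_def ok_com.simps ok_act_def
proof (intro allI impI)
  fix xs assume xs: "in_range k n xs"
  have "map fst ((nop xs)[i := g xs]) = xs[i := fst (g xs)]"
    by (simp add: map_update)
  then show "in_range k n (map fst ((nop xs)[i := g xs]))"
    using xs assms(2)[OF xs] set_update_subset_insert[of xs i "fst (g xs)"]
    by (auto simp: in_range_def)
qed

lemma terminates_act_on:
  assumes "i < 4" "\<And>h. \<exists>h'. act_tape (g (tops \<sigma>)) (stack_tape (\<sigma> i) h) = stack_tape ys h'"
  shows "terminates (act_on i g) \<sigma> (\<sigma>(i := ys)) 1"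
  unfolding terminates_def
proof (intro allI impI)
  fix tps assume r: "rep tps \<sigma>"
  then obtain hs where hs: "tps = map (\<lambda>i. stack_tape (\<sigma> i) (hs i)) [0..<4]"
    by (auto simp: rep_def)
  obtain h' where h': "act_tape (g (tops \<sigma>)) (stack_tape (\<sigma> i) (hs i)) = stack_tape ys h'"
    using assms(2) by blast
  have len: "length tps = 4" by (simp add: hs)
  define tps' where "tps' = map2 act_tape ((nop (map read_tape tps))[i := g (tops \<sigma>)]) tps"
  have "tps' = map (\<lambda>j. stack_tape ((\<sigma>(i := ys)) j) ((hs(i := h')) j)) [0..<4]"
  proof (rule nth_equalityI)
    fix j assume "j < length tps'"
    then have j: "j < 4" by (simp add: tps'_def len nop_def)
    show "tps' ! j = map (\<lambda>j. stack_tape ((\<sigma>(i := ys)) j) ((hs(i := h')) j)) [0..<4] ! j"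
    proof (cases "j = i")
      case True
      then show ?thesis using j h' by (simp add: tps'_def len nop_def hs)
    next
      case False
      then have "tps' ! j = act_tape (read_tape (tps ! j), Stay) (tps ! j)"
        using j by (simp add: tps'_def len nop_def)
      then show ?thesis
        using False j act_tape_Stay[of "stack_tape (\<sigma> j) (hs j)"] by (simp add: hs)
    qed
  qed (simp add: tps'_def len nop_def)
  then have "rep tps' (\<sigma>(i := ys))"
    unfolding rep_def by blast
  moreover have "com_step (act_on i g, tps) = (Skip, tps')"
    using rep_read[OF r] by (simp add: act_on_def tps'_def)
  then have "nsteps (Suc 0) (act_on i g, tps) (Skip, tps')"
    by (intro nsteps_Suc) (simp_all add: act_on_def nsteps_0)
  ultimately show "\<exists>t' tps''. t' \<le> 1 \<and> rep tps'' (\<sigma>(i := ys)) \<and> nsteps t' (act_on i g, tps) (Skip, tps'')"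
    by (intro exI[of _ "Suc 0"] exI[of _ tps']) simp
qed

definition pop :: "nat \<Rightarrow> com" where
  "pop i = act_on i (\<lambda>_. (0, Right))"

definition push_blank :: "nat \<Rightarrow> com" where
  "push_blank i = act_on i (\<lambda>xs. (xs ! i, Left))"

definition push :: "nat \<Rightarrow> nat \<Rightarrow> com" where
  "push i a = push_blank i ;; act_on i (\<lambda>_. (a, Stay))"

definition copy_top :: "nat \<Rightarrow> nat \<Rightarrow> com" where
  "copy_top i j = push_blank j ;; act_on j (\<lambda>xs. (xs ! i, Stay))"

lemma terminates_pop: "i < 4 \<Longrightarrow> terminates (pop i) \<sigma> (\<sigma>(i := tl (\<sigma> i))) 1"
  unfolding pop_def by (rule terminates_act_on) (auto simp: act_pop)

lemma terminates_push_blank: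
  "i < 4 \<Longrightarrow> terminates (push_blank i) \<sigma> (\<sigma>(i := 0 # \<sigma> i)) 1"
  unfolding push_blank_def by (rule terminates_act_on) (auto simp: act_push)

lemma terminates_push:
  assumes "i < 4"
  shows "terminates (push i a) \<sigma> (\<sigma>(i := a # \<sigma> i)) 3"
proof -
  have "terminates (act_on i (\<lambda>_. (a, Stay))) (\<sigma>(i := 0 # \<sigma> i)) ((\<sigma>(i := 0 # \<sigma> i))(i := a # \<sigma> i)) 1"
    using assms by (intro terminates_act_on) (auto simp: act_write)
  from terminates_Seq[OF terminates_push_blank[OF assms] this] show ?thesis
    by (simp add: push_def eval_nat_numeral)
qed

lemma terminates_copy_top:
  assumes "i < 4" "j < 4" "i \<noteq> j"
  shows "terminates (copy_top i j) \<sigma> (\<sigma>(j := top_of (\<sigma> i) # \<sigma> j)) 3"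
proof -
  have "terminates (act_on j (\<lambda>xs. (xs ! i, Stay))) (\<sigma>(j := 0 # \<sigma> j))
      ((\<sigma>(j := 0 # \<sigma> j))(j := top_of (\<sigma> i) # \<sigma> j)) 1"
    using assms by (intro terminates_act_on) (auto simp: act_write)
  from terminates_Seq[OF terminates_push_blank[OF assms(2)] this] show ?thesis
    by (simp add: copy_top_def eval_nat_numeral)
qed

lemma ok_basics [simp]:
  "i < 4 \<Longrightarrow> ok_com 4 8 (pop i)"
  "i < 4 \<Longrightarrow> ok_com 4 8 (push_blank i)"
  "i < 4 \<Longrightarrow> a < 8 \<Longrightarrow> ok_com 4 8 (push i a)"
  "i < 4 \<Longrightarrow> j < 4 \<Longrightarrow> ok_com 4 8 (copy_top i j)"
proof -
  have *: "xs ! j < n" if "in_range k n xs" "j < k" for xs j k n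
    using that unfolding in_range_def by (metis lessThan_iff nth_mem subsetD)
  show "i < 4 \<Longrightarrow> ok_com 4 8 (pop i)"
    unfolding pop_def by (rule ok_act_on) auto
  show pb: "i < 4 \<Longrightarrow> ok_com 4 8 (push_blank i)" for i
    unfolding push_blank_def by (rule ok_act_on) (auto intro: *)
  show "i < 4 \<Longrightarrow> a < 8 \<Longrightarrow> ok_com 4 8 (push i a)"
    unfolding push_def by (simp add: pb ok_act_on)
  show "i < 4 \<Longrightarrow> j < 4 \<Longrightarrow> ok_com 4 8 (copy_top i j)"
    unfolding copy_top_def by (simp add: pb) (rule ok_act_on, auto intro: *)
qed

definition move_top :: "nat \<Rightarrow> nat \<Rightarrow> com" where
  "move_top i j = copy_top i j ;; pop i"

lemma terminates_move_top:
  assumes "i < 4" "j < 4" "i \<noteq> j"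
  shows "terminates (move_top i j) \<sigma> (\<sigma>(i := tl (\<sigma> i), j := top_of (\<sigma> i) # \<sigma> j)) 5"
  using terminates_Seq[OF terminates_copy_top[OF assms] terminates_pop[OF assms(1)]] assms(3)
  by (simp add: move_top_def eval_nat_numeral fun_upd_twist)

definition move_all :: "nat \<Rightarrow> nat \<Rightarrow> com" where
  "move_all i j = Loop (\<lambda>xs. xs ! i \<noteq> 0) (move_top i j)"

text \<open>The end of a stack is recognised by a blank, so the contents must avoid
  \<open>0\<close>. Each symbol costs five steps for the move and two for the loop.\<close>

lemma terminates_move_all:
  assumes "i < 4" "j < 4" "i \<noteq> j"
  shows "0 \<notin> set (\<sigma> i) \<Longrightarrow>
    terminates (move_all i j) \<sigma> (\<sigma>(i := [], j := rev (\<sigma> i) @ \<sigma> j)) (7 * length (\<sigma> i) + 1)"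
proof (induction "\<sigma> i" arbitrary: \<sigma>)
  case Nil
  then have "\<sigma> = \<sigma>(i := [], j := rev (\<sigma> i) @ \<sigma> j)" by (auto simp: fun_eq_iff)
  then show ?case
    unfolding move_all_def using Nil assms terminates_Loop_exit[of "\<lambda>xs. xs ! i \<noteq> 0" \<sigma>]
    by (metis (no_types, lifting) length_tops top_of.simps(1) tops_nth add_0 list.size(3) mult_0_right)
next
  case (Cons x xs)
  let ?s = "\<sigma>(i := xs, j := x # \<sigma> j)"
  have s: "?s i = xs" using assms by simp
  have "terminates (move_all i j) ?s (?s(i := [], j := rev (?s i) @ ?s j)) (7 * length (?s i) + 1)"
    using Cons(1)[of ?s] Cons(2,3) assms by (metis list.set_intros(2) s)
  moreover have "?s(i := [], j := rev (?s i) @ ?s j) = \<sigma>(i := [], j := rev (\<sigma> i) @ \<sigma> j)"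
    using assms Cons(2)[symmetric] by (auto simp: fun_eq_iff)
  moreover have "terminates (move_top i j) \<sigma> ?s 5"
    using terminates_move_top[OF assms, of \<sigma>] Cons(2)[symmetric] by simp
  moreover have "tops \<sigma> ! i \<noteq> 0"
    using Cons(2)[symmetric] Cons(3) assms by simp
  ultimately show ?case
    unfolding move_all_def using terminates_Loop_step[of "\<lambda>xs. xs ! i \<noteq> 0" \<sigma> "move_top i j" ?s 5]
      Cons(2)[symmetric] s by (fastforce intro: terminates_mono)
qed

lemma ok_moves [simp]:
  "i < 4 \<Longrightarrow> j < 4 \<Longrightarrow> ok_com 4 8 (move_top i j)"
  "i < 4 \<Longrightarrow> j < 4 \<Longrightarrow> ok_com 4 8 (move_all i j)"
  by (simp_all add: move_top_def move_all_def)

section \<open>Stacks of trees\<close>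

text \<open>The code of a tree is self-delimiting: a stack can hold the codes of several trees in a row, and
  pushing a single \<open>2\<close> joins the two topmost trees.\<close>

datatype tree = Leaf | Node tree tree

fun code :: "tree \<Rightarrow> nat list" where
  "code Leaf = [1]"
| "code (Node l r) = 2 # code l @ code r"

definition tsize :: "tree \<Rightarrow> nat" where
  "tsize t = length (code t)"

lemma tsize_simps [simp]: "tsize Leaf = 1" "tsize (Node l r) = Suc (tsize l + tsize r)"
  by (simp_all add: tsize_def)

lemma set_code: "set (code t) \<subseteq> {1, 2}"
  by (induction t) auto

lemma zero_notin_code [simp]: "0 \<notin> set (code t)"
  using set_code[of t] by auto

text \<open>The tapes have fixed roles: tape 1 is the main stack of trees, tapes 0 and 2 are
  buffers, tape 3 is the counter of \<open>get_loop\<close>.\<close>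

definition stk :: "nat list \<Rightarrow> nat list \<Rightarrow> nat list \<Rightarrow> nat list \<Rightarrow> stacks" where
  "stk a m b c = (\<lambda>_. [])(0 := a, 1 := m, 2 := b, 3 := c)"

lemma stk_simps [simp]:
  "stk a m b c 0 = a" "stk a m b c 1 = m" "stk a m b c (Suc 0) = m" "stk a m b c 2 = b" "stk a m b c 3 = c"
  "(stk a m b c)(0 := x) = stk x m b c"
  "(stk a m b c)(1 := x) = stk a x b c"
  "(stk a m b c)(Suc 0 := x) = stk a x b c"
  "(stk a m b c)(2 := x) = stk a m x c"
  "(stk a m b c)(3 := x) = stk a m b x"
  by (auto simp: stk_def fun_eq_iff)

text \<open>Codes are in prefix notation: a \<open>2\<close> replaces one pending tree by two, a
  \<open>1\<close> completes one. The code ends where the number of pending trees reaches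
  zero.\<close>

definition get_loop :: com where
  "get_loop = Loop (\<lambda>xs. xs ! 3 \<noteq> 0)
     (Cond (\<lambda>xs. xs ! 1 = 2) (push 3 1) (pop 3) ;; move_top 1 0)"

text \<open>Stated with the rest of the execution as a premise. In this continuation form a whole
  tree can be handled by structural induction while other trees are still pending.\<close>

lemma get_loop_step:
  assumes "terminates get_loop (stk (x # a) m b (if x = 2 then 1 # c # cs else cs)) \<sigma> t"
    "c \<noteq> 0"
  shows "terminates get_loop (stk a (x # m) b (c # cs)) \<sigma> (t + 12)"
proof -
  let ?c' = "if x = 2 then 1 # c # cs else cs"
  have "terminates (Cond (\<lambda>xs. xs ! 1 = 2) (push 3 1) (pop 3)) (stk a (x # m) b (c # cs))
      (stk a (x # m) b ?c') 4"
  proof (cases "x = 2")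
    case True
    have "terminates (push 3 1) (stk a (x # m) b (c # cs)) (stk a (x # m) b (1 # c # cs)) 3"
      using terminates_push[of 3 1 "stk a (x # m) b (c # cs)"] by simp
    from terminates_Cond_True[OF _ this, of "\<lambda>xs. xs ! 1 = 2"] True show ?thesis
      by simp
  next
    case False
    have "terminates (pop 3) (stk a (x # m) b (c # cs)) (stk a (x # m) b cs) 1"
      using terminates_pop[of 3 "stk a (x # m) b (c # cs)"] by simp
    from terminates_mono[OF terminates_Cond_False[OF _ this, of "\<lambda>xs. xs ! 1 = 2" "push 3 1"], of 4]
    show ?thesis using False by simp
  qed
  moreover have "terminates (move_top 1 0) (stk a (x # m) b ?c') (stk (x # a) m b ?c') 5"
    using terminates_move_top[of 1 0 "stk a (x # m) b ?c'"] by simp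
  ultimately have "terminates (Cond (\<lambda>xs. xs ! 1 = 2) (push 3 1) (pop 3) ;; move_top 1 0)
      (stk a (x # m) b (c # cs)) (stk (x # a) m b ?c') 10"
    using terminates_Seq by fastforce
  from terminates_Loop_step[OF _ this, of "\<lambda>xs. xs ! 3 \<noteq> 0"] assms show ?thesis
    unfolding get_loop_def by (fastforce intro: terminates_mono)
qed

text \<open>The counter stack holds as many marks as there are trees still to be moved.\<close>

lemma get_loop_tree:
  "terminates get_loop (stk (rev (code t) @ a) m b cs) \<sigma> u \<Longrightarrow>
   terminates get_loop (stk a (code t @ m) b (1 # cs)) \<sigma> (u + 12 * tsize t)"
proof (induction t arbitrary: a m cs u)
  case Leaf
  then show ?case using get_loop_step[of 1 a m b 1 cs] by simp
next
  case (Node l r)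
  \<comment> \<open>Continuations are composed from the end: the right subtree is moved last, so its
    hypothesis is used first.\<close>
  have "terminates get_loop (stk (rev (code l) @ 2 # a) (code r @ m) b (1 # cs)) \<sigma> (u + 12 * tsize r)"
    using Node.prems by (intro Node.IH(2)) simp
  then have "terminates get_loop (stk (2 # a) (code l @ code r @ m) b (1 # 1 # cs)) \<sigma>
      (u + 12 * tsize r + 12 * tsize l)"
    by (rule Node.IH(1))
  then have "terminates get_loop (stk a (2 # code l @ code r @ m) b (1 # cs)) \<sigma>
      (u + 12 * tsize r + 12 * tsize l + 12)"
    by (intro get_loop_step) simp_all
  then show ?case by (simp add: algebra_simps)
qed

definition get_tree :: com where
  "get_tree = push 3 1 ;; get_loop"

lemma terminates_get_tree:
  "terminates get_tree (stk a (code t @ m) b []) (stk (rev (code t) @ a) m b []) (12 * tsize t + 5)"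
proof -
  have "terminates get_loop (stk (rev (code t) @ a) m b []) (stk (rev (code t) @ a) m b []) 1"
    unfolding get_loop_def by (rule terminates_Loop_exit) simp
  note 1 = get_loop_tree[OF this]
  have "terminates (push 3 1) (stk a (code t @ m) b []) (stk a (code t @ m) b [1]) 3"
    using terminates_push[of 3 1 "stk a (code t @ m) b []"] by simp
  from terminates_Seq[OF this 1] show ?thesis
    by (simp add: get_tree_def algebra_simps)
qed

lemma terminates_move_stk:
  "0 \<notin> set a \<Longrightarrow> terminates (move_all 0 1) (stk a m b c) (stk [] (rev a @ m) b c) (7 * length a + 1)"
  "0 \<notin> set a \<Longrightarrow> terminates (move_all 0 2) (stk a m b c) (stk [] m (rev a @ b) c) (7 * length a + 1)"
  "0 \<notin> set b \<Longrightarrow> terminates (move_all 2 0) (stk a m b c) (stk (rev b @ a) m [] c) (7 * length b + 1)"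
  "0 \<notin> set b \<Longrightarrow> terminates (move_all 2 3) (stk a m b c) (stk a m [] (rev b @ c)) (7 * length b + 1)"
  "0 \<notin> set c \<Longrightarrow> terminates (move_all 3 1) (stk a m b c) (stk a (rev c @ m) b []) (7 * length c + 1)"
  using terminates_move_all[of 0 1 "stk a m b c"] terminates_move_all[of 0 2 "stk a m b c"]
    terminates_move_all[of 2 0 "stk a m b c"] terminates_move_all[of 2 3 "stk a m b c"]
    terminates_move_all[of 3 1 "stk a m b c"] by simp_all

text \<open>Every move reverses a code, so each tree has to be moved an even number of times. The
  upper one travels along tapes 1, 0, 2, 3, 1 and the lower one along 1, 0, 1.\<close>

definition swap_trees :: com where
  "swap_trees = get_tree ;; move_all 0 2 ;; get_tree ;; move_all 2 3 ;; move_all 3 1 ;; move_all 0 1"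

lemma terminates_swap:
  "terminates swap_trees (stk [] (code s @ code t @ m) [] []) (stk [] (code t @ code s @ m) [] [])
     (40 * (tsize s + tsize t) + 30)"
proof -
  have 1: "terminates get_tree (stk [] (code s @ code t @ m) [] [])
      (stk (rev (code s)) (code t @ m) [] []) (12 * tsize s + 5)"
    using terminates_get_tree[of "[]" s "code t @ m" "[]"] by simp
  have 2: "terminates (move_all 0 2) (stk (rev (code s)) (code t @ m) [] [])
      (stk [] (code t @ m) (code s) []) (7 * tsize s + 1)"
    using terminates_move_stk(2)[of "rev (code s)" "code t @ m" "[]" "[]"] by (simp add: tsize_def)
  have 3: "terminates get_tree (stk [] (code t @ m) (code s) [])
      (stk (rev (code t)) m (code s) []) (12 * tsize t + 5)"
    using terminates_get_tree[of "[]" t "m"] by simp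
  have 4: "terminates (move_all 2 3) (stk (rev (code t)) m (code s) [])
      (stk (rev (code t)) m [] (rev (code s))) (7 * tsize s + 1)"
    using terminates_move_stk(4)[of "code s" "rev (code t)" m "[]"] by (simp add: tsize_def)
  have 5: "terminates (move_all 3 1) (stk (rev (code t)) m [] (rev (code s)))
      (stk (rev (code t)) (code s @ m) [] []) (7 * tsize s + 1)"
    using terminates_move_stk(5)[of "rev (code s)" "rev (code t)" m "[]"] by (simp add: tsize_def)
  have 6: "terminates (move_all 0 1) (stk (rev (code t)) (code s @ m) [] [])
      (stk [] (code t @ code s @ m) [] []) (7 * tsize t + 1)"
    using terminates_move_stk(1)[of "rev (code t)" "code s @ m" "[]" "[]"] by (simp add: tsize_def)
  show ?thesis unfolding swap_trees_def
    by (rule terminates_mono[OF terminates_Seq[OF 1 terminates_Seq[OF 2 terminates_Seq[OF 3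
      terminates_Seq[OF 4 terminates_Seq[OF 5 6]]]]]]) (simp add: algebra_simps)
qed

definition drop_tree :: com where
  "drop_tree = get_tree ;; Loop (\<lambda>xs. xs ! 0 \<noteq> 0) (pop 0)"

lemma terminates_clear:
  "0 \<notin> set a \<Longrightarrow>
   terminates (Loop (\<lambda>xs. xs ! 0 \<noteq> 0) (pop 0)) (stk a m b c) (stk [] m b c) (3 * length a + 1)"
proof (induction a)
  case Nil
  then show ?case using terminates_Loop_exit[of "\<lambda>xs. xs ! 0 \<noteq> 0" "stk [] m b c"] by simp
next
  case (Cons x a)
  have "terminates (pop 0) (stk (x # a) m b c) (stk a m b c) 1"
    using terminates_pop[of 0 "stk (x # a) m b c"] by simp
  from terminates_Loop_step[OF _ this, of "\<lambda>xs. xs ! 0 \<noteq> 0"] Cons show ?case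
    by (fastforce intro: terminates_mono)
qed

lemma terminates_drop:
  "terminates drop_tree (stk [] (code t @ m) [] []) (stk [] m [] []) (15 * tsize t + 7)"
proof -
  have "terminates get_tree (stk [] (code t @ m) [] []) (stk (rev (code t)) m [] []) (12 * tsize t + 5)"
    using terminates_get_tree[of "[]" t m "[]"] by simp
  moreover have "terminates (Loop (\<lambda>xs. xs ! 0 \<noteq> 0) (pop 0)) (stk (rev (code t)) m [] [])
      (stk [] m [] []) (3 * tsize t + 1)"
    using terminates_clear[of "rev (code t)" m "[]" "[]"] by (simp add: tsize_def)
  ultimately show ?thesis
    unfolding drop_tree_def using terminates_Seq by (fastforce intro: terminates_mono)
qed

definition copy_loop :: com where
  "copy_loop = Loop (\<lambda>xs. xs ! 0 \<noteq> 0) (copy_top 0 1 ;; move_top 0 2)"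

lemma terminates_copy_loop:
  "0 \<notin> set a \<Longrightarrow>
   terminates copy_loop (stk a m b c) (stk [] (rev a @ m) (rev a @ b) c) (11 * length a + 1)"
proof (induction a arbitrary: m b)
  case Nil
  then show ?case
    unfolding copy_loop_def using terminates_Loop_exit[of "\<lambda>xs. xs ! 0 \<noteq> 0" "stk [] m b c"] by simp
next
  case (Cons x a)
  have "terminates (copy_top 0 1) (stk (x # a) m b c) (stk (x # a) (x # m) b c) 3"
    using terminates_copy_top[of 0 1 "stk (x # a) m b c"] by simp
  moreover have "terminates (move_top 0 2) (stk (x # a) (x # m) b c) (stk a (x # m) (x # b) c) 5"
    using terminates_move_top[of 0 2 "stk (x # a) (x # m) b c"] by simp
  ultimately have 1: "terminates (copy_top 0 1 ;; move_top 0 2) (stk (x # a) m b c)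
      (stk a (x # m) (x # b) c) 9"
    using terminates_Seq by fastforce
  have "terminates copy_loop (stk a (x # m) (x # b) c)
      (stk [] (rev a @ x # m) (rev a @ x # b) c) (11 * length a + 1)"
    using Cons by simp
  from terminates_Loop_step[OF _ 1 this[unfolded copy_loop_def]] Cons.prems show ?case
    unfolding copy_loop_def by (fastforce intro: terminates_mono)
qed

definition dup_tree :: com where
  "dup_tree = get_tree ;; copy_loop ;; move_all 2 0 ;; move_all 0 1"

lemma terminates_dup:
  "terminates dup_tree (stk [] (code t @ m) [] []) (stk [] (code t @ code t @ m) [] [])
     (37 * tsize t + 11)"
proof -
  have 1: "terminates get_tree (stk [] (code t @ m) [] [])
      (stk (rev (code t)) m [] []) (12 * tsize t + 5)"
    using terminates_get_tree[of "[]" t m "[]"] by simp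
  have 2: "terminates copy_loop (stk (rev (code t)) m [] [])
      (stk [] (code t @ m) (code t) []) (11 * tsize t + 1)"
    using terminates_copy_loop[of "rev (code t)" m "[]" "[]"] by (simp add: tsize_def)
  have 3: "terminates (move_all 2 0) (stk [] (code t @ m) (code t) [])
      (stk (rev (code t)) (code t @ m) [] []) (7 * tsize t + 1)"
    using terminates_move_stk(3)[of "code t" "[]" "code t @ m" "[]"] by (simp add: tsize_def)
  have 4: "terminates (move_all 0 1) (stk (rev (code t)) (code t @ m) [] [])
      (stk [] (code t @ code t @ m) [] []) (7 * tsize t + 1)"
    using terminates_move_stk(1)[of "rev (code t)" "code t @ m" "[]" "[]"] by (simp add: tsize_def)
  show ?thesis unfolding dup_tree_def
    by (rule terminates_mono[OF terminates_Seq[OF 1 terminates_Seq[OF 2 terminates_Seq[OF 3 4]]]])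
      (simp add: algebra_simps)
qed

fun push_list :: "nat list \<Rightarrow> com" where
  "push_list [] = Skip"
| "push_list (x # xs) = push_list xs ;; push 1 x"

lemma terminates_push_list:
  "terminates (push_list xs) (stk a m b c) (stk a (xs @ m) b c) (4 * length xs)"
proof (induction xs)
  case Nil
  then show ?case using terminates_Skip by simp
next
  case (Cons x xs)
  have "terminates (push 1 x) (stk a (xs @ m) b c) (stk a (x # xs @ m) b c) 3"
    using terminates_push[of 1 x "stk a (xs @ m) b c"] by simp
  from terminates_Seq[OF Cons this] show ?case by (simp add: algebra_simps)
qed

lemma ok_tree_coms [simp]:
  "ok_com 4 8 get_tree" "ok_com 4 8 swap_trees" "ok_com 4 8 drop_tree" "ok_com 4 8 dup_tree"
  by (simp_all add: get_tree_def get_loop_def swap_trees_def drop_tree_def dup_tree_def copy_loop_def)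

lemma ok_push_list: "set xs \<subseteq> {..<8} \<Longrightarrow> ok_com 4 8 (push_list xs)"
  by (induction xs) auto

lemma ok_push_code [simp]: "ok_com 4 8 (push_list (code t))"
  using set_code[of t] by (intro ok_push_list) auto

section \<open>Polynomial-time functions\<close>

definition poly_bounded :: "(nat \<Rightarrow> nat) \<Rightarrow> bool" where
  "poly_bounded f \<longleftrightarrow> (\<exists>p :: nat poly. \<forall>n. f n \<le> poly p n)"

lemma poly_mono_nat: "x \<le> y \<Longrightarrow> poly (p :: nat poly) x \<le> poly p y"
  by (induction p) (auto intro: add_mono mult_mono)

lemma poly_bounded_poly: "poly_bounded (poly p)"
  unfolding poly_bounded_def by blast

lemma poly_bounded_const: "poly_bounded (\<lambda>n. c)"
  unfolding poly_bounded_def by (rule exI[of _ "[:c:]"]) simp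

lemma poly_bounded_id: "poly_bounded (\<lambda>n. n)"
  unfolding poly_bounded_def by (rule exI[of _ "[:0, 1:]"]) simp

lemma poly_bounded_add:
  assumes "poly_bounded f" "poly_bounded g"
  shows "poly_bounded (\<lambda>n. f n + g n)"
proof -
  from assms obtain p q where "\<And>n. f n \<le> poly p n" "\<And>n. g n \<le> poly q n"
    unfolding poly_bounded_def by metis
  then show ?thesis
    unfolding poly_bounded_def by (intro exI[of _ "p + q"]) (simp add: add_mono)
qed

lemma poly_bounded_mult:
  assumes "poly_bounded f" "poly_bounded g"
  shows "poly_bounded (\<lambda>n. f n * g n)"
proof -
  from assms obtain p q where "\<And>n. f n \<le> poly p n" "\<And>n. g n \<le> poly q n"
    unfolding poly_bounded_def by metis
  then show ?thesis
    unfolding poly_bounded_def by (intro exI[of _ "p * q"]) (simp add: mult_mono)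
qed

text \<open>A polynomial with natural coefficients is monotone, so the bound of \<open>g\<close> may
  be substituted into the bound of \<open>f\<close> even if \<open>f\<close> itself is not
  monotone.\<close>

lemma poly_bounded_comp:
  assumes "poly_bounded f" "poly_bounded g"
  shows "poly_bounded (\<lambda>n. f (g n))"
proof -
  from assms obtain p q where "\<And>n. f n \<le> poly p n" "\<And>n. g n \<le> poly q n"
    unfolding poly_bounded_def by metis
  then have "f (g n) \<le> poly (pcompose p q) n" for n
    by (metis order_trans poly_mono_nat poly_pcompose)
  then show ?thesis unfolding poly_bounded_def by blast
qed

lemma poly_bounded_poly_comp: "poly_bounded g \<Longrightarrow> poly_bounded (\<lambda>n. poly p (g n))"
  by (rule poly_bounded_comp) (rule poly_bounded_poly)

lemma poly_bounded_Suc: "poly_bounded f \<Longrightarrow> poly_bounded (\<lambda>n. Suc (f n))"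
  using poly_bounded_add[of f "\<lambda>_. 1"] poly_bounded_const[of 1] by simp

lemmas poly_bounded_intros =
  poly_bounded_const poly_bounded_id poly_bounded_add poly_bounded_mult poly_bounded_Suc
  poly_bounded_poly_comp poly_bounded_poly

text \<open>\<open>False\<close>, \<open>[]\<close> and later the number \<open>0\<close> are all
  coded by \<open>Leaf\<close>, and a nonempty list by the same tree as the pair of its head and
  tail. A single test for the symbol \<open>2\<close> therefore serves for truth values and for
  lists, and pairing provides consing.\<close>

class enc =
  fixes enc :: "'a \<Rightarrow> tree"

definition sz :: "'a::enc \<Rightarrow> nat" where
  "sz x = tsize (enc x)"

instantiation bool :: enc
begin
definition enc_bool :: "bool \<Rightarrow> tree" where
  "enc_bool b = (if b then Node Leaf Leaf else Leaf)"
instance ..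
end

instantiation prod :: (enc, enc) enc
begin
definition enc_prod :: "'a \<times> 'b \<Rightarrow> tree" where
  "enc_prod x = Node (enc (fst x)) (enc (snd x))"
instance ..
end

instantiation list :: (enc) enc
begin
primrec enc_list :: "'a list \<Rightarrow> tree" where
  "enc_list [] = Leaf"
| "enc_list (x # xs) = Node (enc x) (enc_list xs)"
instance ..
end

section \<open>Sizes of encoded data\<close>

lemma sz_simps [simp]:
  "sz True = 3" "sz False = 1" "sz (x, y) = Suc (sz x + sz y)"
  "sz [] = 1" "sz (x # xs) = Suc (sz x + sz xs)"
  by (simp_all add: sz_def enc_bool_def enc_prod_def)

lemma sz_bool: "sz (b::bool) \<le> 3"
  by (cases b) simp_all

lemma sz_fst: "sz (fst p) \<le> sz p" and sz_snd: "sz (snd p) \<le> sz p"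
  by (cases p; simp)+

lemma sz_pos [simp]: "0 < sz x"
  unfolding sz_def by (cases "enc x") simp_all

lemma length_le_sz: "length xs \<le> sz xs"
  by (induction xs) auto

lemma sz_mem: "x \<in> set xs \<Longrightarrow> sz x \<le> sz xs"
  by (induction xs) auto

lemma sz_append: "sz (xs @ ys) + 1 = sz xs + sz ys"
  by (induction xs) auto

lemma sz_list_le: "(\<And>x. x \<in> set xs \<Longrightarrow> sz x \<le> k) \<Longrightarrow> sz xs \<le> 1 + length xs * (1 + k)"
proof (induction xs)
  case (Cons x xs)
  have "sz x \<le> k" "sz xs \<le> 1 + length xs * (1 + k)"
    using Cons by auto
  then show ?case by simp
qed simp

text \<open>The quantification over \<open>m\<close> is a frame property: whatever lies below the
  argument on the main stack survives, so that intermediate results can be parked there.\<close>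

definition run :: "com \<Rightarrow> tree \<Rightarrow> tree \<Rightarrow> nat \<Rightarrow> bool" where
  "run c s t k \<longleftrightarrow> (\<forall>m. terminates c (stk [] (code s @ m) [] []) (stk [] (code t @ m) [] []) k)"

text \<open>The size of the result is bounded together with the time, since it is the argument size
  for whatever is computed next.\<close>

definition polytime :: "('a::enc \<Rightarrow> 'b::enc) \<Rightarrow> bool" where
  "polytime f \<longleftrightarrow> (\<exists>c (p :: nat poly). ok_com 4 8 c \<and>
     (\<forall>x. sz (f x) \<le> poly p (sz x) \<and> run c (enc x) (enc (f x)) (poly p (sz x))))"

lemma run_mono: "run c s t k \<Longrightarrow> k \<le> k' \<Longrightarrow> run c s t k'"
  unfolding run_def using terminates_mono by blast

lemma polytimeI:
  assumes "ok_com 4 8 c" "poly_bounded T" "poly_bounded U"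
    "\<And>x. sz (f x) \<le> U (sz x)" "\<And>x. run c (enc x) (enc (f x)) (T (sz x))"
  shows "polytime f"
proof -
  from assms(2,3) obtain p q where pq: "\<And>n. T n \<le> poly p n" "\<And>n. U n \<le> poly q n"
    unfolding poly_bounded_def by metis
  have "sz (f x) \<le> poly (p + q) (sz x)" for x
    using pq(2)[of "sz x"] assms(4)[of x] by simp
  moreover have "run c (enc x) (enc (f x)) (poly (p + q) (sz x))" for x
    using pq(1)[of "sz x"] by (intro run_mono[OF assms(5)]) simp
  ultimately show ?thesis
    unfolding polytime_def using assms(1) by blast
qed

lemma polytimeE:
  assumes "polytime f"
  obtains c p where "ok_com 4 8 c" "\<And>x. sz (f x) \<le> poly p (sz x)"
    "\<And>x. run c (enc x) (enc (f x)) (poly p (sz x))"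
  using assms unfolding polytime_def by blast

lemma polytime_bound:
  assumes "polytime f"
  obtains p :: "nat poly" where "\<And>x n. sz x \<le> n \<Longrightarrow> sz (f x) \<le> poly p n"
  using polytimeE[OF assms] by (metis order_trans poly_mono_nat)

lemma run_Seq: "run c s t k \<Longrightarrow> run d t u l \<Longrightarrow> run (c ;; d) s u (k + l + 1)"
  unfolding run_def using terminates_Seq by blast

lemma polytime_cong:
  assumes "polytime g" "\<And>x. enc (f x) = enc (g x)"
  shows "polytime f"
  using assms unfolding polytime_def sz_def by simp

text \<open>Only codes are ever processed; passing between types whose elements have the same tree,
  such as a number and its list of digits, is done by the empty program.\<close>

lemma polytime_recode:
  assumes "\<And>x. enc (f x) = enc x"
  shows "polytime f"
proof (rule polytimeI)
  show "run Skip (enc x) (enc (f x)) 0" for x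
    unfolding run_def assms using terminates_Skip by blast
  show "sz (f x) \<le> sz x" for x
    by (simp add: sz_def assms)
qed (simp_all add: poly_bounded_intros)

lemma polytime_id: "polytime (\<lambda>x. x)"
  by (rule polytime_recode) simp

section \<open>Closure under composition, pairing, branching and list operations\<close>

lemma polytime_comp:
  assumes "polytime g" "polytime f"
  shows "polytime (\<lambda>x. g (f x))"
proof -
  obtain c p where f: "ok_com 4 8 c" "\<And>x. sz (f x) \<le> poly p (sz x)"
    "\<And>x. run c (enc x) (enc (f x)) (poly p (sz x))" by (rule polytimeE[OF assms(2)], rule that)
  obtain d q where g: "ok_com 4 8 d" "\<And>x. sz (g x) \<le> poly q (sz x)"
    "\<And>x. run d (enc x) (enc (g x)) (poly q (sz x))" by (rule polytimeE[OF assms(1)], rule that)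
  have q: "poly q (sz (f x)) \<le> poly q (poly p (sz x))" for x
    by (rule poly_mono_nat[OF f(2)])
  show ?thesis
  proof (rule polytimeI)
    show "ok_com 4 8 (c ;; d)" using f(1) g(1) by simp
    show "sz (g (f x)) \<le> poly q (poly p (sz x))" for x
      using g(2)[of "f x"] q[of x] by linarith
    show "run (c ;; d) (enc x) (enc (g (f x))) (poly p (sz x) + poly q (poly p (sz x)) + 1)" for x
      by (rule run_Seq[OF f(3) run_mono[OF g(3) q]])
  qed (intro poly_bounded_intros)+
qed

lemma run_drop_push: "run (drop_tree ;; push_list (code t)) s t (15 * tsize s + 4 * tsize t + 8)"
proof -
  have "terminates (push_list (code t)) (stk [] m [] []) (stk [] (code t @ m) [] []) (4 * tsize t)" for m
    using terminates_push_list[of "code t" "[]" m "[]" "[]"] by (simp add: tsize_def)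
  from terminates_Seq[OF terminates_drop this] show ?thesis
    unfolding run_def by (auto simp: algebra_simps elim: terminates_mono)
qed

lemma polytime_const: "polytime (\<lambda>x. c)"
proof (rule polytimeI)
  show "run (drop_tree ;; push_list (code (enc c))) (enc x) (enc c) (15 * sz x + 4 * sz c + 8)" for x
    using run_drop_push by (simp add: sz_def)
  show "sz c \<le> sz c" by simp
qed (simp, (intro poly_bounded_intros)+)

lemma terminates_pop_main: "terminates (pop 1) (stk a (x # m) b c) (stk a m b c) 1"
  using terminates_pop[of 1 "stk a (x # m) b c"] by simp

text \<open>Removing the leading \<open>2\<close> of a \<open>Node\<close> leaves the codes of its
  two subtrees as separate entries of the stack.\<close>

lemma run_fst: "run (pop 1 ;; swap_trees ;; drop_tree) (Node s t) s (55 * (tsize s + tsize t) + 40)"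
proof -
  have "terminates (pop 1) (stk [] (code (Node s t) @ m) [] []) (stk [] (code s @ code t @ m) [] []) 1" for m
    using terminates_pop_main by simp
  from terminates_mono[OF terminates_Seq[OF this terminates_Seq[OF terminates_swap terminates_drop]]]
  show ?thesis unfolding run_def by simp
qed

lemma run_snd: "run (pop 1 ;; drop_tree) (Node s t) t (15 * tsize s + 9)"
proof -
  have "terminates (pop 1) (stk [] (code (Node s t) @ m) [] []) (stk [] (code s @ code t @ m) [] []) 1" for m
    using terminates_pop_main by simp
  from terminates_mono[OF terminates_Seq[OF this terminates_drop]] show ?thesis
    unfolding run_def by simp
qed

lemma polytime_fst': "polytime fst"
proof (rule polytimeI)
  show "run (pop 1 ;; swap_trees ;; drop_tree) (enc x) (enc (fst x)) (55 * sz x + 40)" for x :: "'a \<times> 'b"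
    unfolding enc_prod_def by (rule run_mono[OF run_fst]) (simp add: sz_def enc_prod_def)
  show "sz (fst x) \<le> sz x" for x :: "'a \<times> 'b" by (rule sz_fst)
qed (simp, (intro poly_bounded_intros)+)

lemma polytime_snd': "polytime snd"
proof (rule polytimeI)
  show "run (pop 1 ;; drop_tree) (enc x) (enc (snd x)) (15 * sz x + 9)" for x :: "'a \<times> 'b"
    unfolding enc_prod_def by (rule run_mono[OF run_snd]) (simp add: sz_def enc_prod_def)
  show "sz (snd x) \<le> sz x" for x :: "'a \<times> 'b" by (rule sz_snd)
qed (simp, (intro poly_bounded_intros)+)

text \<open>The argument is duplicated; \<open>f\<close> works on the upper copy while the lower one
  is protected by the frame in \<open>run\<close>. After a swap \<open>g\<close> does the same, and
  a final \<open>2\<close> joins the results into a \<open>Node\<close>.\<close>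

lemma polytime_pair:
  assumes "polytime f" "polytime g"
  shows "polytime (\<lambda>x. (f x, g x))"
proof -
  obtain c p where f: "ok_com 4 8 c" "\<And>x. sz (f x) \<le> poly p (sz x)"
    "\<And>x. run c (enc x) (enc (f x)) (poly p (sz x))" by (rule polytimeE[OF assms(1)], rule that)
  obtain d q where g: "ok_com 4 8 d" "\<And>x. sz (g x) \<le> poly q (sz x)"
    "\<And>x. run d (enc x) (enc (g x)) (poly q (sz x))" by (rule polytimeE[OF assms(2)], rule that)
  let ?P = "\<lambda>n. poly p n" and ?Q = "\<lambda>n. poly q n"
  let ?c = "dup_tree ;; c ;; swap_trees ;; d ;; swap_trees ;; push 1 2"
  let ?T = "\<lambda>n. 100 * n + 100 * ?P n + 100 * ?Q n + 100"
  show ?thesis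
  proof (rule polytimeI[of ?c ?T "\<lambda>n. ?P n + ?Q n + 1"])
    show "ok_com 4 8 ?c" using f(1) g(1) by simp
    fix x
    show "sz (f x, g x) \<le> ?P (sz x) + ?Q (sz x) + 1"
      using f(2)[of x] g(2)[of x] by simp
    show "run ?c (enc x) (enc (f x, g x)) (?T (sz x))"
      unfolding run_def
    proof
      fix m
      have 1: "terminates dup_tree (stk [] (code (enc x) @ m) [] [])
          (stk [] (code (enc x) @ code (enc x) @ m) [] []) (37 * sz x + 11)"
        using terminates_dup by (simp add: sz_def)
      have 2: "terminates c (stk [] (code (enc x) @ code (enc x) @ m) [] [])
          (stk [] (code (enc (f x)) @ code (enc x) @ m) [] []) (?P (sz x))"
        using f(3) unfolding run_def by blast
      have 3: "terminates swap_trees (stk [] (code (enc (f x)) @ code (enc x) @ m) [] [])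
          (stk [] (code (enc x) @ code (enc (f x)) @ m) [] []) (40 * (?P (sz x) + sz x) + 30)"
        by (rule terminates_mono[OF terminates_swap]) (use f(2)[of x] in \<open>simp add: sz_def\<close>)
      have 4: "terminates d (stk [] (code (enc x) @ code (enc (f x)) @ m) [] [])
          (stk [] (code (enc (g x)) @ code (enc (f x)) @ m) [] []) (?Q (sz x))"
        using g(3) unfolding run_def by blast
      have 5: "terminates swap_trees (stk [] (code (enc (g x)) @ code (enc (f x)) @ m) [] [])
          (stk [] (code (enc (f x)) @ code (enc (g x)) @ m) [] []) (40 * (?Q (sz x) + ?P (sz x)) + 30)"
        by (rule terminates_mono[OF terminates_swap]) (use f(2)[of x] g(2)[of x] in \<open>simp add: sz_def\<close>)
      have 6: "terminates (push 1 2) (stk [] (code (enc (f x)) @ code (enc (g x)) @ m) [] [])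
          (stk [] (code (enc (f x, g x)) @ m) [] []) 3"
        using terminates_push[of 1 2 "stk [] (code (enc (f x)) @ code (enc (g x)) @ m) [] []"]
        by (simp add: enc_prod_def)
      show "terminates ?c (stk [] (code (enc x) @ m) [] []) (stk [] (code (enc (f x, g x)) @ m) [] [])
          (?T (sz x))"
        by (rule terminates_mono[OF terminates_Seq[OF 1 terminates_Seq[OF 2 terminates_Seq[OF 3
              terminates_Seq[OF 4 terminates_Seq[OF 5 6]]]]]]) simp
    qed
  qed (intro poly_bounded_intros)+
qed

lemma code_enc_bool: "code (enc b) = (if b then [2, 1, 1] else [1])"
  by (simp add: enc_bool_def)

lemma run_branch:
  assumes "b \<Longrightarrow> run c s t k" "\<not> b \<Longrightarrow> run d s t k"
  shows "terminates (Cond (\<lambda>xs. xs ! 1 = 2) (drop_tree ;; c) (drop_tree ;; d))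
     (stk [] (code (enc b) @ code s @ m) [] []) (stk [] (code t @ m) [] []) (k + 60)"
proof (cases b)
  case True
  have "terminates (drop_tree ;; c) (stk [] (code (enc b) @ code s @ m) [] [])
      (stk [] (code t @ m) [] []) (15 * tsize (enc b) + 7 + k + 1)"
    using terminates_Seq[OF terminates_drop] assms(1)[OF True] unfolding run_def by blast
  from terminates_mono[OF terminates_Cond_True[OF _ this]] True show ?thesis
    by (simp add: code_enc_bool tsize_def)
next
  case False
  have "terminates (drop_tree ;; d) (stk [] (code (enc b) @ code s @ m) [] [])
      (stk [] (code t @ m) [] []) (15 * tsize (enc b) + 7 + k + 1)"
    using terminates_Seq[OF terminates_drop] assms(2)[OF False] unfolding run_def by blast
  from terminates_mono[OF terminates_Cond_False[OF _ this]] False show ?thesis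
    by (simp add: code_enc_bool tsize_def)
qed

lemma terminates_dup_run:
  assumes "run c s t k"
  shows "terminates (dup_tree ;; c) (stk [] (code s @ m) [] []) (stk [] (code t @ code s @ m) [] [])
     (37 * tsize s + 12 + k)"
  using terminates_Seq[OF terminates_dup assms[unfolded run_def, rule_format]]
  by (auto simp: algebra_simps)

lemma polytime_if:
  assumes "polytime b" "polytime f" "polytime g"
  shows "polytime (\<lambda>x. if b x then f x else g x)"
proof -
  obtain e r where b: "ok_com 4 8 e" "\<And>x. sz (b x) \<le> poly r (sz x)"
    "\<And>x. run e (enc x) (enc (b x)) (poly r (sz x))" by (rule polytimeE[OF assms(1)], rule that)
  obtain c p where f: "ok_com 4 8 c" "\<And>x. sz (f x) \<le> poly p (sz x)"
    "\<And>x. run c (enc x) (enc (f x)) (poly p (sz x))" by (rule polytimeE[OF assms(2)], rule that)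
  obtain d q where g: "ok_com 4 8 d" "\<And>x. sz (g x) \<le> poly q (sz x)"
    "\<And>x. run d (enc x) (enc (g x)) (poly q (sz x))" by (rule polytimeE[OF assms(3)], rule that)
  let ?c = "(dup_tree ;; e) ;; Cond (\<lambda>xs. xs ! 1 = 2) (drop_tree ;; c) (drop_tree ;; d)"
  let ?T = "\<lambda>n. 37 * n + 12 + poly r n + (poly p n + poly q n + 60) + 1"
  show ?thesis
  proof (rule polytimeI[of ?c ?T "\<lambda>n. poly p n + poly q n"])
    show "ok_com 4 8 ?c" using b(1) f(1) g(1) by simp
    fix x
    show "sz (if b x then f x else g x) \<le> poly p (sz x) + poly q (sz x)"
      using f(2)[of x] g(2)[of x] by simp
    have "run c (enc x) (enc (if b x then f x else g x)) (poly p (sz x) + poly q (sz x))" if "b x"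
      using that run_mono[OF f(3)] by simp
    moreover have "run d (enc x) (enc (if b x then f x else g x)) (poly p (sz x) + poly q (sz x))" if "\<not> b x"
      using that run_mono[OF g(3)] by simp
    ultimately show "run ?c (enc x) (enc (if b x then f x else g x)) (?T (sz x))"
      unfolding run_def[of ?c] sz_def
      by (intro allI terminates_Seq[OF terminates_dup_run[OF b(3)[unfolded sz_def]] run_branch])
        (simp_all add: sz_def)
  qed (intro poly_bounded_intros)+
qed

lemma run_list_case:
  assumes "\<And>y ys. xs = y # ys \<Longrightarrow> run c (enc xs) t k" "xs = [] \<Longrightarrow> run d (enc xs) t k"
  shows "run (Cond (\<lambda>xs. xs ! 1 = 2) c d) (enc xs) t (k + 1)"
  unfolding run_def
proof
  fix m
  show "terminates (Cond (\<lambda>xs. xs ! 1 = 2) c d) (stk [] (code (enc xs) @ m) [] []) (stk [] (code t @ m) [] []) (k + 1)"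
  proof (cases xs)
    case Nil
    with assms(2) show ?thesis
      unfolding run_def by (intro terminates_Cond_False) auto
  next
    case (Cons y ys)
    with assms(1) show ?thesis
      unfolding run_def by (intro terminates_Cond_True) auto
  qed
qed

lemma polytime_null': "polytime (\<lambda>xs. xs = [])"
proof (rule polytimeI)
  fix xs :: "'a list"
  let ?c = "\<lambda>b. drop_tree ;; push_list (code (enc (b :: bool)))"
  show "run (Cond (\<lambda>xs. xs ! 1 = 2) (?c False) (?c True)) (enc xs) (enc (xs = [])) (15 * sz xs + 25 + 1)"
    by (rule run_list_case)
      (auto intro!: run_mono[OF run_drop_push] simp: sz_def[symmetric])
  show "sz (xs = []) \<le> 3" by (rule sz_bool)
qed (simp, (intro poly_bounded_intros)+)

text \<open>In HOL \<open>hd []\<close> is some fixed value. Its code can be wired into the program,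
  which makes \<open>hd\<close> polytime on all lists without a side condition.\<close>

lemma polytime_hd': "polytime hd"
proof (rule polytimeI)
  fix xs :: "'a list"
  let ?k = "4 * sz (hd ([] :: 'a list))"
  show "run (Cond (\<lambda>xs. xs ! 1 = 2) (pop 1 ;; swap_trees ;; drop_tree)
      (drop_tree ;; push_list (code (enc (hd ([] :: 'a list)))))) (enc xs) (enc (hd xs)) (100 * sz xs + ?k + 40 + 1)"
  proof (rule run_list_case)
    show "run (pop 1 ;; swap_trees ;; drop_tree) (enc xs) (enc (hd xs)) (100 * sz xs + ?k + 40)"
      if "xs = y # ys" for y ys
      using run_mono[OF run_fst[of "enc y" "enc ys"], of "100 * sz xs + ?k + 40"] that
      by (simp add: sz_def)
    show "run (drop_tree ;; push_list (code (enc (hd ([] :: 'a list))))) (enc xs) (enc (hd xs))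
        (100 * sz xs + ?k + 40)" if "xs = []"
      using run_mono[OF run_drop_push[of "enc (hd ([] :: 'a list))" Leaf], of "100 * sz xs + ?k + 40"] that
      by (simp add: sz_def)
  qed
  show "sz (hd xs) \<le> sz xs + sz (hd ([] :: 'a list))"
    by (cases xs) auto
qed (simp, (intro poly_bounded_intros)+)

lemma polytime_tl': "polytime tl"
proof (rule polytimeI)
  fix xs :: "'a list"
  show "run (Cond (\<lambda>xs. xs ! 1 = 2) (pop 1 ;; drop_tree) Skip) (enc xs) (enc (tl xs)) (15 * sz xs + 9 + 1)"
  proof (rule run_list_case)
    show "xs = [] \<Longrightarrow> run Skip (enc xs) (enc (tl xs)) (15 * sz xs + 9)"
      unfolding run_def using terminates_mono[OF terminates_Skip] by auto
    show "run (pop 1 ;; drop_tree) (enc xs) (enc (tl xs)) (15 * sz xs + 9)" if "xs = y # ys" for y ys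
      using run_mono[OF run_snd[of "enc y" "enc ys"], of "15 * sz xs + 9"] that by (simp add: sz_def)
  qed
  show "sz (tl xs) \<le> sz xs"
    by (cases xs) auto
qed (simp, (intro poly_bounded_intros)+)

text \<open>The number of rounds \<open>n s\<close> exists only in the logic; the machine learns
  from \<open>test\<close> when to stop. The bound \<open>B\<close> covers every intermediate state,
  as polynomial bounds for single rounds would compose to an exponential one.\<close>

lemma polytime_while:
  fixes init :: "'s::enc \<Rightarrow> 'y::enc" and body :: "'y \<Rightarrow> 'y" and test :: "'y \<Rightarrow> bool"
    and B :: "nat \<Rightarrow> nat" and n :: "'s \<Rightarrow> nat"
  assumes test: "polytime test" and body: "polytime body" and init: "polytime init"
    and B: "poly_bounded B"
    and n: "\<And>s. n s \<le> B (sz s)"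
    and size: "\<And>s i. i \<le> n s \<Longrightarrow> sz ((body ^^ i) (init s)) \<le> B (sz s)"
    and continue: "\<And>s i. i < n s \<Longrightarrow> test ((body ^^ i) (init s))"
    and stop: "\<And>s. \<not> test ((body ^^ n s) (init s))"
  shows "polytime (\<lambda>s. (body ^^ n s) (init s))"
proof -
  obtain e r where t: "ok_com 4 8 e" "\<And>x. sz (test x) \<le> poly r (sz x)"
    "\<And>x. run e (enc x) (enc (test x)) (poly r (sz x))" by (rule polytimeE[OF test], rule that)
  obtain c p where b: "ok_com 4 8 c" "\<And>x. sz (body x) \<le> poly p (sz x)"
    "\<And>x. run c (enc x) (enc (body x)) (poly p (sz x))" by (rule polytimeE[OF body], rule that)
  obtain d q where i: "ok_com 4 8 d" "\<And>x. sz (init x) \<le> poly q (sz x)"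
    "\<And>x. run d (enc x) (enc (init x)) (poly q (sz x))" by (rule polytimeE[OF init], rule that)
  let ?body = "drop_tree ;; c ;; (dup_tree ;; e)"
  let ?loop = "Loop (\<lambda>xs. xs ! 1 = 2) ?body"
  let ?c = "d ;; (dup_tree ;; e) ;; ?loop ;; drop_tree"
  \<comment> \<open>Cost of one round on states of size at most \<open>B s\<close>: dropping the old
    verdict, running the body, duplicating the new state and testing it. The constant
    \<open>100\<close> absorbs the overhead.\<close>
  define K where "K = (\<lambda>s. 100 + poly p (B s) + 37 * B s + poly r (B s))"
  have iter: "terminates ?loop
      (stk [] (code (enc (test ((body ^^ i) (init s)))) @ code (enc ((body ^^ i) (init s))) @ m) [] [])
      (stk [] (code (enc False) @ code (enc ((body ^^ n s) (init s))) @ m) [] [])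
      ((n s - i) * K (sz s) + 1)" if "i \<le> n s" for s i m
    using that
  \<comment> \<open>Backwards from the last round, because the statement describes what is still to
    be executed.\<close>
  proof (induction rule: inc_induct)
    case base
    have "\<not> tops (stk [] (code (enc False) @ m') [] []) ! 1 = 2" for m'
      by (simp add: code_enc_bool)
    then show ?case
      using stop[of s] terminates_Loop_exit[of "\<lambda>xs. xs ! 1 = 2"] by simp
  next
    case (step i)
    let ?y = "(body ^^ i) (init s)"
    have y: "sz ?y \<le> B (sz s)" "sz (body ?y) \<le> B (sz s)"
      using size[of i s] size[of "Suc i" s] step by simp_all
    have T: "test ?y" using continue step by simp
    have 1: "terminates drop_tree (stk [] (code (enc (test ?y)) @ code (enc ?y) @ m) [] [])
        (stk [] (code (enc ?y) @ m) [] []) 52"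
      using terminates_drop[of "enc True"] T by (simp add: enc_bool_def)
    have 2: "terminates c (stk [] (code (enc ?y) @ m) [] []) (stk [] (code (enc (body ?y)) @ m) [] [])
        (poly p (B (sz s)))"
      using run_mono[OF b(3) poly_mono_nat[OF y(1)]] unfolding run_def by blast
    have 3: "terminates (dup_tree ;; e) (stk [] (code (enc (body ?y)) @ m) [] [])
        (stk [] (code (enc (test (body ?y))) @ code (enc (body ?y)) @ m) [] [])
        (37 * B (sz s) + 12 + poly r (B (sz s)))"
      by (rule terminates_mono[OF terminates_dup_run[OF run_mono[OF t(3) poly_mono_nat[OF y(2)]]]])
        (use y(2) in \<open>simp add: sz_def\<close>)
    have "tops (stk [] (code (enc (test ?y)) @ code (enc ?y) @ m) [] []) ! 1 = 2"
      using T by (simp add: code_enc_bool)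
    from terminates_Loop_step[of "\<lambda>xs. xs ! 1 = 2", OF this terminates_Seq[OF 1 terminates_Seq[OF 2 3]]
        step.IH[unfolded funpow.simps comp_apply]]
    show ?case
    proof (rule terminates_mono)
      have "(n s - i) * K (sz s) = (n s - Suc i) * K (sz s) + K (sz s)"
        using step(2) by (metis Suc_diff_Suc add.commute mult_Suc)
      then show "52 + (poly p (B (sz s)) + (37 * B (sz s) + 12 + poly r (B (sz s))) + 1) + 1 +
          ((n s - Suc i) * K (sz s) + 1) + 2 \<le> (n s - i) * K (sz s) + 1"
        by (simp add: K_def)
    qed
  qed
  let ?T = "\<lambda>n. poly q n + (37 * poly q n + 12 + poly r (poly q n) + (B n * K n + 1 + 22 + 1) + 1) + 1"
  show ?thesis
  proof (rule polytimeI[of ?c ?T B])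
    show "ok_com 4 8 ?c" using t(1) b(1) i(1) by simp
    have "poly_bounded K" unfolding K_def by (intro poly_bounded_intros B)
    then show "poly_bounded ?T" by (intro poly_bounded_intros B)
    fix s
    show "sz ((body ^^ n s) (init s)) \<le> B (sz s)" using size by simp
    show "run ?c (enc s) (enc ((body ^^ n s) (init s))) (?T (sz s))"
      unfolding run_def
    proof
      fix m
      have 1: "terminates d (stk [] (code (enc s) @ m) [] []) (stk [] (code (enc (init s)) @ m) [] [])
          (poly q (sz s))"
        using i(3) unfolding run_def by blast
      have 2: "terminates (dup_tree ;; e) (stk [] (code (enc (init s)) @ m) [] [])
          (stk [] (code (enc (test (init s))) @ code (enc (init s)) @ m) [] [])
          (37 * poly q (sz s) + 12 + poly r (poly q (sz s)))"
        by (rule terminates_mono[OF terminates_dup_run[OF run_mono[OF t(3) poly_mono_nat[OF i(2)]]]])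
          (use i(2)[of s] in \<open>simp add: sz_def\<close>)
      have 3: "terminates ?loop (stk [] (code (enc (test (init s))) @ code (enc (init s)) @ m) [] [])
          (stk [] (code (enc False) @ code (enc ((body ^^ n s) (init s))) @ m) [] [])
          (B (sz s) * K (sz s) + 1)"
        by (rule terminates_mono[OF iter[OF le0, of s m, unfolded funpow.simps id_apply]]) (use n[of s] in simp)
      have 4: "terminates drop_tree (stk [] (code (enc False) @ code (enc ((body ^^ n s) (init s))) @ m) [] [])
          (stk [] (code (enc ((body ^^ n s) (init s))) @ m) [] []) 22"
        using terminates_drop[of "enc False"] by (simp add: enc_bool_def)
      show "terminates ?c (stk [] (code (enc s) @ m) [] [])
          (stk [] (code (enc ((body ^^ n s) (init s))) @ m) [] []) (?T (sz s))"
        by (rule terminates_Seq[OF 1 terminates_Seq[OF 2 terminates_Seq[OF 3 4]]])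
    qed
  qed (rule B)
qed

section \<open>Rules in applied form, and iteration over lists\<close>

lemma polytime_fst: "polytime f \<Longrightarrow> polytime (\<lambda>s. fst (f s))"
  by (rule polytime_comp[OF polytime_fst'])

lemma polytime_snd: "polytime f \<Longrightarrow> polytime (\<lambda>s. snd (f s))"
  by (rule polytime_comp[OF polytime_snd'])

lemma polytime_null: "polytime f \<Longrightarrow> polytime (\<lambda>s. f s = [])"
  by (rule polytime_comp[OF polytime_null'])

lemma polytime_hd: "polytime f \<Longrightarrow> polytime (\<lambda>s. hd (f s))"
  by (rule polytime_comp[OF polytime_hd'])

lemma polytime_tl: "polytime f \<Longrightarrow> polytime (\<lambda>s. tl (f s))"
  by (rule polytime_comp[OF polytime_tl'])

lemma polytime_Cons: "polytime f \<Longrightarrow> polytime g \<Longrightarrow> polytime (\<lambda>s. f s # g s)"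
  by (rule polytime_cong[OF polytime_pair]) (simp_all add: enc_prod_def)

lemma polytime_not:
  assumes "polytime f"
  shows "polytime (\<lambda>s. \<not> f s)"
proof -
  have "(\<lambda>s. \<not> f s) = (\<lambda>s. if f s then False else True)" by auto
  then show ?thesis
    by (simp only: polytime_if[OF assms polytime_const polytime_const])
qed

lemma polytime_conj:
  assumes "polytime f" "polytime g"
  shows "polytime (\<lambda>s. f s \<and> g s)"
proof -
  have "(\<lambda>s. f s \<and> g s) = (\<lambda>s. if f s then g s else False)" by auto
  then show ?thesis
    by (simp only: polytime_if[OF assms polytime_const])
qed

lemma polytime_disj:
  assumes "polytime f" "polytime g"
  shows "polytime (\<lambda>s. f s \<or> g s)"
proof -
  have "(\<lambda>s. f s \<or> g s) = (\<lambda>s. if f s then True else g s)" by auto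
  then show ?thesis
    by (simp only: polytime_if[OF assms(1) polytime_const assms(2)])
qed

lemma polytime_eq_bool:
  assumes "polytime f" "polytime g"
  shows "polytime (\<lambda>s. f s = (g s :: bool))"
proof -
  have "(\<lambda>s. f s = g s) = (\<lambda>s. if f s then g s else \<not> g s)" by auto
  then show ?thesis
    by (simp only: polytime_if[OF assms polytime_not[OF assms(2)]])
qed

lemmas polytime_basic =
  polytime_const polytime_id polytime_fst polytime_snd polytime_pair polytime_if polytime_null
  polytime_hd polytime_tl polytime_Cons polytime_not polytime_conj polytime_disj polytime_eq_bool

text \<open>The context \<open>s\<close> is carried along in the loop state because
  \<open>step\<close> depends on it. The size premise ranges over prefixes \<open>ys\<close>, that
  is, over all intermediate accumulators.\<close>

lemma polytime_fold:
  fixes xs :: "'s::enc \<Rightarrow> 'x::enc list" and a :: "'s \<Rightarrow> 'b::enc" and step :: "'s \<Rightarrow> 'x \<Rightarrow> 'b \<Rightarrow> 'b"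
  assumes xs: "polytime xs" and a: "polytime a"
    and step: "polytime (\<lambda>p. step (fst p) (fst (snd p)) (snd (snd p)))"
    and B: "poly_bounded B"
    and size: "\<And>s ys zs. xs s = ys @ zs \<Longrightarrow> sz (fold (step s) ys (a s)) \<le> B (sz s)"
  shows "polytime (\<lambda>s. fold (step s) (xs s) (a s))"
proof -
  define test :: "'x list \<times> 's \<times> 'b \<Rightarrow> bool" where "test = (\<lambda>y. fst y \<noteq> [])"
  define body :: "'x list \<times> 's \<times> 'b \<Rightarrow> 'x list \<times> 's \<times> 'b" where
    "body = (\<lambda>y. (tl (fst y), fst (snd y), step (fst (snd y)) (hd (fst y)) (snd (snd y))))"
  define init where "init = (\<lambda>s. (xs s, s, a s))"
  have iter: "(body ^^ i) (init s) = (drop i (xs s), s, fold (step s) (take i (xs s)) (a s))"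
    if "i \<le> length (xs s)" for i s
    using that
  proof (induction i)
    case (Suc i)
    then have "drop i (xs s) = xs s ! i # drop (Suc i) (xs s)"
      by (simp add: Cons_nth_drop_Suc)
    with Suc show ?case
      by (simp add: body_def take_Suc_conv_app_nth)
  qed (simp add: init_def)
  obtain p :: "nat poly" where p: "\<And>s n. sz s \<le> n \<Longrightarrow> sz (xs s) \<le> poly p n"
    using polytime_bound[OF xs] by metis
  let ?B = "\<lambda>n. poly p n + n + B n + 2"
  have "polytime (\<lambda>s. (body ^^ length (xs s)) (init s))"
  proof (rule polytime_while)
    show "polytime test"
      unfolding test_def by (intro polytime_basic)
    have "polytime (\<lambda>y::'x list \<times> 's \<times> 'b. (fst (snd y), hd (fst y), snd (snd y)))"
      by (intro polytime_basic)
    from polytime_comp[OF step this]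
    show "polytime body"
      unfolding body_def by (intro polytime_basic) simp_all
    show "polytime init"
      unfolding init_def by (intro polytime_basic xs a)
    show "poly_bounded ?B"
      by (intro poly_bounded_intros B)
    show "length (xs s) \<le> ?B (sz s)" for s
      using p[of s "sz s"] length_le_sz[of "xs s"] by simp
    show "sz ((body ^^ i) (init s)) \<le> ?B (sz s)" if "i \<le> length (xs s)" for s i
    proof -
      have "sz (drop i (xs s)) \<le> sz (xs s)"
        using sz_append[of "take i (xs s)" "drop i (xs s)"] sz_pos[of "take i (xs s)"]
        unfolding append_take_drop_id by linarith
      then show ?thesis
        using iter[OF that] size[of s "take i (xs s)" "drop i (xs s)"] p[of s "sz s"] by simp
    qed
    show "test ((body ^^ i) (init s))" if "i < length (xs s)" for s i
      using iter[of i s] that by (simp add: test_def)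
    show "\<not> test ((body ^^ length (xs s)) (init s))" for s
      using iter[of "length (xs s)" s] by (simp add: test_def)
  qed
  then have "polytime (\<lambda>s. snd (snd ((body ^^ length (xs s)) (init s))))"
    by (intro polytime_basic)
  then show ?thesis
    by (simp add: iter)
qed

lemma polytime_fold_add:
  fixes xs :: "'s::enc \<Rightarrow> 'x::enc list" and a :: "'s \<Rightarrow> 'b::enc" and step :: "'s \<Rightarrow> 'x \<Rightarrow> 'b \<Rightarrow> 'b"
  assumes xs: "polytime xs" and a: "polytime a"
    and step: "polytime (\<lambda>p. step (fst p) (fst (snd p)) (snd (snd p)))"
    and B: "poly_bounded B"
    and size: "\<And>s x b. x \<in> set (xs s) \<Longrightarrow> sz (step s x b) \<le> sz b + B (sz s)"
  shows "polytime (\<lambda>s. fold (step s) (xs s) (a s))"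
proof -
  obtain p :: "nat poly" where p: "\<And>s n. sz s \<le> n \<Longrightarrow> sz (xs s) \<le> poly p n"
    using polytime_bound[OF xs] by metis
  obtain q :: "nat poly" where q: "\<And>s n. sz s \<le> n \<Longrightarrow> sz (a s) \<le> poly q n"
    using polytime_bound[OF a] by metis
  have fold: "sz (fold (step s) ys b) \<le> sz b + length ys * B (sz s)" if "set ys \<subseteq> set (xs s)" for s ys b
    using that
  proof (induction ys arbitrary: b)
    case (Cons y ys)
    then have "sz (fold (step s) ys (step s y b)) \<le> sz (step s y b) + length ys * B (sz s)"
      by simp
    also have "sz (step s y b) \<le> sz b + B (sz s)"
      using size Cons.prems by simp
    finally show ?case by simp
  qed simp
  show ?thesis
  proof (rule polytime_fold[OF xs a step])
    show "poly_bounded (\<lambda>n. poly q n + poly p n * B n)"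
      by (intro poly_bounded_intros B)
    fix s ys zs assume ys: "xs s = ys @ zs"
    have "length ys \<le> poly p (sz s)"
      using p[of s "sz s"] length_le_sz[of "xs s"] ys by simp
    then have "length ys * B (sz s) \<le> poly p (sz s) * B (sz s)"
      by (rule mult_le_mono1)
    moreover have "sz (fold (step s) ys (a s)) \<le> sz (a s) + length ys * B (sz s)"
      using fold ys by simp
    ultimately show "sz (fold (step s) ys (a s)) \<le> poly q (sz s) + poly p (sz s) * B (sz s)"
      using q[of s "sz s"] by linarith
  qed
qed

lemma polytime_rev: "polytime f \<Longrightarrow> polytime (\<lambda>s. rev (f s))"
proof -
  have "polytime (\<lambda>xs::'b list. fold (\<lambda>x ys. x # ys) xs [])"
  proof (rule polytime_fold_add[where B = "\<lambda>n. n + 1"])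
    show "sz (x # ys) \<le> sz ys + (sz xs + 1)" if "x \<in> set xs" for x :: 'b and xs ys
      using sz_mem[OF that] by simp
  qed (intro polytime_basic poly_bounded_intros)+
  then have "polytime (rev :: 'b list \<Rightarrow> _)"
    by (simp add: fold_Cons_rev)
  then show "polytime f \<Longrightarrow> polytime (\<lambda>s. rev (f s))"
    by (rule polytime_comp)
qed

lemma polytime_append: "polytime f \<Longrightarrow> polytime g \<Longrightarrow> polytime (\<lambda>s. f s @ g s)"
proof -
  have "polytime (\<lambda>p::'b list \<times> 'b list. fold (\<lambda>x ys. x # ys) (rev (fst p)) (snd p))"
  proof (rule polytime_fold_add[where B = "\<lambda>n. n + 1"])
    show "sz (x # ys) \<le> sz ys + (sz p + 1)" if "x \<in> set (rev (fst p))"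
      for x :: 'b and ys and p :: "'b list \<times> 'b list"
      using sz_mem[of x "fst p"] sz_fst[of p] that by simp
  qed (intro polytime_basic poly_bounded_intros polytime_rev)+
  then have "polytime (\<lambda>p::'b list \<times> 'b list. fst p @ snd p)"
    by (simp add: fold_Cons_rev)
  then show "polytime f \<Longrightarrow> polytime g \<Longrightarrow> polytime (\<lambda>s. f s @ g s)"
    using polytime_comp[of "\<lambda>p. fst p @ snd p" "\<lambda>s. (f s, g s)"] polytime_pair[of f g] by simp
qed

section \<open>Binary arithmetic\<close>

text \<open>Least significant digit first and no digits for \<open>0\<close>: halving is then
  \<open>tl\<close>, parity is \<open>hd\<close>, and testing for zero is testing for
  \<open>[]\<close>. The notation \<open>binary\<close> of the instances runs the other way.\<close>

fun bits :: "nat \<Rightarrow> bool list" where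
  "bits n = (if n = 0 then [] else odd n # bits (n div 2))"

declare bits.simps [simp del]

lemma bits_0 [simp]: "bits 0 = []"
  by (simp add: bits.simps)

lemma bits_rec: "n \<noteq> 0 \<Longrightarrow> bits n = odd n # bits (n div 2)"
  by (subst bits.simps) simp

lemma bits_eq_Nil [simp]: "bits n = [] \<longleftrightarrow> n = 0"
  by (subst bits.simps) simp

definition bitlen :: "nat \<Rightarrow> nat" where
  "bitlen n = length (bits n)"

lemma bitlen_le: "n < 2 ^ k \<Longrightarrow> bitlen n \<le> k"
proof (induction n arbitrary: k rule: bits.induct)
  case (1 n)
  show ?case
  proof (cases "n = 0")
    case False
    with 1 obtain j where k: "k = Suc j" by (cases k) auto
    then have "bitlen (n div 2) \<le> j" using 1 False by auto
    then show ?thesis using False k by (simp add: bitlen_def bits_rec)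
  qed (simp add: bitlen_def)
qed

lemma less_bitlen: "n < 2 ^ bitlen n"
proof (induction n rule: bits.induct)
  case (1 n)
  then show ?case
    by (cases "n = 0") (auto simp: bitlen_def bits_rec)
qed

instantiation nat :: enc
begin
definition enc_nat :: "nat \<Rightarrow> tree" where
  "enc_nat n = enc (bits n)"
instance ..
end

lemma sz_nat: "sz (n::nat) = sz (bits n)"
  by (simp add: sz_def enc_nat_def)

lemma sz_nat_le: "sz (n::nat) \<le> 1 + 4 * bitlen n"
  using sz_list_le[of "bits n" 3] sz_bool by (simp add: sz_nat bitlen_def)

lemma bitlen_le_sz: "bitlen n \<le> sz (n::nat)"
  using length_le_sz[of "bits n"] by (simp add: sz_nat bitlen_def)

lemma less_pow_sz: "n < 2 ^ sz (n::nat)"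
  using less_bitlen[of n] bitlen_le_sz[of n]
  by (meson less_le_trans one_le_numeral power_increasing)

lemma sz_nat_less: "n < 2 ^ k \<Longrightarrow> sz (n::nat) \<le> 1 + 4 * k"
  using sz_nat_le[of n] bitlen_le[of n k] by linarith

lemma polytime_bits: "polytime f \<Longrightarrow> polytime (\<lambda>s. bits (f s))"
  by (erule polytime_comp[rotated]) (rule polytime_recode, simp add: enc_nat_def)

lemma polytime_eq_0: "polytime f \<Longrightarrow> polytime (\<lambda>s. f s = (0::nat))"
  using polytime_null[OF polytime_bits[of f]] by simp

lemma polytime_div2: "polytime f \<Longrightarrow> polytime (\<lambda>s. f s div (2::nat))"
proof (rule polytime_cong)
  show "enc (f s div 2) = enc (tl (bits (f s)))" for s
    by (cases "f s = 0") (simp_all add: enc_nat_def bits_rec)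
qed (intro polytime_basic polytime_bits)

lemma odd_eq_bits: "odd n \<longleftrightarrow> bits n \<noteq> [] \<and> hd (bits n)"
  by (cases "n = 0") (simp_all add: bits_rec)

lemma polytime_odd: "polytime f \<Longrightarrow> polytime (\<lambda>s. odd (f s :: nat))"
  unfolding odd_eq_bits by (intro polytime_basic polytime_bits)

definition shift_in :: "bool \<Rightarrow> nat \<Rightarrow> nat" where
  "shift_in b n = 2 * n + of_bool b"

text \<open>The exceptional case keeps the representation canonical: a zero digit appended to
  \<open>0\<close> must not be stored.\<close>

lemma bits_shift_in: "bits (shift_in b n) = (if n = 0 \<and> \<not> b then [] else b # bits n)"
  by (cases "shift_in b n = 0") (auto simp: shift_in_def bits_rec)

lemma sz_shift_in: "sz (shift_in b n) \<le> sz n + 4"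
  using sz_bool[of b] by (auto simp: sz_nat bits_shift_in)

lemma polytime_shift_in:
  "polytime b \<Longrightarrow> polytime f \<Longrightarrow> polytime (\<lambda>s. shift_in (b s) (f s))"
proof (rule polytime_cong)
  show "enc (shift_in (b s) (f s)) = enc (if f s = 0 \<and> \<not> b s then [] else b s # bits (f s))" for s
    by (simp add: enc_nat_def bits_shift_in)
qed (intro polytime_basic polytime_bits polytime_eq_0)

definition horner :: "bool list \<Rightarrow> nat \<Rightarrow> nat" where
  "horner bs n = fold shift_in bs n"

lemma horner_simps [simp]:
  "horner [] n = n" "horner (b # bs) n = horner bs (shift_in b n)"
  by (simp_all add: horner_def)

lemma horner_append: "horner (as @ bs) n = horner bs (horner as n)"
  by (simp add: horner_def)

lemma horner_rev_bits: "horner (rev (bits n)) 0 = n"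
proof (induction n rule: bits.induct)
  case (1 n)
  then show ?case
    by (cases "n = 0") (auto simp: bits_rec horner_append shift_in_def)
qed

lemma polytime_horner: "polytime f \<Longrightarrow> polytime (\<lambda>s. horner (f s) 0)"
proof -
  have "polytime (\<lambda>bs. fold shift_in bs 0)"
  proof (rule polytime_fold_add[where B = "\<lambda>n. 4"])
    show "sz (shift_in b n) \<le> sz n + 4" for b n
      by (rule sz_shift_in)
  qed (intro polytime_basic poly_bounded_intros polytime_shift_in)+
  then have "polytime (\<lambda>bs. horner bs 0)"
    by (simp add: horner_def)
  then show "polytime f \<Longrightarrow> polytime (\<lambda>s. horner (f s) 0)"
    by (rule polytime_comp)
qed

text \<open>Schoolbook addition; the state consists of the remaining summands, the carry and the digits of
  the result, most significant digit first.\<close>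

definition add_step :: "nat \<times> nat \<times> bool \<times> bool list \<Rightarrow> nat \<times> nat \<times> bool \<times> bool list" where
  "add_step s = (fst s div 2, fst (snd s) div 2,
     (if odd (fst s) then odd (fst (snd s)) \<or> fst (snd (snd s)) else odd (fst (snd s)) \<and> fst (snd (snd s))),
     (odd (fst s) = (odd (fst (snd s)) = fst (snd (snd s)))) # snd (snd (snd s)))"

text \<open>The invariant of addition: the pending sum \<open>x + y + c\<close>, followed by the
  digits already output, spells the total. Each step moves the last digit of the pending sum to the
  output.\<close>

lemma add_step_eq:
  assumes "add_step (x, y, c, out) = (x', y', c', out')"
  shows "x' + y' + of_bool c' = (x + y + of_bool c) div 2"
    "horner out' (x' + y' + of_bool c') = horner out (x + y + of_bool c)"
proof -
  obtain a b :: bool where *: "a = odd x" "b = odd y" by simp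
  have x: "x = 2 * (x div 2) + of_bool a" and y: "y = 2 * (y div 2) + of_bool b"
    unfolding * by simp_all
  have half: "m = n div 2" if "2 * m + of_bool b = n" for m n :: nat and b
    using that by (cases b) auto
  \<comment> \<open>The test \<open>a = (b = c)\<close> is the exclusive or of the three bits, hence
    the last digit of their sum.\<close>
  have s: "2 * (x' + y' + of_bool c') + of_bool (a = (b = c)) = x + y + of_bool c"
    using assms x y unfolding add_step_def *[symmetric] by (cases a; cases b; cases c) auto
  then show "x' + y' + of_bool c' = (x + y + of_bool c) div 2"
    by (rule half)
  have "out' = (a = (b = c)) # out"
    using assms unfolding add_step_def by (auto simp: *)
  then show "horner out' (x' + y' + of_bool c') = horner out (x + y + of_bool c)"
    using s by (simp add: shift_in_def)
qed

lemma fold_add_step: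
  "fold (\<lambda>_. add_step) ks (x, y, c, out) = (x', y', c', out') \<Longrightarrow>
     x' + y' + of_bool c' = (x + y + of_bool c) div 2 ^ length ks \<and>
     horner out' (x' + y' + of_bool c') = horner out (x + y + of_bool c) \<and>
     length out' = length out + length ks \<and> x' \<le> x \<and> y' \<le> y"
proof (induction ks arbitrary: x y c out)
  case (Cons k ks)
  obtain x1 y1 c1 out1 where 1: "add_step (x, y, c, out) = (x1, y1, c1, out1)"
    by (metis prod_cases4)
  then have "length out1 = Suc (length out)" "x1 \<le> x" "y1 \<le> y"
    by (auto simp: add_step_def)
  then show ?case
    using Cons.IH[of x1 y1 c1 out1] Cons.prems add_step_eq[OF 1]
    by (auto simp: 1 div_mult2_eq)
qed simp

text \<open>The folded list is a clock whose number of ticks suffices to shift the pending sum,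
  final carry included, down to zero; the digits then hold the whole result.\<close>

lemma add_eq_fold:
  "x + y = horner (snd (snd (snd (fold (\<lambda>_. add_step) (True # bits x @ bits y) (x, y, False, []))))) 0"
proof -
  obtain x' y' c' out' where
    1: "fold (\<lambda>_. add_step) (True # bits x @ bits y) (x, y, False, []) = (x', y', c', out')"
    by (metis prod_cases4)
  have "x < 2 ^ bitlen x" "y < 2 ^ bitlen y"
    by (rule less_bitlen)+
  moreover have "(2::nat) ^ bitlen x \<le> 2 ^ (bitlen x + bitlen y)" "(2::nat) ^ bitlen y \<le> 2 ^ (bitlen x + bitlen y)"
    by (rule power_increasing; simp)+
  ultimately have "x + y < 2 ^ Suc (bitlen x + bitlen y)"
    unfolding power_Suc by linarith
  then have "(x + y) div 2 ^ length (True # bits x @ bits y) = 0"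
    by (simp add: bitlen_def)
  then show ?thesis
    using fold_add_step[OF 1] 1 by (auto simp del: fold_simps)
qed

lemma polytime_add:
  assumes "polytime f" "polytime g"
  shows "polytime (\<lambda>s. f s + (g s :: nat))"
proof -
  let ?xs = "\<lambda>s. True # bits (fst s) @ bits (snd s)" and ?a = "\<lambda>s::nat \<times> nat. (fst s, snd s, False, [] :: bool list)"
  have "polytime (\<lambda>s::nat \<times> nat. fold (\<lambda>_. add_step) (?xs s) (?a s))"
  proof (rule polytime_fold[where B = "\<lambda>n. 100 + 100 * n"])
    show "polytime (\<lambda>p::(nat \<times> nat) \<times> bool \<times> nat \<times> nat \<times> bool \<times> bool list. add_step (snd (snd p)))"
      unfolding add_step_def by (intro polytime_basic polytime_div2 polytime_odd)
    fix s :: "nat \<times> nat" and ys zs assume ys: "?xs s = ys @ zs"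
    obtain x' y' c' out' where 1: "fold (\<lambda>_. add_step) ys (?a s) = (x', y', c', out')"
      by (metis prod_cases4)
    note 2 = fold_add_step[OF 1]
    have "length ys \<le> 1 + bitlen (fst s) + bitlen (snd s)"
      using arg_cong[OF ys, of length] by (simp add: bitlen_def)
    then have "length ys \<le> 1 + sz (fst s) + sz (snd s)"
      using bitlen_le_sz[of "fst s"] bitlen_le_sz[of "snd s"] by linarith
    moreover have "sz out' \<le> 1 + length ys * 4"
      using sz_list_le[of out' 3] sz_bool 2 by simp
    moreover have "sz x' \<le> 1 + 4 * sz (fst s)"
      using 2 less_pow_sz[of "fst s"] by (intro sz_nat_less) simp
    moreover have "sz y' \<le> 1 + 4 * sz (snd s)"
      using 2 less_pow_sz[of "snd s"] by (intro sz_nat_less) simp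
    moreover have "sz s = Suc (sz (fst s) + sz (snd s))"
      by (cases s) simp
    ultimately show "sz (fold (\<lambda>_. add_step) ys (?a s)) \<le> 100 + 100 * sz s"
      using sz_bool[of c'] unfolding 1 by simp
  qed (intro polytime_basic poly_bounded_intros polytime_append polytime_bits)+
  then have "polytime (\<lambda>s::nat \<times> nat. horner (snd (snd (snd (fold (\<lambda>_. add_step) (?xs s) (?a s))))) 0)"
    by (intro polytime_basic polytime_horner)
  then have "polytime (\<lambda>s::nat \<times> nat. fst s + snd s)"
    by (subst add_eq_fold) simp
  then show ?thesis
    using polytime_comp[of "\<lambda>p. fst p + snd p" "\<lambda>s. (f s, g s)"] polytime_pair[OF assms] by simp
qed

text \<open>Shift-and-add is Horner's scheme scaled by \<open>y\<close>. The start value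
  \<open>m * y\<close> generalises the claim for the induction, and every partial result is a digit
  prefix times \<open>y\<close>.\<close>

lemma fold_mult:
  "fold (\<lambda>b n. shift_in False n + (if b then y else 0)) bs (m * y) = horner bs m * y"
proof (induction bs arbitrary: m)
  case (Cons b bs)
  have "shift_in False (m * y) + (if b then y else 0) = shift_in b m * y"
    by (simp add: shift_in_def algebra_simps)
  then show ?case using Cons by simp
qed simp

lemma horner_less: "n < 2 ^ k \<Longrightarrow> horner bs n < 2 ^ (k + length bs)"
proof (induction bs arbitrary: n k)
  case (Cons b bs)
  have "shift_in b n < 2 ^ Suc k"
    using Cons.prems by (auto simp: shift_in_def of_bool_def)
  from Cons.IH[OF this] show ?case by simp
qed simp

lemma polytime_mult:
  assumes "polytime f" "polytime g"
  shows "polytime (\<lambda>s. f s * (g s :: nat))"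
proof -
  let ?step = "\<lambda>s b n. shift_in False n + (if b then snd s else (0::nat))"
  have fold: "fold (?step s) bs 0 = horner bs 0 * snd s" for s :: "nat \<times> nat" and bs
    using fold_mult[of "snd s" bs 0] by simp
  have "polytime (\<lambda>s::nat \<times> nat. fold (?step s) (rev (bits (fst s))) 0)"
  proof (rule polytime_fold[where B = "\<lambda>n. 1 + 4 * (n + n)"])
    fix s :: "nat \<times> nat" and ys zs assume ys: "rev (bits (fst s)) = ys @ zs"
    have "length ys \<le> sz (fst s)"
      using arg_cong[OF ys, of length] bitlen_le_sz[of "fst s"] by (simp add: bitlen_def)
    then have "length ys \<le> sz s" using sz_fst[of s] by simp
    moreover have "horner ys 0 < 2 ^ length ys"
      using horner_less[of 0 0 ys] by simp
    moreover have "snd s < 2 ^ sz s"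
      using less_pow_sz[of "snd s"] sz_snd[of s]
      by (meson less_le_trans one_le_numeral power_increasing)
    ultimately have "horner ys 0 * snd s < 2 ^ sz s * 2 ^ sz s"
      by (intro mult_strict_mono) (auto elim!: less_le_trans)
    then have "horner ys 0 * snd s < 2 ^ (sz s + sz s)"
      by (simp add: power_add)
    then show "sz (fold (?step s) ys 0) \<le> 1 + 4 * (sz s + sz s)"
      unfolding fold by (rule sz_nat_less)
  qed (intro polytime_basic poly_bounded_intros polytime_rev polytime_bits polytime_add polytime_shift_in)+
  then have "polytime (\<lambda>s::nat \<times> nat. fst s * snd s)"
    unfolding fold horner_rev_bits .
  then show ?thesis
    using polytime_comp[of "\<lambda>p. fst p * snd p" "\<lambda>s. (f s, g s)"] polytime_pair[OF assms] by simp
qed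

definition le_step :: "bool \<Rightarrow> nat \<times> bool \<Rightarrow> nat \<times> bool" where
  "le_step b s = (fst s div 2, if b = odd (fst s) then snd s else odd (fst s))"

text \<open>Comparison from the least significant digit: a later difference overrides the verdict of
  the lower digits, and a nonzero remainder of \<open>y\<close> after the last digit of
  \<open>x\<close> overrides everything. The initial verdict decides the case of equality.\<close>

lemma fold_le_step:
  "fold le_step (bits x) (y, le) = (y', le') \<Longrightarrow> (y' \<noteq> 0 \<or> le') = (x < y \<or> (x = y \<and> le))"
proof (induction x arbitrary: y le rule: bits.induct)
  case (1 x)
  show ?case
  proof (cases "x = 0")
    case False
    obtain a b :: bool where *: "a = odd x" "b = odd y" by simp
    have x: "x = 2 * (x div 2) + of_bool a" and y: "y = 2 * (y div 2) + of_bool b"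
      unfolding * by simp_all
    have "(y' \<noteq> 0 \<or> le') = (x div 2 < y div 2 \<or> x div 2 = y div 2 \<and> (if a = b then le else b))"
      using 1 False by (simp add: bits_rec le_step_def *)
    also have "\<dots> = (x < y \<or> (x = y \<and> le))"
      using x y by (cases a; cases b) (simp_all, linarith+)
    finally show ?thesis .
  qed (use 1 in auto)
qed

lemma polytime_le:
  assumes "polytime f" "polytime g"
  shows "polytime (\<lambda>s. f s \<le> (g s :: nat))"
proof -
  let ?r = "\<lambda>s::nat \<times> nat. fold le_step (bits (fst s)) (snd s, True)"
  have "polytime ?r"
  proof (rule polytime_fold[where B = "\<lambda>n. 100 + 100 * n"])
    show "polytime (\<lambda>p::(nat \<times> nat) \<times> bool \<times> nat \<times> bool. le_step (fst (snd p)) (snd (snd p)))"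
      unfolding le_step_def by (intro polytime_basic polytime_div2 polytime_odd)
    fix s :: "nat \<times> nat" and ys :: "bool list"
    have "fst (fold le_step ys (y, b)) \<le> y" for y b
    proof (induction ys arbitrary: y b)
      case (Cons c ys)
      show ?case
        using Cons[of "y div 2" "snd (le_step c (y, b))"] by (simp add: le_step_def split: if_splits)
    qed simp
    then have "fst (fold le_step ys (snd s, True)) < 2 ^ sz (snd s)"
      using less_pow_sz[of "snd s"] le_less_trans by blast
    then have "sz (fst (fold le_step ys (snd s, True))) \<le> 1 + 4 * sz s"
      using sz_nat_less sz_snd[of s] by (meson add_left_mono le_trans mult_le_mono2)
    then show "sz (fold le_step ys (snd s, True)) \<le> 100 + 100 * sz s"
      using sz_bool[of "snd (fold le_step ys (snd s, True))"]
      by (cases "fold le_step ys (snd s, True)") simp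
  qed (intro polytime_basic poly_bounded_intros polytime_bits)+
  then have "polytime (\<lambda>s. fst (?r s) \<noteq> 0 \<or> snd (?r s))"
    by (intro polytime_basic polytime_eq_0)
  moreover have "(fst (?r s) \<noteq> 0 \<or> snd (?r s)) = (fst s \<le> snd s)" for s
    using fold_le_step[of "fst s" "snd s" True] by (cases "?r s") auto
  ultimately have "polytime (\<lambda>s::nat \<times> nat. fst s \<le> snd s)"
    by simp
  then show ?thesis
    using polytime_comp[of "\<lambda>p. fst p \<le> snd p" "\<lambda>s. (f s, g s)"] polytime_pair[OF assms] by simp
qed

lemma polytime_eq_nat:
  assumes "polytime f" "polytime g"
  shows "polytime (\<lambda>s. f s = (g s :: nat))"
  using polytime_conj[OF polytime_le[OF assms] polytime_le[OF assms(2,1)]]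
  by (simp add: order_eq_iff)

section \<open>Machines for predicates on words\<close>

text \<open>The alphabet being finite, the tree code of each symbol is wired into a cascade of
  conditionals.\<close>

definition push_symbol :: "nat list \<Rightarrow> com" where
  "push_symbol ss = foldr (\<lambda>s c. Cond (\<lambda>xs. xs ! 2 = s) (push_list (code (enc s))) c) ss Skip"

lemma terminates_push_symbol:
  "s \<in> set ss \<Longrightarrow> terminates (push_symbol ss) (stk a m (s # b) c) (stk a (code (enc s) @ m) (s # b) c)
     (4 * sz s + length ss)"
proof (induction ss)
  case (Cons s' ss)
  show ?case
  proof (cases "s = s'")
    case True
    have "terminates (push_list (code (enc s))) (stk a m (s # b) c) (stk a (code (enc s) @ m) (s # b) c)
        (4 * sz s)"
      using terminates_push_list[of "code (enc s)" a m "s # b" c] by (simp add: sz_def tsize_def)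
    from terminates_mono[OF terminates_Cond_True[OF _ this, of "\<lambda>xs. xs ! 2 = s'"],
        of "4 * sz s + length (s' # ss)"] True
    show ?thesis by (simp add: push_symbol_def)
  next
    case False
    with Cons have "terminates (push_symbol ss) (stk a m (s # b) c)
        (stk a (code (enc s) @ m) (s # b) c) (4 * sz s + length ss)"
      by simp
    from terminates_mono[OF terminates_Cond_False[OF _ this, of "\<lambda>xs. xs ! 2 = s'"],
        of "4 * sz s + length (s' # ss)"] False
    show ?thesis by (simp add: push_symbol_def)
  qed
qed simp

definition symbols :: "nat list" where
  "symbols = [1..<8]"

text \<open>The word lies reversed on tape 2, so consing symbol after symbol onto the list on tape 1
  restores its order.\<close>

definition load :: com where
  "load = Loop (\<lambda>xs. xs ! 2 \<noteq> 0) (push_symbol symbols ;; push 1 2 ;; pop 2)"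

lemma terminates_load:
  "set b \<subseteq> set symbols \<Longrightarrow>
   terminates load (stk [] (code (enc ys)) b []) (stk [] (code (enc (rev b @ ys))) [] []) (80 * length b + 1)"
proof (induction b arbitrary: ys)
  case Nil
  then show ?case
    unfolding load_def using terminates_Loop_exit[of "\<lambda>xs. xs ! 2 \<noteq> 0" "stk [] (code (enc ys)) [] []"]
    by simp
next
  case (Cons s b)
  then have s: "s \<in> set symbols" "s \<noteq> 0" by (auto simp: symbols_def)
  have "sz s \<le> 13"
    using s sz_nat_less[of s 3] by (simp add: symbols_def)
  then have 1: "terminates (push_symbol symbols) (stk [] (code (enc ys)) (s # b) [])
      (stk [] (code (enc s) @ code (enc ys)) (s # b) []) 60"
    by (intro terminates_mono[OF terminates_push_symbol[OF s(1)]]) (simp add: symbols_def)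
  have 2: "terminates (push 1 2) (stk [] (code (enc s) @ code (enc ys)) (s # b) [])
      (stk [] (code (enc (s # ys))) (s # b) []) 3"
    using terminates_push[of 1 2 "stk [] (code (enc s) @ code (enc ys)) (s # b) []"] by simp
  have 3: "terminates (pop 2) (stk [] (code (enc (s # ys))) (s # b) []) (stk [] (code (enc (s # ys))) b []) 1"
    using terminates_pop[of 2 "stk [] (code (enc (s # ys))) (s # b) []"] by simp
  have 4: "terminates load (stk [] (code (enc (s # ys))) b []) (stk [] (code (enc (rev b @ s # ys))) [] [])
      (80 * length b + 1)"
    using Cons.IH[of "s # ys"] Cons.prems by simp
  have "tops (stk [] (code (enc ys)) (s # b) []) ! 2 \<noteq> 0"
    using s by simp
  from terminates_Loop_step[of "\<lambda>xs. xs ! 2 \<noteq> 0", OF this terminates_Seq[OF 1 terminates_Seq[OF 2 3]]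
      4[unfolded load_def]]
  show ?case
    unfolding load_def by (auto elim!: terminates_mono)
qed

definition scan :: com where
  "scan = Loop (\<lambda>xs. xs ! 0 \<noteq> 7) (move_top 0 2)"

lemma terminates_scan:
  "7 \<notin> set a \<Longrightarrow> terminates scan (stk (a @ 7 # r) [] b []) (stk (7 # r) [] (rev a @ b) []) (7 * length a + 1)"
proof (induction a arbitrary: b)
  case Nil
  then show ?case
    unfolding scan_def using terminates_Loop_exit[of "\<lambda>xs. xs ! 0 \<noteq> 7" "stk (7 # r) [] b []"] by simp
next
  case (Cons x a)
  have 1: "terminates (move_top 0 2) (stk ((x # a) @ 7 # r) [] b []) (stk (a @ 7 # r) [] (x # b) []) 5"
    using terminates_move_top[of 0 2 "stk ((x # a) @ 7 # r) [] b []"] by simp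
  have 2: "terminates scan (stk (a @ 7 # r) [] (x # b) []) (stk (7 # r) [] (rev a @ x # b) []) (7 * length a + 1)"
    using Cons by simp
  have "tops (stk ((x # a) @ 7 # r) [] b []) ! 0 \<noteq> 7"
    using Cons.prems by simp
  from terminates_Loop_step[of "\<lambda>xs. xs ! 0 \<noteq> 7", OF this 1 2[unfolded scan_def]]
  show ?case
    unfolding scan_def by (auto elim!: terminates_mono)
qed

text \<open>Symbol \<open>7\<close> is the bar. If the first two bars are adjacent, the machine rejects before it looks
  at the rest of the input.\<close>

definition program :: "com \<Rightarrow> com" where
  "program c = scan ;; move_top 0 2 ;;
     Cond (\<lambda>xs. xs ! 0 = 7) (Halt False)
       (move_all 0 2 ;; push 1 1 ;; load ;; c ;; Cond (\<lambda>xs. xs ! 1 = 2) (Halt True) (Halt False))"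

lemma ok_program: "ok_com 4 8 c \<Longrightarrow> ok_com 4 8 (program c)"
proof -
  have "ok_com 4 8 (push_symbol ss)" for ss
    by (induction ss) (simp_all add: push_symbol_def)
  then show "ok_com 4 8 c \<Longrightarrow> ok_com 4 8 (program c)"
    by (simp add: program_def scan_def load_def)
qed

lemma terminates_prefix:
  assumes "7 \<notin> set a"
  shows "terminates scan (stk (a @ 7 # r) [] [] []) (stk (7 # r) [] (rev a) []) (7 * length a + 1)"
    "terminates (move_top 0 2) (stk (7 # r) [] (rev a) []) (stk r [] (7 # rev a) []) 5"
  using terminates_scan[OF assms, of r "[]"] terminates_move_top[of 0 2 "stk (7 # r) [] (rev a) []"]
  by simp_all

text \<open>The time depends on \<open>a\<close> alone, because nothing behind the second bar is
  read. This is the case in which the rest of the word has no bound in the input size.\<close>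

lemma program_rejects_early:
  assumes "7 \<notin> set a" "top_of r = 7"
  shows "halts (program c) (stk (a @ 7 # r) [] [] []) False (7 * length a + 9)"
proof -
  have "halts (Cond (\<lambda>xs. xs ! 0 = 7) (Halt False) d) (stk r [] (7 # rev a) []) False (0 + 1)" for d
    using assms(2) by (intro halts_Cond_True halts_Halt) simp
  from halts_mono[OF halts_Seq[OF terminates_prefix(1)[OF assms(1)]
      halts_Seq[OF terminates_prefix(2)[OF assms(1)] this]], of "7 * length a + 9"]
  show ?thesis
    unfolding program_def by simp
qed

lemma program_decides:
  fixes f :: "nat list \<Rightarrow> bool"
  assumes a: "7 \<notin> set a" and r: "top_of r \<noteq> 7" and w: "w = a @ 7 # r" "set w \<subseteq> {1..<8}"
    and c: "run c (enc w) (enc (f w)) k"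
  shows "halts (program c) (stk w [] [] []) (f w) (100 * length w + 100 + k)"
proof -
  have r0: "0 \<notin> set r" using w by auto
  have 1: "terminates (move_all 0 2) (stk r [] (7 # rev a) []) (stk [] [] (rev w) []) (7 * length r + 1)"
    using terminates_move_stk(2)[OF r0, of "[]" "7 # rev a" "[]"] by (simp add: w(1))
  have 2: "terminates (push 1 1) (stk [] [] (rev w) []) (stk [] (code (enc ([] :: nat list))) (rev w) []) 3"
    using terminates_push[of 1 1 "stk [] [] (rev w) []"] by simp
  have 3: "terminates load (stk [] (code (enc ([] :: nat list))) (rev w) []) (stk [] (code (enc w)) [] [])
      (80 * length w + 1)"
    using terminates_load[of "rev w" "[]"] w(2) by (auto simp: symbols_def)
  have 4: "terminates c (stk [] (code (enc w)) [] []) (stk [] (code (enc (f w))) [] []) k"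
    using c unfolding run_def by (metis append_Nil2)
  have 5: "halts (Cond (\<lambda>xs. xs ! 1 = 2) (Halt True) (Halt False)) (stk [] (code (enc (f w))) [] []) (f w) 1"
  proof (cases "f w")
    case True
    then show ?thesis
      using halts_Cond_True[OF _ halts_Halt[of True], of "\<lambda>xs. xs ! 1 = 2" "stk [] (code (enc (f w))) [] []"]
      by (simp add: code_enc_bool)
  next
    case False
    then show ?thesis
      using halts_Cond_False[OF _ halts_Halt[of False], of "\<lambda>xs. xs ! 1 = 2" "stk [] (code (enc (f w))) [] []"]
      by (simp add: code_enc_bool)
  qed
  have "tops (stk r [] (7 # rev a) []) ! 0 \<noteq> 7" using r by simp
  note 6 = halts_Cond_False[of "\<lambda>xs. xs ! 0 = 7", OF this halts_Seq[OF 1 halts_Seq[OF 2 halts_Seq[OF 3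
    halts_Seq[OF 4 5]]]], of "Halt False"]
  note 7 = halts_Seq[OF terminates_prefix(1)[OF a] halts_Seq[OF terminates_prefix(2)[OF a] 6]]
  have "length w = Suc (length a + length r)"
    by (simp add: w(1))
  then show ?thesis
    unfolding program_def by (intro halts_mono[OF 7[folded w(1)]]) simp
qed

lemma rep_init: "rep (snd (init_config (tm_of 4 n c) w)) (stk w [] [] [])"
  unfolding rep_def
proof
  have "[0..<4::nat] = [0, 1, 2, 3]" by (simp add: upt_rec)
  moreover have "replicate (4 - 1) x = [x, x, x]" for x :: tape
    by (simp add: numeral_3_eq_3)
  ultimately show "snd (init_config (tm_of 4 n c) w) = map (\<lambda>i. stack_tape (stk w [] [] [] i) ((\<lambda>_. 0) i)) [0..<4]"
    by (simp add: init_config_def tm_of_def input_tape_eq)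
qed

lemma halts_tm:
  assumes "halts c (stk w [] [] []) b t" "t \<le> n"
  shows "if b then accepts_within (tm_of 4 8 c) w n else rejects_within (tm_of 4 8 c) w n"
proof -
  obtain s tps where "s \<le> t" "nsteps s (c, snd (init_config (tm_of 4 8 c) w)) (Halt b, tps)"
    using assms(1) rep_init unfolding halts_def by blast
  from tm_of_halts[OF this(2), of n] this(1) assms(2) show ?thesis
    by (cases b) (simp_all add: accepts_within_def rejects_within_def tm_of_def)
qed

theorem polytime_machine:
  fixes f :: "nat list \<Rightarrow> bool"
  assumes "polytime f"
  obtains M and p :: "nat poly" where "is_tm M" "num_symbols M = 8"
    "\<And>a r n. 7 \<notin> set a \<Longrightarrow> top_of r = 7 \<Longrightarrow> poly p (length a) \<le> n \<Longrightarrow> rejects_within M (a @ 7 # r) n"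
    "\<And>a r w n. 7 \<notin> set a \<Longrightarrow> top_of r \<noteq> 7 \<Longrightarrow> w = a @ 7 # r \<Longrightarrow> set w \<subseteq> {1..<8} \<Longrightarrow> poly p (length w) \<le> n \<Longrightarrow>
       if f w then accepts_within M w n else rejects_within M w n"
proof -
  obtain c q where c: "ok_com 4 8 c" "\<And>w. sz (f w) \<le> poly q (sz w)"
    "\<And>w. run c (enc w) (enc (f w)) (poly q (sz w))"
    by (rule polytimeE[OF assms], rule that)
  \<comment> \<open>A symbol is below \<open>2 ^ 3\<close> and hence has size at most 13; with one
    unit per list cell, a word of length \<open>n\<close> has size at most
    \<open>1 + 14 * n\<close>.\<close>
  have "poly_bounded (\<lambda>n. 100 * n + 100 + poly q (1 + 14 * n))"
    by (intro poly_bounded_intros)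
  then obtain p where p: "\<And>n. 100 * n + 100 + poly q (1 + 14 * n) \<le> poly p n"
    unfolding poly_bounded_def by blast
  let ?M = "tm_of 4 8 (program c)"
  show thesis
  proof (rule that)
    show "is_tm ?M"
      using is_tm_of[OF ok_program[OF c(1)]] by simp
    show "num_symbols ?M = 8"
      by (simp add: tm_of_def)
    show "rejects_within ?M (a @ 7 # r) n" if "7 \<notin> set a" "top_of r = 7" "poly p (length a) \<le> n" for a r n
    proof -
      have "7 * length a + 9 \<le> n"
        using p[of "length a"] that(3) by linarith
      from halts_tm[OF program_rejects_early[OF that(1,2)] this] show ?thesis
        by simp
    qed
    show "if f w then accepts_within ?M w n else rejects_within ?M w n"
      if "7 \<notin> set a" "top_of r \<noteq> 7" and w: "w = a @ 7 # r" "set w \<subseteq> {1..<8}" and n: "poly p (length w) \<le> n"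
      for a r w n
    proof -
      have "sz x \<le> 13" if "x \<in> set w" for x
        using that w(2) sz_nat_less[of x 3] by fastforce
      from sz_list_le[of w, OF this] have "sz w \<le> 1 + 14 * length w"
        by simp
      from poly_mono_nat[OF this, of q] have "100 * length w + 100 + poly q (sz w) \<le> n"
        using p[of "length w"] n by linarith
      from halts_tm[OF program_decides[where f = f and k = "poly q (sz w)", OF that(1,2) w c(3)] this] show ?thesis .
    qed
  qed
qed

section \<open>The decision procedure\<close>

lemma polytime_map:
  assumes "polytime f" and g: "polytime (\<lambda>p. g (fst p) (snd p))"
  shows "polytime (\<lambda>s. map (g s) (f s))"
proof -
  have eq: "fold (\<lambda>x ys. g s x # ys) xs [] = rev (map (g s) xs)" for s xs
  proof -
    have "fold (\<lambda>x ys. g s x # ys) xs zs = rev (map (g s) xs) @ zs" for zs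
      by (induction xs arbitrary: zs) auto
    then show ?thesis by simp
  qed
  obtain p :: "nat poly" where p: "\<And>s x n. sz (s, x) \<le> n \<Longrightarrow> sz (g s x) \<le> poly p n"
    using polytime_bound[OF g] by (metis fst_conv snd_conv)
  obtain q :: "nat poly" where q: "\<And>s n. sz s \<le> n \<Longrightarrow> sz (f s) \<le> poly q n"
    using polytime_bound[OF assms(1)] by metis
  have "polytime (\<lambda>s. fold (\<lambda>x ys. g s x # ys) (f s) [])"
  proof (rule polytime_fold_add[where B = "\<lambda>n. 1 + poly p (1 + n + poly q n)"])
    have "polytime (\<lambda>p. (fst p, fst (snd p)))"
      by (intro polytime_basic)
    from polytime_comp[OF g this]
    have "polytime (\<lambda>p. g (fst p) (fst (snd p)))"
      by simp
    then show "polytime (\<lambda>p. g (fst p) (fst (snd p)) # snd (snd p))"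
      by (intro polytime_basic)
    fix s x and ys :: "'c list" assume x: "x \<in> set (f s)"
    have "sz (s, x) \<le> 1 + sz s + poly q (sz s)"
      using sz_mem[OF x] q[of s "sz s"] by simp
    from p[OF this] show "sz (g s x # ys) \<le> sz ys + (1 + poly p (1 + sz s + poly q (sz s)))"
      by simp
  qed (intro polytime_basic poly_bounded_intros assms)+
  then have "polytime (\<lambda>s. rev (rev (map (g s) (f s))))"
    unfolding eq by (rule polytime_rev)
  then show ?thesis by simp
qed

lemma polytime_bex:
  assumes "polytime f" and P: "polytime (\<lambda>p. P (fst p) (snd p))"
  shows "polytime (\<lambda>s. \<exists>x\<in>set (f s). P s x)"
proof -
  have eq: "fold (\<lambda>x b. b \<or> P s x) xs b = (b \<or> (\<exists>x\<in>set xs. P s x))" for s xs b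
    by (induction xs arbitrary: b) auto
  have "polytime (\<lambda>s. fold (\<lambda>x b. b \<or> P s x) (f s) False)"
  proof (rule polytime_fold_add[where B = "\<lambda>n. 3"])
    have "polytime (\<lambda>p. (fst p, fst (snd p)))"
      by (intro polytime_basic)
    from polytime_comp[OF P this]
    have "polytime (\<lambda>p. P (fst p) (fst (snd p)))"
      by simp
    then show "polytime (\<lambda>p. snd (snd p) \<or> P (fst p) (fst (snd p)))"
      by (intro polytime_basic)
    show "sz (b \<or> P s x) \<le> sz b + 3" for b s x
      using sz_bool[of "b \<or> P s x"] by simp
  qed (intro polytime_basic poly_bounded_intros assms)+
  then show ?thesis
    unfolding eq by simp
qed

text \<open>Scanning the input: an entry is a sign with a natural number, a record a list of entries that
  was closed by a semicolon. At each bar the current record and the list of completed ones are stored.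
  All lists come out in reverse.\<close>

type_synonym entry = "bool \<times> nat"

text \<open>Slash and comma both fall into the last case, so a fraction simply contributes two
  entries, the denominator in front of the numerator.\<close>

definition scan_step ::
  "nat \<Rightarrow> entry \<times> entry list \<times> entry list list \<times> (entry list \<times> entry list list) list
       \<Rightarrow> entry \<times> entry list \<times> entry list list \<times> (entry list \<times> entry list list) list" where
  "scan_step c s =
     (if c = 1 then ((fst (fst s), shift_in False (snd (fst s))), snd s)
      else if c = 2 then ((fst (fst s), shift_in True (snd (fst s))), snd s)
      else if c = 3 then ((True, snd (fst s)), snd s)
      else if c = 6 then ((False, 0), [], (fst s # fst (snd s)) # fst (snd (snd s)), snd (snd (snd s)))
      else if c = 7 then ((False, 0), [], [],
        (fst s # fst (snd s), fst (snd (snd s))) # snd (snd (snd s)))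
      else ((False, 0), fst s # fst (snd s), snd (snd s)))"

definition sections :: "nat list \<Rightarrow> (entry list \<times> entry list list) list" where
  "sections w = snd (snd (snd (fold scan_step w ((False, 0), [], [], []))))"

lemma sz_scan_step: "sz (scan_step c s) \<le> sz s + 10"
proof -
  obtain b n fs rs ss where s: "s = ((b, n), fs, rs, ss)"
    by (metis prod.collapse)
  have "sz (0::nat) = 1" by (simp add: sz_nat)
  then show ?thesis
    using sz_shift_in[of False n] sz_shift_in[of True n] sz_pos[of b] unfolding s scan_step_def by simp
qed

lemma polytime_sections: "polytime sections"
proof -
  have "polytime (\<lambda>w. fold scan_step w ((False, 0), [], [], []))"
  proof (rule polytime_fold_add[where B = "\<lambda>n. 10"])
    show "polytime (\<lambda>p::nat list \<times> nat \<times> entry \<times> entry list \<times> entry list list \<times>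
        (entry list \<times> entry list list) list. scan_step (fst (snd p)) (snd (snd p)))"
      unfolding scan_step_def by (intro polytime_basic polytime_eq_nat polytime_shift_in)
    show "sz (scan_step x b) \<le> sz b + 10" for x b
      by (rule sz_scan_step)
  qed (intro polytime_basic poly_bounded_intros)+
  then show ?thesis
    unfolding sections_def by (intro polytime_basic)
qed

text \<open>An edge \<open>(p, q, u, v, h, r)\<close> leads from \<open>p\<close> to \<open>q\<close> with weight \<open>(u - v) / h\<close> and discount factor
  \<open>r\<close>; likewise \<open>(u, v, d)\<close> stands for the number \<open>(u - v) / d\<close>. Differences keep all components
  natural.\<close>

type_synonym edge = "nat \<times> nat \<times> nat \<times> nat \<times> nat \<times> nat"
type_synonym frac = "nat \<times> nat \<times> nat"

text \<open>One step of the value recursion, weight plus discounted rest, over the common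
  denominator \<open>h * (d * r)\<close>. The fraction is not reduced, so only additions and
  multiplications occur.\<close>

definition prepend :: "edge \<Rightarrow> frac \<Rightarrow> frac" where
  "prepend e x =
     (fst (snd (snd e)) * (snd (snd x) * snd (snd (snd (snd (snd e))))) + fst x * fst (snd (snd (snd (snd e)))),
      fst (snd (snd (snd e))) * (snd (snd x) * snd (snd (snd (snd (snd e))))) + fst (snd x) * fst (snd (snd (snd (snd e)))),
      fst (snd (snd (snd (snd e)))) * (snd (snd x) * snd (snd (snd (snd (snd e))))))"

text \<open>Cross-multiplication with the subtracted terms moved to the other side, so that the
  comparison stays within the natural numbers.\<close>

definition frac_le :: "frac \<Rightarrow> frac \<Rightarrow> bool" where
  "frac_le x y \<longleftrightarrow> fst x * snd (snd y) + fst (snd y) * snd (snd x) \<le> fst y * snd (snd x) + fst (snd x) * snd (snd y)"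

definition best_step :: "edge \<Rightarrow> edge \<times> frac \<Rightarrow> frac \<Rightarrow> frac" where
  "best_step e t x = (if fst (fst t) = fst (snd e) \<and> frac_le (snd t) x then snd t else x)"

text \<open>The start value \<open>(0, 0, 1)\<close> stands for the empty continuation: a path may
  end after \<open>e\<close>.\<close>

definition best :: "(edge \<times> frac) list \<Rightarrow> edge \<Rightarrow> frac" where
  "best tab e = fold (best_step e) tab (0, 0, 1)"

text \<open>An entry belongs to a first edge, not to a state. Since \<open>best\<close> admits
  stopping, \<open>k\<close> rounds account for all nonempty paths of at most \<open>k\<close>
  edges.\<close>

definition relax :: "edge list \<Rightarrow> (edge \<times> frac) list \<Rightarrow> (edge \<times> frac) list" where
  "relax es tab = map (\<lambda>e. (e, prepend e (best tab e))) es"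

text \<open>\<open>ks\<close> is a unary clock for the number of rounds. From the empty table the
  first round produces the paths with a single edge.\<close>

definition solve :: "edge list \<Rightarrow> 'a list \<Rightarrow> (edge \<times> frac) list" where
  "solve es ks = fold (\<lambda>_. relax es) ks []"

lemma polytime_prepend: "polytime f \<Longrightarrow> polytime g \<Longrightarrow> polytime (\<lambda>s. prepend (f s) (g s))"
  unfolding prepend_def by (intro polytime_basic polytime_add polytime_mult)

lemma polytime_frac_le: "polytime f \<Longrightarrow> polytime g \<Longrightarrow> polytime (\<lambda>s. frac_le (f s) (g s))"
  unfolding frac_le_def by (intro polytime_basic polytime_add polytime_mult polytime_le)

text \<open>A minimum is one of the given fractions, so selecting it cannot make numbers
  longer.\<close>

lemma fold_best_step: "fold (best_step e) tab x \<in> insert x (snd ` set tab)"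
proof (induction tab arbitrary: x)
  case (Cons t tab)
  show ?case
    using Cons[of "best_step e t x"] by (auto simp: best_step_def split: if_splits)
qed simp

lemma polytime_best:
  assumes "polytime f" "polytime g"
  shows "polytime (\<lambda>s. best (f s) (g s))"
proof -
  have "polytime (\<lambda>s. fold (best_step (snd s)) (fst s) (0, 0, 1))"
  proof (rule polytime_fold[where B = "\<lambda>n. n + 10"])
    show "polytime (\<lambda>p :: ((edge \<times> frac) list \<times> edge) \<times> (edge \<times> frac) \<times> frac.
        best_step (snd (fst p)) (fst (snd p)) (snd (snd p)))"
      unfolding best_step_def by (intro polytime_basic polytime_eq_nat polytime_frac_le)
    fix s :: "(edge \<times> frac) list \<times> edge" and ys zs assume s: "fst s = ys @ zs"
    have "fold (best_step (snd s)) ys (0, 0, 1) \<in> insert (0, 0, 1) (snd ` set ys)"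
      by (rule fold_best_step)
    moreover have "set ys \<subseteq> set (fst s)"
      using s by simp
    ultimately consider "fold (best_step (snd s)) ys (0, 0, 1) = (0, 0, 1)"
      | t where "t \<in> set (fst s)" "fold (best_step (snd s)) ys (0, 0, 1) = snd t"
      by blast
    then show "sz (fold (best_step (snd s)) ys (0, 0, 1)) \<le> sz s + 10"
    proof cases
      case 1
      then show ?thesis by (simp add: sz_nat bits_rec)
    next
      case 2
      then show ?thesis
        using sz_snd[of t] sz_mem[OF 2(1)] sz_fst[of s] by simp
    qed
  qed (intro polytime_basic poly_bounded_intros)+
  then have "polytime (\<lambda>s. best (fst s) (snd s))"
    by (simp add: best_def)
  from polytime_comp[OF this polytime_pair[OF assms]] show ?thesis by simp
qed

lemma polytime_relax: "polytime f \<Longrightarrow> polytime g \<Longrightarrow> polytime (\<lambda>s. relax (f s) (g s))"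
proof -
  have "polytime (\<lambda>s. relax (fst s) (snd s))"
    unfolding relax_def
    by (intro polytime_map polytime_basic polytime_prepend polytime_best)
  then show "polytime f \<Longrightarrow> polytime g \<Longrightarrow> polytime (\<lambda>s. relax (f s) (g s))"
    using polytime_comp[of "\<lambda>s. relax (fst s) (snd s)" "\<lambda>s. (f s, g s)"] polytime_pair[of f g] by simp
qed

section \<open>Growth of the numbers during value iteration\<close>

definition small_edge :: "nat \<Rightarrow> edge \<Rightarrow> bool" where
  "small_edge k e \<longleftrightarrow> (case e of (p, q, u, v, h, r) \<Rightarrow> u \<le> 2 ^ k \<and> v \<le> 2 ^ k \<and> h \<le> 2 ^ k \<and> r \<le> 2 ^ k)"

definition small_frac :: "nat \<Rightarrow> frac \<Rightarrow> bool" where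
  "small_frac k x \<longleftrightarrow> (case x of (u, v, d) \<Rightarrow> u \<le> 2 ^ k \<and> v \<le> 2 ^ k \<and> d \<le> 2 ^ k)"

text \<open>A product with the denominators \<open>d\<close> and \<open>r\<close> adds
  \<open>2 * k\<close> to the exponent \<open>m\<close>; the sum of two such terms costs one more
  bit.\<close>

lemma small_prepend:
  assumes "small_edge k e" "small_frac m x"
  shows "small_frac (m + (2 * k + 1)) (prepend e x)"
proof -
  obtain p q u v h r where e: "e = (p, q, u, v, h, r)" by (cases e) auto
  obtain a b d where x: "x = (a, b, d)" by (cases x) auto
  have le: "c * (d * r) + z * h \<le> 2 ^ (m + (2 * k + 1))" if "c \<le> 2 ^ k" "z \<le> 2 ^ m" for c z
  proof -
    have "c * (d * r) \<le> 2 ^ k * (2 ^ m * 2 ^ k)"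
      using that assms by (intro mult_mono) (auto simp: e x small_edge_def small_frac_def)
    moreover have "z * h \<le> 2 ^ m * 2 ^ k"
      using that assms by (intro mult_mono) (auto simp: e small_edge_def)
    moreover have "(2::nat) ^ m * 2 ^ k \<le> 2 ^ k * (2 ^ m * 2 ^ k)" by simp
    moreover have "(2::nat) ^ (m + (2 * k + 1)) = 2 * (2 ^ k * (2 ^ m * 2 ^ k))"
      by (simp add: power_add mult_2)
    ultimately show ?thesis by linarith
  qed
  show ?thesis
    using le[of u a] le[of v b] le[of h 0] assms
    by (simp add: prepend_def small_frac_def small_edge_def e x)
qed

lemma small_best: "(\<And>t. t \<in> set tab \<Longrightarrow> small_frac m (snd t)) \<Longrightarrow> small_frac m (best tab e)"
  using fold_best_step[of e tab "(0, 0, 1)"] unfolding best_def by (auto simp: small_frac_def)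

lemma solve_snoc: "solve es (ks @ [k]) = relax es (solve es ks)"
  by (simp add: solve_def)

text \<open>Bit lengths grow linearly in the number of rounds, which is what makes iteration without
  reducing fractions affordable.\<close>

lemma small_solve:
  assumes "\<And>e. e \<in> set es \<Longrightarrow> small_edge k e"
  shows "t \<in> set (solve es ks) \<Longrightarrow> fst t \<in> set es \<and> small_frac (length ks * (2 * k + 1)) (snd t)"
proof (induction ks arbitrary: t rule: rev_induct)
  case (snoc x ks)
  then obtain e where e: "e \<in> set es" "t = (e, prepend e (best (solve es ks) e))"
    by (auto simp: solve_snoc relax_def)
  have "small_frac (length ks * (2 * k + 1)) (best (solve es ks) e)"
    using snoc.IH by (intro small_best) simp
  from small_prepend[OF assms[OF e(1)] this] e show ?case
    by (simp add: algebra_simps)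
qed (simp add: solve_def)

lemma length_solve: "length (solve es ks) \<le> length es"
  by (cases ks rule: rev_cases) (simp_all add: solve_snoc relax_def, simp add: solve_def)

lemma sz_small_frac:
  assumes "small_frac k x"
  shows "sz x \<le> 17 + 12 * k"
proof -
  obtain a b d where x: "x = (a, b, d)" by (cases x) auto
  have "(2::nat) ^ k < 2 ^ (k + 1)" by simp
  then have "a < 2 ^ (k + 1)" "b < 2 ^ (k + 1)" "d < 2 ^ (k + 1)"
    using assms unfolding x small_frac_def by (auto elim: le_less_trans)
  from this[THEN sz_nat_less] show ?thesis
    by (simp add: x)
qed

lemma polytime_solve: "polytime f \<Longrightarrow> polytime g \<Longrightarrow> polytime (\<lambda>s. solve (f s) (g s :: nat list))"
proof -
  have "polytime (\<lambda>s. fold (\<lambda>_. relax (fst s)) (snd s :: nat list) [])"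
  proof (rule polytime_fold[where B = "\<lambda>n. 1 + n * (20 + n + 12 * (n * (2 * n + 1)))"])
    fix s :: "edge list \<times> nat list" and ys zs assume s: "snd s = ys @ zs"
    let ?n = "sz s"
    have n: "sz (fst s) \<le> ?n" "length (fst s) \<le> ?n" "length ys \<le> ?n"
      using sz_fst[of s] sz_snd[of s] length_le_sz[of "fst s"] length_le_sz[of "snd s"] s by simp_all
    \<comment> \<open>A number is smaller than two to the power of its own size, so the size of the
      whole argument bounds all exponents.\<close>
    have small: "small_edge ?n e" if "e \<in> set (fst s)" for e
    proof -
      obtain p q u v h r where e: "e = (p, q, u, v, h, r)" by (cases e) auto
      have "sz u \<le> ?n" "sz v \<le> ?n" "sz h \<le> ?n" "sz r \<le> ?n"
        using sz_mem[OF that] n(1) by (simp_all add: e)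
      then have "(2::nat) ^ sz x \<le> 2 ^ ?n" if "x \<in> {u, v, h, r}" for x
        using that by (auto intro: power_increasing)
      then have "x \<le> 2 ^ ?n" if "x \<in> {u, v, h, r}" for x
        using that less_pow_sz[of x] by (meson less_imp_le order_trans)
      then show ?thesis by (simp add: e small_edge_def)
    qed
    have t: "sz t \<le> 19 + ?n + 12 * (?n * (2 * ?n + 1))" if "t \<in> set (solve (fst s) ys)" for t
    proof -
      have "fst t \<in> set (fst s)" and 2: "small_frac (length ys * (2 * ?n + 1)) (snd t)"
        using small_solve[OF small that] by blast+
      then have "sz (fst t) \<le> ?n"
        using sz_mem[of "fst t" "fst s"] n(1) by linarith
      moreover note sz_small_frac[OF 2]
      moreover have "length ys * (2 * ?n + 1) \<le> ?n * (2 * ?n + 1)"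
        using n(3) by (rule mult_le_mono1)
      moreover have "sz t = Suc (sz (fst t) + sz (snd t))" by (cases t) simp
      ultimately show ?thesis by linarith
    qed
    have "sz (solve (fst s) ys) \<le> 1 + length (solve (fst s) ys) * (1 + (19 + ?n + 12 * (?n * (2 * ?n + 1))))"
      by (rule sz_list_le[OF t])
    also have "\<dots> \<le> 1 + ?n * (1 + (19 + ?n + 12 * (?n * (2 * ?n + 1))))"
      using length_solve[of "fst s" ys] n(2) by (intro add_left_mono mult_le_mono1) simp
    also have "\<dots> = 1 + ?n * (20 + ?n + 12 * (?n * (2 * ?n + 1)))" by simp
    finally show "sz (fold (\<lambda>_. relax (fst s)) ys []) \<le> 1 + ?n * (20 + ?n + 12 * (?n * (2 * ?n + 1)))"
      by (simp add: solve_def)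
  qed (intro polytime_basic poly_bounded_intros polytime_relax)+
  then have "polytime (\<lambda>s. solve (fst s) (snd s :: nat list))"
    by (simp add: solve_def)
  then show "polytime f \<Longrightarrow> polytime g \<Longrightarrow> polytime (\<lambda>s. solve (f s) (g s :: nat list))"
    using polytime_comp[of "\<lambda>s. solve (fst s) (snd s)" "\<lambda>s. (f s, g s)"] polytime_pair[of f g] by simp
qed

text \<open>A clock with quadratically many ticks; nesting it provides polynomial clocks of higher
  degree.\<close>

definition square_list :: "'a list \<Rightarrow> 'a list" where
  "square_list xs = fold (\<lambda>_ ys. xs @ ys) xs []"

lemma length_square_list: "length (square_list xs) = length xs * length xs"
proof -
  have "length (fold (\<lambda>_ ys. xs @ ys) zs ys) = length zs * length xs + length ys" for zs ys :: "'a list"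
    by (induction zs arbitrary: ys) auto
  then show ?thesis by (simp add: square_list_def)
qed

lemma polytime_square_list: "polytime f \<Longrightarrow> polytime (\<lambda>s. square_list (f s))"
proof -
  have "polytime (\<lambda>xs::'b list. fold (\<lambda>_ ys. xs @ ys) xs [])"
  proof (rule polytime_fold_add[where B = "\<lambda>n. n"])
    show "sz (xs @ ys) \<le> sz ys + sz xs" for xs ys :: "'b list"
      using sz_append[of xs ys] by simp
  qed (intro polytime_basic poly_bounded_intros polytime_append)+
  then have "polytime (square_list :: 'b list \<Rightarrow> _)"
    by (simp add: square_list_def[abs_def])
  then show "polytime f \<Longrightarrow> polytime (\<lambda>s. square_list (f s))"
    by (rule polytime_comp)
qed

definition entry_diff :: "entry \<Rightarrow> nat \<times> nat" where
  "entry_diff x = (if fst x then (0, snd x) else (snd x, 0))"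

text \<open>The record of a transition lists, in this order, denominator and numerator of the discount
  factor, denominator and numerator of the weight, target, letter and source.\<close>

definition edge_of_record :: "entry list \<Rightarrow> edge" where
  "edge_of_record r =
     (snd (hd (tl (tl (tl (tl (tl (tl r))))))), snd (hd (tl (tl (tl (tl r))))),
      fst (entry_diff (hd (tl (tl (tl r))))), snd (entry_diff (hd (tl (tl (tl r))))),
      snd (hd (tl (tl r))), snd (hd (tl r)))"

text \<open>The fourth power of the input length exceeds the bound on path lengths in \<open>short_path\<close>.\<close>

definition decide :: "nat list \<Rightarrow> bool" where
  "decide w \<longleftrightarrow>
     (\<exists>t\<in>set (solve (map edge_of_record (snd (hd (tl (tl (sections w)))))) (square_list (square_list w))).
        (\<exists>r\<in>set (snd (hd (tl (sections w)))). snd (hd r) = fst (fst t)) \<and>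
        frac_le (snd t)
          (fst (entry_diff (hd (tl (fst (hd (tl (tl (tl (sections w))))))))),
           snd (entry_diff (hd (tl (fst (hd (tl (tl (tl (sections w))))))))),
           snd (hd (fst (hd (tl (tl (tl (sections w)))))))))"

lemma polytime_entry_diff: "polytime f \<Longrightarrow> polytime (\<lambda>s. entry_diff (f s))"
  unfolding entry_diff_def by (intro polytime_basic)

lemma polytime_decide: "polytime decide"
proof -
  have sec: "polytime f \<Longrightarrow> polytime (\<lambda>s. sections (f s))" for f :: "'c::enc \<Rightarrow> nat list"
    by (rule polytime_comp[OF polytime_sections])
  show ?thesis
    unfolding decide_def[abs_def] edge_of_record_def[abs_def]
    by (intro polytime_bex polytime_map polytime_basic polytime_frac_le polytime_entry_diff
      polytime_solve polytime_square_list polytime_eq_nat sec)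
qed

section \<open>Short paths\<close>

locale weighted_graph =
  fixes E :: "'e set" and src tgt :: "'e \<Rightarrow> 'v" and wt :: "'e \<Rightarrow> rat" and disc :: "'e \<Rightarrow> nat"
  assumes finite_E: "finite E" and disc_ge_2: "e \<in> E \<Longrightarrow> 2 \<le> disc e"
begin

definition path :: "'e list \<Rightarrow> bool" where
  "path es \<longleftrightarrow> es \<noteq> [] \<and> set es \<subseteq> E \<and> successively (\<lambda>e f. tgt e = src f) es"

fun pval :: "'e list \<Rightarrow> rat" where
  "pval [] = 0"
| "pval (e # es) = wt e + pval es / of_nat (disc e)"

text \<open>The reciprocal of \<open>rate es\<close> is the discount applied to whatever follows
  \<open>es\<close>.\<close>

fun rate :: "'e list \<Rightarrow> nat" where
  "rate [] = 1"
| "rate (e # es) = disc e * rate es"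

lemma rate_append: "rate (as @ bs) = rate as * rate bs"
  by (induction as) auto

lemma pval_append: "pval (as @ bs) = pval as + pval bs / of_nat (rate as)"
  by (induction as) (auto simp: add_divide_distrib)

lemma rate_pos: "set es \<subseteq> E \<Longrightarrow> 0 < rate es"
  by (induction es) (use disc_ge_2 in fastforce)+

lemma rate_ge_2: "set es \<subseteq> E \<Longrightarrow> es \<noteq> [] \<Longrightarrow> 2 \<le> rate es"
proof (cases es)
  case (Cons e fs)
  assume "set es \<subseteq> E"
  then have "2 \<le> disc e" "1 \<le> rate fs"
    using disc_ge_2 rate_pos[of fs] by (auto simp: Cons Suc_le_eq)
  then have "2 * 1 \<le> disc e * rate fs" by (rule mult_le_mono)
  then show ?thesis by (simp add: Cons)
qed simp

lemma rate_le:
  assumes "\<And>e. e \<in> E \<Longrightarrow> disc e \<le> 2 ^ B"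
  shows "set es \<subseteq> E \<Longrightarrow> rate es \<le> 2 ^ (B * length es)"
proof (induction es)
  case (Cons e es)
  then have "disc e * rate es \<le> 2 ^ B * 2 ^ (B * length es)"
    by (intro mult_le_mono assms) auto
  then show ?case by (simp add: power_add)
qed simp

text \<open>With discount factors at least \<open>2\<close> the rest contributes at most half of
  \<open>2 * K\<close>, so the bound reproduces itself: a geometric series.\<close>

lemma pval_bound:
  assumes "\<And>e. e \<in> E \<Longrightarrow> \<bar>wt e\<bar> \<le> K" "0 \<le> K"
  shows "set es \<subseteq> E \<Longrightarrow> \<bar>pval es\<bar> \<le> 2 * K"
proof (induction es)
  case (Cons e es)
  have d: "2 \<le> (of_nat (disc e) :: rat)"
    using disc_ge_2[of e] Cons.prems by (metis list.set_intros(1) of_nat_le_iff of_nat_numeral subsetD)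
  have "\<bar>pval es / of_nat (disc e)\<bar> \<le> 2 * K / 2"
    unfolding abs_divide using Cons d assms(2) by (intro frac_le) auto
  moreover have "\<bar>wt e\<bar> \<le> K" using assms(1) Cons.prems by simp
  ultimately show ?case unfolding pval.simps by linarith
qed (use assms(2) in simp)

text \<open>Here integrality of the discount factors enters: \<open>rate es\<close> clears all
  denominators due to discounting, and \<open>D\<close> those of the weights.\<close>

lemma pval_integral:
  assumes "\<And>e. e \<in> E \<Longrightarrow> of_nat D * wt e \<in> \<int>"
  shows "set es \<subseteq> E \<Longrightarrow> of_nat D * of_nat (rate es) * pval es \<in> \<int>"
proof (induction es)
  case (Cons e es)
  have "of_nat (disc e) \<noteq> (0 :: rat)"
    using disc_ge_2[of e] Cons.prems by auto
  then have "of_nat D * of_nat (rate (e # es)) * pval (e # es)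
      = of_nat (disc e * rate es) * (of_nat D * wt e) + of_nat D * of_nat (rate es) * pval es"
    by (simp add: field_simps)
  also have "\<dots> \<in> \<int>"
  proof (rule Ints_add)
    show "of_nat (disc e * rate es) * (of_nat D * wt e) \<in> \<int>"
      by (rule Ints_mult[OF Ints_of_nat assms]) (use Cons.prems in simp)
    show "of_nat D * of_nat (rate es) * pval es \<in> \<int>"
      using Cons by simp
  qed
  finally show ?case .
qed simp

definition iterate :: "nat \<Rightarrow> 'e list \<Rightarrow> 'e list" where
  "iterate k bs = concat (replicate k bs)"

lemma iterate_simps [simp]: "iterate 0 bs = []" "iterate (Suc k) bs = bs @ iterate k bs"
  by (simp_all add: iterate_def)

lemma length_iterate: "length (iterate k bs) = k * length bs"
  by (induction k) auto

text \<open>Partial sum of a geometric series; the factor before the last parenthesis is the value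
  of the infinite repetition.\<close>

lemma pval_iterate:
  assumes "1 < rate bs"
  shows "pval (iterate k bs)
    = pval bs * of_nat (rate bs) / (of_nat (rate bs) - 1) * (1 - 1 / of_nat (rate bs) ^ k)"
proof (induction k)
  case (Suc k)
  define R :: rat where "R = of_nat (rate bs)"
  have "1 < R" using assms unfolding R_def by (metis of_nat_1 of_nat_less_iff)
  then have "pval bs + pval bs * R / (R - 1) * (1 - 1 / R ^ k) / R
      = pval bs * R / (R - 1) * (1 - 1 / R ^ Suc k)"
    by (simp add: field_simps)
  with Suc show ?case
    by (simp add: pval_append R_def)
qed simp

text \<open>Because \<open>e\<close> occurs again, the last edge of \<open>e # bs\<close> leads back
  to the source of \<open>e\<close>, so the segment can follow itself.\<close>

lemma path_iterate:
  assumes "path (as @ (e # bs) @ e # cs)" "0 < k"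
  shows "path (as @ iterate k (e # bs))"
proof -
  have *: "successively (\<lambda>e f. tgt e = src f) (iterate k (e # bs))
      \<and> set (iterate k (e # bs)) \<subseteq> set (e # bs)" for k
  proof (induction k)
    case (Suc k)
    have "iterate k (e # bs) \<noteq> [] \<Longrightarrow> hd (iterate k (e # bs)) = e"
      by (cases k) auto
    with Suc assms show ?case
      by (cases "iterate k (e # bs) = []")
        (auto simp: path_def successively_append_iff simp del: append_Cons)
  qed simp
  moreover have "hd (iterate k (e # bs)) = e" "iterate k (e # bs) \<noteq> []"
    using assms(2) by (cases k; simp)+
  ultimately show ?thesis
    using assms by (auto simp: path_def successively_append_iff)
qed

lemma path_shortcut: "path (as @ (e # bs) @ e # cs) \<Longrightarrow> path (as @ e # cs)"
  by (auto simp: path_def successively_append_iff simp del: append_Cons)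

text \<open>If removing a cycle from a path increases the value beyond the threshold, then the cycle is worth
  repeating: the value of the infinite iteration lies below the threshold, and by integrality by such a
  margin that a small number of iterations suffices.\<close>

lemma pump:
  assumes p: "path (as @ (e # bs) @ e # cs)" and le: "pval (as @ (e # bs) @ e # cs) \<le> \<nu>"
    and less: "\<nu> < pval (as @ e # cs)"
    and m: "length (as @ e # bs) \<le> m"
    and disc: "\<And>e. e \<in> E \<Longrightarrow> disc e \<le> 2 ^ B" and wt: "\<And>e. e \<in> E \<Longrightarrow> \<bar>wt e\<bar> \<le> 2 ^ B"
    and D: "\<And>e. e \<in> E \<Longrightarrow> of_nat D * wt e \<in> \<int>" and d: "of_nat d * \<nu> \<in> \<int>"
    and C: "d * D \<le> 2 ^ C" "0 < d * D"
  shows "pval (as @ iterate (B + 2 + C + B * m) (e # bs)) \<le> \<nu>"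
proof -
  \<comment> \<open>After \<open>k\<close> rounds the missing tail is at most
    \<open>2 ^ (B + 2) / 2 ^ k\<close>, while the margin is at least
    \<open>1 / 2 ^ (C + B * m)\<close>; this \<open>k\<close> makes the two equal.\<close>
  define k where "k = B + 2 + C + B * m"
  define bs' where "bs' = e # bs"
  define A Bv x where "A = pval as" and "Bv = pval bs'" and "x = pval (e # cs)"
  define Ra Rb :: rat where "Ra = of_nat (rate as)" and "Rb = of_nat (rate bs')"
  \<comment> \<open>The value of repeating the cycle forever, that is, the fixed point of mapping y
    to \<open>Bv + y / Rb\<close>.\<close>
  define c where "c = Bv * Rb / (Rb - 1)"
  have E: "set as \<subseteq> E" "set bs' \<subseteq> E" using p by (auto simp: path_def bs'_def)
  have rates: "1 \<le> rate as" "2 \<le> rate bs'"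
    using rate_pos[OF E(1)] rate_ge_2[OF E(2)] by (simp_all add: bs'_def)
  then have R: "1 \<le> Ra" "2 \<le> Rb"
    unfolding Ra_def Rb_def by (metis of_nat_1 of_nat_le_iff, metis of_nat_numeral of_nat_le_iff)
  have c: "c = Bv + c / Rb"
    using R unfolding c_def by (simp add: field_simps)
  have h1: "A + (Bv + x / Rb) / Ra \<le> \<nu>"
    using le by (simp only: pval_append bs'_def[symmetric] A_def Bv_def x_def Ra_def Rb_def)
  have h2: "\<nu> < A + x / Ra"
    using less by (simp only: pval_append A_def x_def Ra_def)
  \<comment> \<open>Both paths share the prefix, so the comparison is between \<open>x\<close> and
    its image under the cycle map. A contraction that lowers \<open>x\<close> has its fixed point
    \<open>c\<close> below \<open>x\<close>, and hence also below the image of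
    \<open>x\<close>.\<close>
  have "(Bv + x / Rb) / Ra < x / Ra" using h1 h2 by linarith
  then have "Bv + x / Rb < x" using R by (simp add: divide_less_cancel)
  then have "c < x"
    using R unfolding c_def by (simp add: field_simps)
  then have "c / Rb < x / Rb" using R by (simp add: divide_strict_right_mono)
  then have "c / Ra < (Bv + x / Rb) / Ra"
    using R c by (intro divide_strict_right_mono) linarith+
  then have gap: "0 < \<nu> - A - c / Ra" using h1 by linarith
  \<comment> \<open>A common denominator of the margin: \<open>d\<close> clears
    \<open>\<nu>\<close>, \<open>D\<close> with the rates clears \<open>A\<close> and
    \<open>Bv\<close>, and \<open>Rb - 1\<close> clears the geometric series.\<close>
  define Q :: rat where "Q = of_nat (d * D) * Ra * (Rb - 1)"
  have Q: "0 < Q" using R C(2) unfolding Q_def by (intro mult_pos_pos) auto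
  have "(\<nu> - A - c / Ra) * Q = of_nat D * of_nat (rate as) * (of_nat (rate bs') - 1) * (of_nat d * \<nu>)
      - of_nat d * (of_nat (rate bs') - 1) * (of_nat D * of_nat (rate as) * A)
      - of_nat d * (of_nat D * of_nat (rate bs') * Bv)"
    using R unfolding c_def Q_def Ra_def[symmetric] Rb_def[symmetric] of_nat_mult
    by (simp add: field_simps)
  also have "\<dots> \<in> \<int>"
    unfolding A_def Bv_def
    by (intro Ints_diff Ints_mult d pval_integral[OF D] E Ints_of_nat Ints_1)
  finally obtain z where z: "(\<nu> - A - c / Ra) * Q = of_int z"
    by (auto elim: Ints_cases)
  moreover have "0 < (\<nu> - A - c / Ra) * Q" using gap Q by simp
  \<comment> \<open>A positive integer is at least one: the strict inequality becomes a quantitative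
    margin.\<close>
  ultimately have "1 \<le> (\<nu> - A - c / Ra) * Q" by simp
  then have gap_Q: "1 / Q \<le> \<nu> - A - c / Ra"
    using Q by (simp add: divide_le_eq)
  have "rate as * rate bs' \<le> 2 ^ (B * m)"
  proof -
    have "rate (as @ bs') \<le> 2 ^ (B * length (as @ bs'))"
      using E by (intro rate_le disc) auto
    also have "\<dots> \<le> 2 ^ (B * m)"
      using m by (intro power_increasing mult_le_mono) (auto simp: bs'_def)
    finally show ?thesis by (simp add: rate_append)
  qed
  with C(1) have "d * D * (rate as * rate bs') \<le> 2 ^ C * 2 ^ (B * m)"
    by (rule mult_le_mono)
  then have "(of_nat (d * D * (rate as * rate bs')) :: rat) \<le> of_nat (2 ^ C * 2 ^ (B * m))"
    by (simp only: of_nat_le_iff)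
  moreover have "Q \<le> of_nat (d * D * (rate as * rate bs'))"
  proof -
    have "of_nat (d * D) * Ra * (Rb - 1) \<le> of_nat (d * D) * Ra * Rb"
      using R by (intro mult_left_mono) auto
    then show ?thesis by (simp add: Q_def Ra_def Rb_def mult.assoc)
  qed
  ultimately have "Q \<le> 2 ^ (C + B * m)" by (simp add: power_add)
  then have "1 / 2 ^ (C + B * m) \<le> 1 / Q"
    using Q by (intro divide_left_mono) auto
  with gap_Q have gap2: "1 / 2 ^ (C + B * m) \<le> \<nu> - A - c / Ra" by linarith
  have Bv: "\<bar>Bv\<bar> \<le> 2 * 2 ^ B"
    unfolding Bv_def using E(2) by (intro pval_bound wt) auto
  have "Rb / (Rb - 1) \<le> 2"
    using R by (simp add: divide_le_eq)
  then have "\<bar>Bv\<bar> * (Rb / (Rb - 1)) \<le> 2 * 2 ^ B * 2"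
    using R by (intro mult_mono Bv) auto
  moreover have "\<bar>c\<bar> = \<bar>Bv\<bar> * (Rb / (Rb - 1))"
    using R by (simp add: c_def abs_mult)
  ultimately have "\<bar>c\<bar> \<le> 2 * 2 ^ B * 2"
    by (simp only:)
  moreover have "2 ^ k \<le> Ra * Rb ^ k"
    using R mult_mono[of 1 Ra "2 ^ k" "Rb ^ k"] by (simp add: power_mono)
  ultimately have "\<bar>c\<bar> / (Ra * Rb ^ k) \<le> 2 * 2 ^ B * 2 / 2 ^ k"
    by (intro frac_le) auto
  also have "\<dots> = 1 / 2 ^ (C + B * m)"
    by (simp add: k_def power_add)
  finally have tail: "\<bar>c\<bar> / (Ra * Rb ^ k) \<le> 1 / 2 ^ (C + B * m)" .
  have "0 < Ra * Rb ^ k" using R by simp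
  then have "- (c / (Ra * Rb ^ k)) \<le> \<bar>c\<bar> / (Ra * Rb ^ k)"
    using abs_ge_minus_self[of "c / (Ra * Rb ^ k)"] by (simp only: abs_divide abs_of_pos)
  moreover have "pval (iterate k bs') = c * (1 - 1 / Rb ^ k)"
    using pval_iterate[of bs' k] rates(2) by (simp add: c_def Bv_def Rb_def)
  then have "pval (as @ iterate k bs') = A + c / Ra - c / (Ra * Rb ^ k)"
    unfolding pval_append A_def Ra_def
    by (simp add: right_diff_distrib diff_divide_distrib mult.commute)
  ultimately show ?thesis
    using gap2 tail unfolding k_def[symmetric] bs'_def[symmetric] by linarith
qed

text \<open>Induction on the length. If dropping a cycle keeps the value within the threshold, the
  path gets shorter; otherwise the cycle is pumped and everything behind it is discarded. Both
  changes preserve the first edge, and with it the initial state.\<close>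

lemma short_path:
  assumes m: "card E \<le> m"
    and disc: "\<And>e. e \<in> E \<Longrightarrow> disc e \<le> 2 ^ B" and wt: "\<And>e. e \<in> E \<Longrightarrow> \<bar>wt e\<bar> \<le> 2 ^ B"
    and D: "\<And>e. e \<in> E \<Longrightarrow> of_nat D * wt e \<in> \<int>" and d: "of_nat d * \<nu> \<in> \<int>"
    and C: "d * D \<le> 2 ^ C" "0 < d * D"
  shows "path es \<Longrightarrow> pval es \<le> \<nu> \<Longrightarrow>
    \<exists>fs. path fs \<and> hd fs = hd es \<and> pval fs \<le> \<nu> \<and> length fs \<le> m * (B + 2 + C + B * m)"
proof (induction es rule: length_induct)
  case (1 es)
  let ?k = "B + 2 + C + B * m"
  show ?case
  proof (cases "length es \<le> m")
    case True
    have "length es \<le> m * ?k" using True by (simp add: algebra_simps)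
    with 1(2,3) show ?thesis by blast
  next
    case False
    \<comment> \<open>Pigeonhole on an initial segment: prefix and cycle together then have at most
      \<open>m\<close> edges, which bounds the rates in \<open>pump\<close>.\<close>
    have "\<not> distinct (take (Suc m) es)"
    proof
      assume "distinct (take (Suc m) es)"
      then have "card (set (take (Suc m) es)) = Suc m"
        using False by (simp add: distinct_card)
      moreover have "card (set (take (Suc m) es)) \<le> card E"
        using 1(2) set_take_subset[of "Suc m" es] by (intro card_mono finite_E) (auto simp: path_def)
      ultimately show False using m by simp
    qed
    then obtain as bs cs' e where t: "take (Suc m) es = as @ [e] @ bs @ [e] @ cs'"
      using not_distinct_decomp by blast
    define cs where "cs = cs' @ drop (Suc m) es"
    have es: "es = as @ (e # bs) @ e # cs"
      using append_take_drop_id[of "Suc m" es] unfolding t cs_def by simp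
    have len: "length (as @ e # bs) \<le> m"
      using arg_cong[OF t, of length] False by simp
    show ?thesis
    proof (cases "pval (as @ e # cs) \<le> \<nu>")
      case True
      moreover have "path (as @ e # cs)"
        using path_shortcut 1(2) unfolding es .
      moreover have "length (as @ e # cs) < length es" by (simp add: es)
      moreover have "hd (as @ e # cs) = hd es" by (cases as) (simp_all add: es)
      ultimately show ?thesis using 1(1) by metis
    next
      case False
      let ?fs = "as @ iterate ?k (e # bs)"
      have "pval ?fs \<le> \<nu>"
        by (rule pump[OF 1(2,3)[unfolded es] _ len disc wt D d C]) (use False in auto)
      moreover have "path ?fs"
        using path_iterate[OF 1(2)[unfolded es], of ?k] by simp
      moreover have "hd ?fs = hd es"
        by (cases as) (simp_all add: es)
      moreover have "length ?fs \<le> m * ?k"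
      proof -
        have "length ?fs = length as + ?k * length (e # bs)"
          by (simp add: length_iterate)
        \<comment> \<open>As \<open>?k\<close> is positive, the prefix may be counted
          \<open>?k\<close> times as well.\<close>
        also have "\<dots> \<le> ?k * length as + ?k * length (e # bs)" by simp
        also have "\<dots> = ?k * length (as @ e # bs)" by (simp add: algebra_simps)
        also have "\<dots> \<le> ?k * m" using len by (rule mult_le_mono2)
        finally show ?thesis by (simp add: mult.commute)
      qed
      ultimately show ?thesis by blast
    qed
  qed
qed

end

section \<open>Correctness of the value iteration\<close>

definition frac_val :: "frac \<Rightarrow> rat" where
  "frac_val x = (of_nat (fst x) - of_nat (fst (snd x))) / of_nat (snd (snd x))"

definition edge_src :: "edge \<Rightarrow> nat" where "edge_src e = fst e"

definition edge_tgt :: "edge \<Rightarrow> nat" where "edge_tgt e = fst (snd e)"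

definition edge_wt :: "edge \<Rightarrow> rat" where
  "edge_wt e = (of_nat (fst (snd (snd e))) - of_nat (fst (snd (snd (snd e))))) / of_nat (fst (snd (snd (snd (snd e)))))"

definition edge_disc :: "edge \<Rightarrow> nat" where
  "edge_disc e = snd (snd (snd (snd (snd e))))"

definition proper_edge :: "edge \<Rightarrow> bool" where
  "proper_edge e \<longleftrightarrow> 0 < fst (snd (snd (snd (snd e)))) \<and> 2 \<le> edge_disc e"

definition proper_frac :: "frac \<Rightarrow> bool" where
  "proper_frac x \<longleftrightarrow> 0 < snd (snd x)"

lemma frac_le_iff:
  assumes "proper_frac x" "proper_frac y"
  shows "frac_le x y \<longleftrightarrow> frac_val x \<le> frac_val y"
proof -
  obtain a b c where x: "x = (a, b, c)" by (cases x) auto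
  obtain a' b' c' where y: "y = (a', b', c')" by (cases y) auto
  have c: "0 < (of_nat c :: rat)" "0 < (of_nat c' :: rat)"
    using assms by (simp_all add: x y proper_frac_def)
  have "frac_val x \<le> frac_val y \<longleftrightarrow>
      (of_nat a - of_nat b) * of_nat c' \<le> (of_nat a' - of_nat b') * (of_nat c :: rat)"
    using c by (simp add: x y frac_val_def divide_le_eq le_divide_eq mult.commute)
  also have "\<dots> \<longleftrightarrow> (of_nat (a * c' + b' * c) :: rat) \<le> of_nat (a' * c + b * c')"
    by (simp add: algebra_simps)
  also have "\<dots> \<longleftrightarrow> frac_le x y"
    unfolding of_nat_le_iff by (simp add: x y frac_le_def)
  finally show ?thesis by simp
qed

lemma prepend_proper: "proper_edge e \<Longrightarrow> proper_frac x \<Longrightarrow> proper_frac (prepend e x)"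
  by (simp add: proper_edge_def proper_frac_def prepend_def edge_disc_def)

lemma prepend_val:
  assumes "proper_edge e" "proper_frac x"
  shows "frac_val (prepend e x) = edge_wt e + frac_val x / of_nat (edge_disc e)"
proof -
  obtain p q u v h r where e: "e = (p, q, u, v, h, r)" by (cases e) auto
  obtain a b c where x: "x = (a, b, c)" by (cases x) auto
  have "h \<noteq> 0" "r \<noteq> 0" "c \<noteq> 0"
    using assms by (auto simp: e x proper_edge_def proper_frac_def edge_disc_def)
  then show ?thesis
    by (simp add: e x frac_val_def edge_wt_def prepend_def edge_disc_def field_simps)
qed

lemma fold_best_step_proper:
  "(\<And>t. t \<in> set tab \<Longrightarrow> proper_frac (snd t)) \<Longrightarrow> proper_frac x \<Longrightarrow>
   proper_frac (fold (best_step e) tab x)"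
  using fold_best_step[of e tab x] by auto

text \<open>The selected value is attained, by a matching entry or by the start value; this serves
  soundness, the lower bound proved next serves completeness.\<close>

lemma fold_best_step_cases:
  "fold (best_step e) tab x = x \<or>
   (\<exists>t\<in>set tab. edge_src (fst t) = edge_tgt e \<and> fold (best_step e) tab x = snd t)"
proof (induction tab arbitrary: x)
  case (Cons t tab)
  show ?case
    using Cons[of "best_step e t x"] by (auto simp: best_step_def edge_src_def edge_tgt_def split: if_splits)
qed simp

lemma fold_best_step_le:
  "(\<And>t. t \<in> set tab \<Longrightarrow> proper_frac (snd t)) \<Longrightarrow> proper_frac x \<Longrightarrow>
   frac_val (fold (best_step e) tab x) \<le> frac_val x \<and>
   (\<forall>t\<in>set tab. edge_src (fst t) = edge_tgt e \<longrightarrow> frac_val (fold (best_step e) tab x) \<le> frac_val (snd t))"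
proof (induction tab arbitrary: x)
  case (Cons t tab)
  have p: "proper_frac (snd t)" "proper_frac (best_step e t x)"
    using Cons.prems by (auto simp: best_step_def)
  have "frac_val (best_step e t x) \<le> frac_val x"
    using frac_le_iff[OF p(1) Cons.prems(2)] by (auto simp: best_step_def)
  moreover have "frac_val (best_step e t x) \<le> frac_val (snd t)" if "edge_src (fst t) = edge_tgt e"
    using frac_le_iff[OF p(1) Cons.prems(2)] that
    by (auto simp: best_step_def edge_src_def edge_tgt_def)
  moreover have "frac_val (fold (best_step e) tab (best_step e t x)) \<le> frac_val (best_step e t x) \<and>
    (\<forall>u\<in>set tab. edge_src (fst u) = edge_tgt e \<longrightarrow>
       frac_val (fold (best_step e) tab (best_step e t x)) \<le> frac_val (snd u))"
    using Cons.prems p by (intro Cons.IH) auto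
  ultimately show ?case by (auto intro: order_trans)
qed simp

locale edge_graph =
  fixes es :: "edge list"
  assumes proper: "e \<in> set es \<Longrightarrow> proper_edge e"
begin

sublocale weighted_graph "set es" edge_src edge_tgt edge_wt edge_disc
  using proper by unfold_locales (auto simp: proper_edge_def)

lemma solve_proper: "t \<in> set (solve es ks) \<Longrightarrow> fst t \<in> set es \<and> proper_frac (snd t)"
proof (induction ks arbitrary: t rule: rev_induct)
  case (snoc k ks)
  then obtain e where e: "e \<in> set es" "t = (e, prepend e (best (solve es ks) e))"
    by (auto simp: solve_snoc relax_def)
  have "proper_frac (best (solve es ks) e)"
    unfolding best_def using snoc.IH by (intro fold_best_step_proper) (auto simp: proper_frac_def)
  then show ?case
    using e prepend_proper proper by simp
qed (simp add: solve_def)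

lemma path_Cons: "path (e # fs) \<longleftrightarrow> e \<in> set es \<and> (fs = [] \<or> edge_tgt e = edge_src (hd fs) \<and> path fs)"
  by (cases fs) (auto simp: path_def)

text \<open>No entry is too small: each is the exact value of an actual path, obtained by prepending
  an edge to the path behind the selected entry.\<close>

lemma solve_sound:
  "t \<in> set (solve es ks) \<Longrightarrow> \<exists>fs. path fs \<and> hd fs = fst t \<and> pval fs = frac_val (snd t)"
proof (induction ks arbitrary: t rule: rev_induct)
  case (snoc k ks)
  then obtain e where e: "e \<in> set es" "t = (e, prepend e (best (solve es ks) e))"
    by (auto simp: solve_snoc relax_def)
  have "proper_frac (best (solve es ks) e)"
    unfolding best_def
    by (rule fold_best_step_proper) (use solve_proper in blast, simp add: proper_frac_def)
  note val = prepend_val[OF proper[OF e(1)] this]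
  consider "best (solve es ks) e = (0, 0, 1)"
    | t' where "t' \<in> set (solve es ks)" "edge_src (fst t') = edge_tgt e" "best (solve es ks) e = snd t'"
    using fold_best_step_cases[of e "solve es ks" "(0, 0, 1)"] unfolding best_def by auto
  then show ?case
  proof cases
    case 1
    then show ?thesis
      using e val by (intro exI[of _ "[e]"]) (simp add: path_Cons frac_val_def)
  next
    case 2
    then obtain fs where "path fs" "hd fs = fst t'" "pval fs = frac_val (snd t')"
      using snoc.IH by blast
    then show ?thesis
      using e val 2 by (intro exI[of _ "e # fs"]) (simp add: path_Cons)
  qed
qed (simp add: solve_def)

text \<open>Dividing by a positive discount factor is monotone, so a continuation at least as good
  yields a path at least as good.\<close>

lemma solve_complete:
  "path fs \<Longrightarrow> length fs \<le> length ks \<Longrightarrow> \<exists>t\<in>set (solve es ks). fst t = hd fs \<and> frac_val (snd t) \<le> pval fs"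
proof (induction ks arbitrary: fs rule: rev_induct)
  case Nil
  then show ?case by (simp add: path_def)
next
  case (snoc k ks)
  obtain e gs where fs: "fs = e # gs" using snoc.prems(1) by (cases fs) (auto simp: path_def)
  then have e: "e \<in> set es" using snoc.prems by (simp add: path_Cons)
  let ?b = "best (solve es ks) e"
  have proper_tab: "proper_frac (snd t)" if "t \<in> set (solve es ks)" for t
    using solve_proper that by blast
  have start: "proper_frac (0, 0, 1)" by (simp add: proper_frac_def)
  have "proper_frac ?b"
    unfolding best_def using proper_tab start by (rule fold_best_step_proper)
  note val = prepend_val[OF proper[OF e] this]
  note le = fold_best_step_le[of "solve es ks", OF proper_tab start, of e, folded best_def]
  have "frac_val ?b \<le> pval gs"
  proof (cases "gs = []")
    case True
    then show ?thesis using le by (simp add: frac_val_def)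
  next
    case False
    then have "path gs" "edge_tgt e = edge_src (hd gs)" "length gs \<le> length ks"
      using snoc.prems by (auto simp: fs path_Cons)
    then obtain t where "t \<in> set (solve es ks)" "fst t = hd gs" "frac_val (snd t) \<le> pval gs"
      using snoc.IH by blast
    then show ?thesis
      using le \<open>edge_tgt e = _\<close> by fastforce
  qed
  then have "frac_val (prepend e ?b) \<le> pval fs"
    using divide_right_mono[of "frac_val ?b" "pval gs" "of_nat (edge_disc e)"] by (simp add: val fs)
  moreover have "(e, prepend e ?b) \<in> set (solve es (ks @ [k]))"
    using e by (simp add: solve_snoc relax_def)
  ultimately show ?case
    by (intro bexI[of _ "(e, prepend e ?b)"]) (simp_all add: fs)
qed

text \<open>Here \<open>short_path\<close> is used with \<open>B\<close> as the bound on both edges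
  and bit lengths, and with \<open>C = B + B * B\<close>; the premise on \<open>ks\<close> is the
  resulting path length.\<close>

lemma solve_correct:
  assumes small: "\<And>e. e \<in> set es \<Longrightarrow> small_edge B e" and len: "length es \<le> B"
    and x: "proper_frac x" "snd (snd x) \<le> 2 ^ B"
    and ks: "B * (B + 2 + (B + B * B) + B * B) \<le> length ks"
  shows "(\<exists>t\<in>set (solve es ks). edge_src (fst t) \<in> I \<and> frac_le (snd t) x)
     \<longleftrightarrow> (\<exists>fs. path fs \<and> edge_src (hd fs) \<in> I \<and> pval fs \<le> frac_val x)"
proof
  assume "\<exists>t\<in>set (solve es ks). edge_src (fst t) \<in> I \<and> frac_le (snd t) x"
  then obtain t where t: "t \<in> set (solve es ks)" "edge_src (fst t) \<in> I" "frac_le (snd t) x" by blast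
  then have "frac_val (snd t) \<le> frac_val x"
    using solve_proper[OF t(1)] x frac_le_iff by blast
  then show "\<exists>fs. path fs \<and> edge_src (hd fs) \<in> I \<and> pval fs \<le> frac_val x"
    using solve_sound[OF t(1)] t(2) by metis
next
  define den where "den = (\<lambda>e :: edge. fst (snd (snd (snd (snd e)))))"
  \<comment> \<open>A plain product of all weight denominators is good enough as a common multiple:
    it has at most about \<open>B * B\<close> bits.\<close>
  define D where "D = (\<Prod>e\<in>set es. den e)"
  have den: "0 < den e" "den e \<le> 2 ^ B" if "e \<in> set es" for e
    using proper[OF that] small[OF that] by (auto simp: proper_edge_def den_def small_edge_def)
  have card: "card (set es) \<le> B" using card_length len by (rule order_trans)
  have "D \<le> (\<Prod>e\<in>set es. 2 ^ B)"
    unfolding D_def using den by (intro prod_mono) auto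
  also have "\<dots> = 2 ^ (B * card (set es))" by (simp add: power_mult)
  also have "\<dots> \<le> 2 ^ (B * B)" using card by (intro power_increasing mult_le_mono) auto
  finally have "snd (snd x) * D \<le> 2 ^ B * 2 ^ (B * B)" using x(2) by (intro mult_le_mono)
  then have C: "snd (snd x) * D \<le> 2 ^ (B + B * B)" by (simp add: power_add)
  have C0: "0 < snd (snd x) * D"
    using den x(1) by (auto simp: D_def proper_frac_def intro!: prod_pos)
  have disc: "edge_disc e \<le> 2 ^ B" if "e \<in> set es" for e
    using small[OF that] by (auto simp: small_edge_def edge_disc_def)
  have wt: "\<bar>edge_wt e\<bar> \<le> 2 ^ B" if "e \<in> set es" for e
  proof -
    obtain p q u v h r where e: "e = (p, q, u, v, h, r)" by (cases e) auto
    have uvh: "u \<le> 2 ^ B" "v \<le> 2 ^ B" "0 < h"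
      using small[OF that] proper[OF that] by (auto simp: small_edge_def proper_edge_def e)
    then have "(of_nat u :: rat) \<le> 2 ^ B" "(of_nat v :: rat) \<le> 2 ^ B" "(1 :: rat) \<le> of_nat h"
      by simp_all
    then have "\<bar>of_nat u - of_nat v\<bar> \<le> (2 ^ B :: rat)" "(1 :: rat) \<le> of_nat h"
      using of_nat_0_le_iff[of u, where 'a = rat] of_nat_0_le_iff[of v, where 'a = rat] by linarith+
    then have "\<bar>of_nat u - of_nat v\<bar> / of_nat h \<le> (2 ^ B / 1 :: rat)"
      by (intro frac_le) auto
    then show ?thesis by (simp add: edge_wt_def e)
  qed
  have D: "of_nat D * edge_wt e \<in> \<int>" if "e \<in> set es" for e
  proof -
    have "den e dvd D"
      unfolding D_def by (rule dvd_prodI[OF finite_set that])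
    then obtain z where z: "D = den e * z" ..
    have "of_nat D * edge_wt e = of_nat z * (of_nat (fst (snd (snd e))) - of_nat (fst (snd (snd (snd e)))))"
      using den(1)[OF that] unfolding z by (simp add: edge_wt_def den_def)
    also have "\<dots> \<in> \<int>" by simp
    finally show ?thesis .
  qed
  have d: "of_nat (snd (snd x)) * frac_val x \<in> \<int>"
    using x(1) by (simp add: frac_val_def proper_frac_def)
  assume "\<exists>fs. path fs \<and> edge_src (hd fs) \<in> I \<and> pval fs \<le> frac_val x"
  then obtain fs where fs: "path fs" "edge_src (hd fs) \<in> I" "pval fs \<le> frac_val x" by blast
  from short_path[OF card disc wt D d C C0 fs(1,3)]
  obtain gs where gs: "path gs" "hd gs = hd fs" "pval gs \<le> frac_val x" "length gs \<le> length ks"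
    using ks by (meson order_trans)
  obtain t where t: "t \<in> set (solve es ks)" "fst t = hd gs" "frac_val (snd t) \<le> pval gs"
    using solve_complete[OF gs(1,4)] by blast
  then have "frac_le (snd t) x"
    using solve_proper[OF t(1)] gs(3) x(1) by (auto simp: frac_le_iff)
  then show "\<exists>t\<in>set (solve es ks). edge_src (fst t) \<in> I \<and> frac_le (snd t) x"
    using t gs(2) fs(2) by (intro bexI[of _ t]) simp_all
qed

end

section \<open>Reading instances\<close>

definition scan_word :: "symbol list \<Rightarrow> entry \<times> entry list \<times> entry list list \<times> (entry list \<times> entry list list) list
    \<Rightarrow> entry \<times> entry list \<times> entry list list \<times> (entry list \<times> entry list list) list" where
  "scan_word w s = fold scan_step (map symbol_code w) s"

lemma scan_word_simps [simp]:
  "scan_word [] s = s"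
  "scan_word (x # w) s = scan_word w (scan_step (symbol_code x) s)"
  "scan_word (v @ w) s = scan_word w (scan_word v s)"
  by (simp_all add: scan_word_def)

lemma horner_binary: "horner (binary n) 0 = n"
proof (induction n rule: binary.induct)
  case (1 n)
  show ?case
  proof (cases "n < 2")
    case True
    then have "n = 0 \<or> n = 1" by auto
    then show ?thesis by (auto simp: binary.simps[of n] shift_in_def)
  next
    case False
    then show ?thesis
      using 1 by (subst binary.simps) (simp add: horner_append shift_in_def)
  qed
qed

lemma less_pow_binary: "n < 2 ^ length (binary n)"
  using horner_less[of 0 0 "binary n"] by (simp add: horner_binary)

lemma length_binary_le: "length (binary n) \<le> n + 1"
proof (induction n rule: binary.induct)
  case (1 n)
  then show ?case
    by (cases "n < 2") (subst binary.simps, simp)+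
qed

lemma binary_nonempty: "binary n \<noteq> []"
  by (subst binary.simps) simp

lemma scan_digits: "scan_word (map Digit bs) ((b, n), s) = ((b, horner bs n), s)"
proof (induction bs arbitrary: n)
  case (Cons c bs)
  then show ?case by (cases c) (simp_all add: scan_step_def)
qed simp

lemma scan_nat [simp]: "scan_word (write_nat n) ((b, 0), s) = ((b, n), s)"
  by (simp add: write_nat_def scan_digits horner_binary)

definition numerator_entry :: "rat \<Rightarrow> entry" where
  "numerator_entry r = (fst (quotient_of r) < 0, nat \<bar>fst (quotient_of r)\<bar>)"

definition denominator_entry :: "rat \<Rightarrow> entry" where
  "denominator_entry r = (False, nat (snd (quotient_of r)))"

lemma scan_rat [simp]:
  "scan_word (write_rat r) ((False, 0), fs, s) = (denominator_entry r, numerator_entry r # fs, s)"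
  by (simp add: write_rat_def scan_step_def numerator_entry_def denominator_entry_def split: prod.splits)

definition trans_record :: "(nat, nat) nmda \<Rightarrow> nat \<times> nat \<times> nat \<Rightarrow> entry list" where
  "trans_record A t =
     [denominator_entry (discount A t), numerator_entry (discount A t),
      denominator_entry (weight A t), numerator_entry (weight A t),
      (False, snd (snd t)), (False, fst (snd t)), (False, fst t)]"

lemma scan_trans:
  "scan_word (write_trans A t) ((False, 0), [], rs, ss) = ((False, 0), [], trans_record A t # rs, ss)"
  by (cases t) (simp add: scan_step_def trans_record_def)

lemma scan_transs:
  "scan_word (concat (map (write_trans A) ts)) ((False, 0), [], rs, ss)
     = ((False, 0), [], rev (map (trans_record A) ts) @ rs, ss)"
  by (induction ts arbitrary: rs) (simp_all add: scan_trans)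

lemma scan_states:
  "scan_word (concat (map (\<lambda>q. write_nat q @ [Semicolon]) qs)) ((False, 0), [], rs, ss)
     = ((False, 0), [], rev (map (\<lambda>q. [(False, q)]) qs) @ rs, ss)"
  by (induction qs arbitrary: rs) (simp_all add: scan_step_def)

text \<open>The entries \<open>(False, 0)\<close> are the empty ones pending between a final
  semicolon and the bar. The alphabet size is followed by no bar and therefore forms no
  section.\<close>

lemma sections_instance:
  "sections (map symbol_code (write_instance A \<nu> ts qs)) =
     [([(False, card (states A))], []),
      ([(False, 0)], rev (map (\<lambda>q. [(False, q)]) qs)),
      ([(False, 0)], rev (map (trans_record A) ts)),
      ([denominator_entry \<nu>, numerator_entry \<nu>], [])]"
proof -
  have "scan_word (write_instance A \<nu> ts qs) ((False, 0), [], [], []) =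
     ((False, card (alphabet A)), [], [], 
     [([(False, card (states A))], []),
      ([(False, 0)], rev (map (\<lambda>q. [(False, q)]) qs)),
      ([(False, 0)], rev (map (trans_record A) ts)),
      ([denominator_entry \<nu>, numerator_entry \<nu>], [])])"
    unfolding write_instance_def
    by (simp add: scan_transs scan_states) (simp add: scan_step_def scan_transs scan_states)
  then show ?thesis
    by (simp add: sections_def scan_word_def[symmetric])
qed

text \<open>The letter is forgotten, so transitions that differ only in their letter may become the
  same edge.\<close>

definition edge_of :: "(nat, nat) nmda \<Rightarrow> nat \<times> nat \<times> nat \<Rightarrow> edge" where
  "edge_of A t = edge_of_record (trans_record A t)"

definition frac_of :: "rat \<Rightarrow> frac" where
  "frac_of r = (fst (entry_diff (numerator_entry r)), snd (entry_diff (numerator_entry r)),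
     snd (denominator_entry r))"

lemma decide_instance:
  fixes A \<nu> ts qs
  defines "w \<equiv> map symbol_code (write_instance A \<nu> ts qs)"
  shows "decide w \<longleftrightarrow>
    (\<exists>t\<in>set (solve (rev (map (edge_of A) ts)) (square_list (square_list w))).
       edge_src (fst t) \<in> set qs \<and> frac_le (snd t) (frac_of \<nu>))"
  unfolding decide_def w_def sections_instance
  by (simp add: frac_of_def edge_src_def rev_map comp_def edge_of_def[abs_def] Bex_def eq_commute)

lemma entry_diff_numerator:
  "(of_nat (fst (entry_diff (numerator_entry r))) - of_nat (snd (entry_diff (numerator_entry r))) :: rat)
     = of_int (fst (quotient_of r))"
  by (simp add: entry_diff_def numerator_entry_def)

lemma frac_of_val: "frac_val (frac_of r) = r"
proof -
  have "0 < snd (quotient_of r)" by (rule quotient_of_denom_pos')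
  then have "(of_nat (nat (snd (quotient_of r))) :: rat) = of_int (snd (quotient_of r))"
    by simp
  then show ?thesis
    using quotient_of_div[of r "fst (quotient_of r)" "snd (quotient_of r)"]
    by (simp add: frac_val_def frac_of_def entry_diff_numerator denominator_entry_def)
qed

lemma frac_of_proper: "proper_frac (frac_of r)"
  using quotient_of_denom_pos'[of r] by (simp add: proper_frac_def frac_of_def denominator_entry_def)

lemma edge_of_src: "edge_src (edge_of A t) = fst t"
  by (simp add: edge_src_def edge_of_def edge_of_record_def trans_record_def)

lemma edge_of_tgt: "edge_tgt (edge_of A t) = snd (snd t)"
  by (simp add: edge_tgt_def edge_of_def edge_of_record_def trans_record_def)

lemma edge_of_wt: "edge_wt (edge_of A t) = weight A t"
  using frac_of_val[of "weight A t"]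
  by (simp add: edge_wt_def edge_of_def edge_of_record_def trans_record_def frac_val_def frac_of_def)

text \<open>An integer has denominator \<open>1\<close>, so the numerator alone is the discount
  factor; being an integer above \<open>1\<close>, it is at least \<open>2\<close>.\<close>

lemma edge_of_disc:
  assumes "integral_nmda A" "t \<in> trans A"
  shows "of_nat (edge_disc (edge_of A t)) = discount A t" "2 \<le> edge_disc (edge_of A t)"
proof -
  obtain z where z: "discount A t = of_int z"
    using assms by (auto simp: integral_nmda_def elim: Ints_cases)
  have "1 < discount A t" using assms by (auto simp: integral_nmda_def is_nmda_def)
  then have "1 < z" by (simp add: z)
  then show "of_nat (edge_disc (edge_of A t)) = discount A t" "2 \<le> edge_disc (edge_of A t)"
    by (simp_all add: edge_disc_def edge_of_def edge_of_record_def trans_record_def z numerator_entry_def)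
qed

lemma edge_of_proper:
  assumes "integral_nmda A" "t \<in> trans A"
  shows "proper_edge (edge_of A t)"
  using edge_of_disc(2)[OF assms] quotient_of_denom_pos'[of "weight A t"]
  by (simp add: proper_edge_def edge_of_def edge_of_record_def trans_record_def denominator_entry_def)

section \<open>Runs as paths\<close>

fun trans_value :: "('q, 'a) nmda \<Rightarrow> ('q \<times> 'a \<times> 'q) list \<Rightarrow> rat" where
  "trans_value A [] = 0"
| "trans_value A (t # ts) = weight A t + trans_value A ts / discount A t"

lemma trans_value_sum:
  "(\<Sum>i<length ts. weight A (ts ! i) * (\<Prod>j<i. 1 / discount A (ts ! j))) = trans_value A ts"
proof (induction ts)
  case (Cons t ts)
  have "(\<Sum>i<length ts. weight A (ts ! i) * ((1 / discount A t) * (\<Prod>j<i. 1 / discount A (ts ! j))))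
      = trans_value A ts / discount A t"
    unfolding Cons[symmetric] sum_divide_distrib by (intro sum.cong) auto
  then show ?case
    by (simp only: list.size trans_value.simps add_Suc_right add_0_right sum.lessThan_Suc_shift
        prod.lessThan_Suc_shift nth_Cons_0 nth_Cons_Suc) simp
qed simp

text \<open>A list of transitions determines both a word and a run on it.\<close>

definition trans_chain :: "('q, 'a) nmda \<Rightarrow> ('q \<times> 'a \<times> 'q) list \<Rightarrow> bool" where
  "trans_chain A ts \<longleftrightarrow> ts \<noteq> [] \<and> set ts \<subseteq> trans A \<and> fst (hd ts) \<in> initial A \<and>
     successively (\<lambda>s t. snd (snd s) = fst t) ts"

lemma finite_runs:
  assumes "is_nmda A" "u \<noteq> []"
  shows "finite (runs A u)"
proof -
  have "runs A u \<subseteq> {ps. set ps \<subseteq> states A \<and> length ps = Suc (length u)}"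
  proof
    fix ps assume ps: "ps \<in> runs A u"
    have "ps ! i \<in> states A" if "i < Suc (length u)" for i
    proof (cases i)
      case 0
      then show ?thesis using ps assms(1) by (auto simp: runs_def is_nmda_def)
    next
      case (Suc j)
      then have "run_trans u ps j \<in> trans A" using ps that by (auto simp: runs_def)
      then show ?thesis using assms(1) Suc by (auto simp: run_trans_def is_nmda_def)
    qed
    then show "ps \<in> {ps. set ps \<subseteq> states A \<and> length ps = Suc (length u)}"
      using ps by (auto simp: runs_def in_set_conv_nth)
  qed
  moreover have "finite {ps. set ps \<subseteq> states A \<and> length ps = Suc (length u)}"
    using assms(1) by (intro finite_lists_length_eq) (simp add: is_nmda_def)
  ultimately show ?thesis by (rule finite_subset)
qed

text \<open>Finitely many runs make \<open>Min\<close> an attained minimum. If there is no run, the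
  value is infinite and the right-hand side has no witness.\<close>

lemma nmda_value_le_iff:
  assumes "is_nmda A" "u \<noteq> []"
  shows "nmda_value A u \<le> ereal (of_rat \<nu>) \<longleftrightarrow> (\<exists>ps\<in>runs A u. run_value A u ps \<le> \<nu>)"
proof (cases "runs A u = {}")
  case False
  then show ?thesis
    using finite_runs[OF assms] Min_le_iff[of "run_value A u ` runs A u" \<nu>]
    by (simp add: nmda_value_def of_rat_less_eq)
qed (simp add: nmda_value_def)

text \<open>The minimum over runs and the choice of the word merge into one existential quantifier
  over chains, which turns the question into one about paths.\<close>

lemma ex_word_iff_chain:
  assumes A: "is_nmda A"
  shows "(\<exists>u. u \<noteq> [] \<and> set u \<subseteq> alphabet A \<and> nmda_value A u \<le> ereal (of_rat \<nu>))
     \<longleftrightarrow> (\<exists>ts. trans_chain A ts \<and> trans_value A ts \<le> \<nu>)"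
proof
  assume "\<exists>u. u \<noteq> [] \<and> set u \<subseteq> alphabet A \<and> nmda_value A u \<le> ereal (of_rat \<nu>)"
  then obtain u ps where u: "u \<noteq> []" "ps \<in> runs A u" "run_value A u ps \<le> \<nu>"
    using nmda_value_le_iff[OF A] by blast
  let ?ts = "map (run_trans u ps) [0..<length u]"
  have "trans_value A ?ts = run_value A u ps"
    unfolding trans_value_sum[symmetric] run_value_def by (intro sum.cong prod.cong arg_cong2[of _ _ _ _ times]) auto
  moreover have "trans_chain A ?ts"
    using u(1,2) by (auto simp: trans_chain_def runs_def successively_conv_nth hd_map run_trans_def)
  ultimately show "\<exists>ts. trans_chain A ts \<and> trans_value A ts \<le> \<nu>"
    using u(3) by metis
next
  assume "\<exists>ts. trans_chain A ts \<and> trans_value A ts \<le> \<nu>"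
  then obtain ts where ts: "trans_chain A ts" "trans_value A ts \<le> \<nu>" by blast
  define u where "u = map (\<lambda>t. fst (snd t)) ts"
  define ps where "ps = fst (hd ts) # map (\<lambda>t. snd (snd t)) ts"
  have len: "length u = length ts" by (simp add: u_def)
  have tr: "run_trans u ps i = ts ! i" if "i < length ts" for i
  proof -
    have "ps ! i = fst (ts ! i)"
    proof (cases i)
      case 0
      then show ?thesis using that by (cases ts) (simp_all add: ps_def)
    next
      case (Suc j)
      then show ?thesis
        using ts(1) that by (auto simp: ps_def trans_chain_def successively_conv_nth)
    qed
    then show ?thesis using that by (simp add: run_trans_def u_def ps_def prod_eq_iff)
  qed
  have "u \<noteq> []" using ts(1) by (simp add: u_def trans_chain_def)
  moreover have "set u \<subseteq> alphabet A"
    using ts(1) A by (fastforce simp: u_def trans_chain_def is_nmda_def)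
  moreover have "ps \<in> runs A u"
    using ts(1) tr nth_mem by (fastforce simp: runs_def len trans_chain_def ps_def)
  moreover have "run_value A u ps = trans_value A ts"
    unfolding trans_value_sum[symmetric] run_value_def len
    by (intro sum.cong prod.cong arg_cong2[of _ _ _ _ times]) (auto simp: tr)
  ultimately show "\<exists>u. u \<noteq> [] \<and> set u \<subseteq> alphabet A \<and> nmda_value A u \<le> ereal (of_rat \<nu>)"
    using ts(2) nmda_value_le_iff[OF A] by metis
qed

lemma decide_correct:
  assumes A: "integral_nmda A" and ts: "set ts = trans A" and qs: "set qs = initial A"
    and w: "w = map symbol_code (write_instance A \<nu> ts qs)"
  shows "decide w \<longleftrightarrow>
    (\<exists>u. u \<noteq> [] \<and> set u \<subseteq> alphabet A \<and> nmda_value A u \<le> ereal (of_rat \<nu>))"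
proof -
  let ?es = "rev (map (edge_of A) ts)"
  interpret edge_graph ?es
    using edge_of_proper[OF A] ts by unfold_locales auto
  have len_concat: "length x \<le> length (concat xs)" if "x \<in> set xs" for x :: "symbol list" and xs
    using that by (induction xs) auto
  have rat_len: "length (binary (nat \<bar>fst (quotient_of r)\<bar>)) \<le> length (write_rat r)"
    "length (binary (nat (snd (quotient_of r)))) \<le> length (write_rat r)" for r
    by (simp_all add: write_rat_def write_nat_def split: prod.splits)
  have trans_len: "length (write_trans A t) \<le> length w" if "t \<in> set ts" for t
  proof -
    have "length (write_trans A t) \<le> length (concat (map (write_trans A) ts))"
      using that by (intro len_concat) simp
    then show ?thesis by (simp add: w write_instance_def)
  qed
  have pow: "n \<le> 2 ^ length w" if "length (binary n) \<le> length w" for n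
    using less_pow_binary[of n] power_increasing[OF that, of "2::nat"] by linarith
  have rat_le: "nat \<bar>fst (quotient_of r)\<bar> \<le> 2 ^ length w" "nat (snd (quotient_of r)) \<le> 2 ^ length w"
    if "length (write_rat r) \<le> length w" for r
    by (intro pow order_trans[OF rat_len(1) that] order_trans[OF rat_len(2) that])+
  have small: "small_edge (length w) e" if "e \<in> set ?es" for e
  proof -
    obtain t where t: "t \<in> set ts" "e = edge_of A t" using \<open>e \<in> set ?es\<close> by auto
    have "length (write_rat (weight A t)) + length (write_rat (discount A t)) \<le> length (write_trans A t)"
      by (cases t) simp
    with trans_len[OF t(1)] have
      "length (write_rat (weight A t)) \<le> length w" "length (write_rat (discount A t)) \<le> length w"
      by linarith+
    note le = rat_le[OF this(1)] rat_le[OF this(2)]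
    have e: "e = (fst t, snd (snd t), fst (entry_diff (numerator_entry (weight A t))),
        snd (entry_diff (numerator_entry (weight A t))), nat (snd (quotient_of (weight A t))),
        nat \<bar>fst (quotient_of (discount A t))\<bar>)"
      by (simp add: t(2) edge_of_def edge_of_record_def trans_record_def numerator_entry_def
          denominator_entry_def)
    have "fst (entry_diff (numerator_entry r)) \<le> nat \<bar>fst (quotient_of r)\<bar>"
      "snd (entry_diff (numerator_entry r)) \<le> nat \<bar>fst (quotient_of r)\<bar>" for r
      by (simp_all add: entry_diff_def numerator_entry_def)
    then show ?thesis
      unfolding e small_edge_def prod.case using le by (blast intro: order_trans)
  qed
  have "length ts \<le> length (concat (map (write_trans A) ts))"
    by (induction ts) (auto split: prod.splits)
  then have len_es: "length ?es \<le> length w"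
    by (simp add: w write_instance_def)
  have nu: "snd (snd (frac_of \<nu>)) \<le> 2 ^ length w"
  proof -
    have "length (write_rat \<nu>) \<le> length w"
      by (simp add: w write_instance_def)
    from rat_le(2)[OF this] show ?thesis
      by (simp only: frac_of_def denominator_entry_def snd_conv)
  qed
  have ks: "length w * (length w + 2 + (length w + length w * length w) + length w * length w)
      \<le> length (square_list (square_list w))"
  proof -
    \<comment> \<open>The bars alone give \<open>3 \<le> L\<close>. Then \<open>2 * L + 2\<close> is
      at most \<open>L * L\<close>, so the bracket is at most \<open>3 * (L * L)\<close>, hence at
      most \<open>L * L * L\<close>.\<close>
    define L where "L = length w"
    have L: "3 \<le> L" by (simp add: L_def w write_instance_def)
    then have "2 * L + 2 + 2 * (L * L) \<le> L * L * L"
    proof -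
      have "3 * (L * L) \<le> L * (L * L)" using L by (intro mult_le_mono1)
      moreover have "3 * L \<le> L * L" using L by (intro mult_le_mono1)
      ultimately show ?thesis using L unfolding mult.assoc by linarith
    qed
    then have "L * (2 * L + 2 + 2 * (L * L)) \<le> L * (L * L * L)"
      by (rule mult_le_mono2)
    then show ?thesis
      unfolding length_square_list L_def[symmetric] by (simp add: algebra_simps)
  qed
  have "decide w \<longleftrightarrow>
      (\<exists>fs. path fs \<and> edge_src (hd fs) \<in> set qs \<and> pval fs \<le> frac_val (frac_of \<nu>))"
    unfolding decide_instance[of A \<nu> ts qs, folded w]
    by (rule solve_correct[OF small len_es frac_of_proper nu ks])
  also have "\<dots> \<longleftrightarrow> (\<exists>fs. path fs \<and> edge_src (hd fs) \<in> initial A \<and> pval fs \<le> \<nu>)"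
    by (simp add: frac_of_val qs)
  also have "\<dots> \<longleftrightarrow> (\<exists>xs. trans_chain A xs \<and> trans_value A xs \<le> \<nu>)"
  proof
    have val: "set xs \<subseteq> trans A \<Longrightarrow> pval (map (edge_of A) xs) = trans_value A xs" for xs
      by (induction xs) (auto simp: edge_of_wt edge_of_disc(1)[OF A])
    have path_iff: "path fs \<longleftrightarrow> fs \<noteq> [] \<and> set fs \<subseteq> edge_of A ` trans A \<and>
        successively (\<lambda>e f. edge_tgt e = edge_src f) fs" for fs
      unfolding path_def by (simp add: ts)
    have chain: "path (map (edge_of A) xs) \<and> edge_src (hd (map (edge_of A) xs)) \<in> initial A
        \<longleftrightarrow> trans_chain A xs" if "set xs \<subseteq> trans A" for xs
      using that unfolding path_iff trans_chain_def successively_map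
      by (cases "xs = []") (auto simp: hd_map edge_of_src edge_of_tgt)
    show "\<exists>xs. trans_chain A xs \<and> trans_value A xs \<le> \<nu>"
      if "\<exists>fs. path fs \<and> edge_src (hd fs) \<in> initial A \<and> pval fs \<le> \<nu>"
    proof -
      from that obtain fs where fs: "path fs" "edge_src (hd fs) \<in> initial A" "pval fs \<le> \<nu>" by blast
      \<comment> \<open>Any preimage of an edge will do: an edge fixes source, target, weight and
        discount factor, so the choice affects only the letters of the word.\<close>
      define xs where "xs = map (inv_into (trans A) (edge_of A)) fs"
      have sub: "set fs \<subseteq> edge_of A ` trans A"
        using fs(1) unfolding path_iff by blast
      have eq: "map (edge_of A) xs = fs"
        unfolding xs_def map_map comp_def using sub by (intro map_idI f_inv_into_f) blast
      have "set xs \<subseteq> trans A"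
        unfolding xs_def set_map using sub by (blast intro: inv_into_into)
      then have "trans_chain A xs" "trans_value A xs \<le> \<nu>"
        using chain[of xs] val[of xs] fs unfolding eq by simp_all
      then show ?thesis by blast
    qed
    show "\<exists>fs. path fs \<and> edge_src (hd fs) \<in> initial A \<and> pval fs \<le> \<nu>"
      if "\<exists>xs. trans_chain A xs \<and> trans_value A xs \<le> \<nu>"
    proof -
      from that obtain xs where xs: "trans_chain A xs" "trans_value A xs \<le> \<nu>" by blast
      then have "set xs \<subseteq> trans A" by (simp add: trans_chain_def)
      from chain[OF this] val[OF this] xs show ?thesis
        by (intro exI[of _ "map (edge_of A) xs"]) (simp only: conj_assoc simp_thms)
    qed
  qed
  also have "\<dots> \<longleftrightarrow> (\<exists>u. u \<noteq> [] \<and> set u \<subseteq> alphabet A \<and> nmda_value A u \<le> ereal (of_rat \<nu>))"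
    using A by (intro ex_word_iff_chain[symmetric]) (simp add: integral_nmda_def)
  finally show ?thesis .
qed

section \<open>The length of the input word in terms of the input size\<close>

lemma length_write_rat: "length (write_rat r) \<le> binary_length r + 2"
  by (auto simp: write_rat_def write_nat_def binary_length_def split: prod.splits)

text \<open>One transition ensures a state \<open>0\<close> and a letter \<open>0\<close>. By
  completeness every state has a transition on letter \<open>0\<close>, and every letter one from
  state \<open>0\<close>.\<close>

lemma numbered_card_le:
  assumes A: "is_nmda A" "states A = {..<n}" "alphabet A = {..<k}" and ne: "trans A \<noteq> {}"
  shows "n \<le> card (trans A)" "k \<le> card (trans A)"
proof -
  have fin: "finite (trans A)"
    using A(1) by (auto simp: is_nmda_def intro: finite_subset[of _ "states A \<times> alphabet A \<times> states A"])
  have sub: "trans A \<subseteq> {..<n} \<times> {..<k} \<times> {..<n}"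
    and ex: "\<And>p a. p < n \<Longrightarrow> a < k \<Longrightarrow> \<exists>q. (p, a, q) \<in> trans A"
    using A(1) unfolding is_nmda_def A(2,3) by (blast, metis lessThan_iff)
  obtain t where "t \<in> trans A" using ne by blast
  with sub have "t \<in> {..<n} \<times> {..<k} \<times> {..<n}" by (rule subsetD)
  then have pos: "0 < n" "0 < k" by auto
  have "{..<n} \<subseteq> fst ` trans A"
  proof
    fix p assume "p \<in> {..<n}"
    then obtain q where "(p, 0, q) \<in> trans A" using ex[of p 0] pos by auto
    then show "p \<in> fst ` trans A" by (rule image_eqI[rotated]) simp
  qed
  then have "card {..<n} \<le> card (fst ` trans A)"
    by (intro card_mono finite_imageI fin)
  also have "\<dots> \<le> card (trans A)" by (rule card_image_le[OF fin])
  finally show "n \<le> card (trans A)" by simp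
  have "{..<k} \<subseteq> (\<lambda>t. fst (snd t)) ` trans A"
  proof
    fix a assume "a \<in> {..<k}"
    then obtain q where "(0, a, q) \<in> trans A" using ex[of 0 a] pos by auto
    then show "a \<in> (\<lambda>t. fst (snd t)) ` trans A" by (rule image_eqI[rotated]) simp
  qed
  then have "card {..<k} \<le> card ((\<lambda>t. fst (snd t)) ` trans A)"
    by (intro card_mono finite_imageI fin)
  also have "\<dots> \<le> card (trans A)" by (rule card_image_le[OF fin])
  finally show "k \<le> card (trans A)" by simp
qed

lemma input_size_ge:
  assumes "finite (trans A)"
  shows "card (trans A) \<le> input_size (A, \<nu>)" "binary_length \<nu> \<le> input_size (A, \<nu>)"
    "t \<in> trans A \<Longrightarrow> binary_length (weight A t) \<le> input_size (A, \<nu>)"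
    "t \<in> trans A \<Longrightarrow> binary_length (discount A t) \<le> input_size (A, \<nu>)"
proof -
  have fin: "finite ({card (trans A), binary_length \<nu>} \<union>
          (\<lambda>t. binary_length (weight A t)) ` trans A \<union>
          (\<lambda>t. binary_length (discount A t)) ` trans A)"
    using assms by simp
  show "card (trans A) \<le> input_size (A, \<nu>)" "binary_length \<nu> \<le> input_size (A, \<nu>)"
    "t \<in> trans A \<Longrightarrow> binary_length (weight A t) \<le> input_size (A, \<nu>)"
    "t \<in> trans A \<Longrightarrow> binary_length (discount A t) \<le> input_size (A, \<nu>)"
    unfolding input_size.simps by (rule Max_ge[OF fin]; simp)+
qed

lemma length_concat_le:
  "(\<And>x. x \<in> set xs \<Longrightarrow> length (f x) \<le> b) \<Longrightarrow> length (concat (map f xs)) \<le> length xs * b"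
  by (induction xs) (auto intro: add_mono)

text \<open>State numbers and letters are below the number of transitions, so even the crude linear
  bound on their binary length keeps the whole word quadratic.\<close>

lemma length_write_instance:
  fixes \<nu> :: rat
  assumes A: "is_nmda A" "numbered A" and ne: "trans A \<noteq> {}"
    and ts: "distinct ts" "set ts = trans A" and qs: "distinct qs" "set qs = initial A"
  defines "s \<equiv> input_size (A, \<nu>)"
  shows "length (write_instance A \<nu> ts qs) \<le> 6 * (s * s) + 20 * s + 20"
proof -
  from A(2) obtain n k where nk: "states A = {..<n}" "alphabet A = {..<k}"
    unfolding numbered_def by blast
  have fin: "finite (trans A)"
    using ts(2) by (metis finite_set)
  note size = input_size_ge[OF fin, where \<nu> = \<nu>, folded s_def]
  have n: "n \<le> s" "k \<le> s"
    using numbered_card_le[OF A(1) nk ne] size(1) by linarith+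
  have nat: "length (write_nat m) \<le> s + 1" if "m \<le> s" for m
    using length_binary_le[of m] that by (simp add: write_nat_def)
  \<comment> \<open>Three numbers of length at most \<open>s + 1\<close>, two fractions of length at
    most \<open>s + 2\<close>, and five separators.\<close>
  have "length (write_trans A t) \<le> 5 * s + 12" if "t \<in> set ts" for t
  proof -
    obtain p a q where t: "t = (p, a, q)" by (cases t)
    have "p < n" "a < k" "q < n"
      using that ts(2) A(1) nk by (auto simp: is_nmda_def t)
    then have "length (write_nat p) \<le> s + 1" "length (write_nat a) \<le> s + 1" "length (write_nat q) \<le> s + 1"
      using n by (intro nat; linarith)+
    moreover have "length (write_rat (weight A t)) \<le> s + 2" "length (write_rat (discount A t)) \<le> s + 2"
      using size(3,4)[of t] that ts(2) length_write_rat[of "weight A t"] length_write_rat[of "discount A t"]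
      by auto
    ultimately show ?thesis by (simp add: t)
  qed
  then have "length (concat (map (write_trans A) ts)) \<le> length ts * (5 * s + 12)"
    by (rule length_concat_le)
  also have "\<dots> \<le> s * (5 * s + 12)"
    using distinct_card[OF ts(1)] ts(2) size(1) by (intro mult_le_mono1) simp
  finally have 1: "length (concat (map (write_trans A) ts)) \<le> s * (5 * s + 12)" .
  have q: "q < n" if "q \<in> set qs" for q
    using that qs(2) A(1) nk by (auto simp: is_nmda_def)
  have "length (write_nat q @ [Semicolon]) \<le> s + 2" if "q \<in> set qs" for q
    using nat[of q] q[OF that] n by simp
  then have "length (concat (map (\<lambda>q. write_nat q @ [Semicolon]) qs)) \<le> length qs * (s + 2)"
    by (rule length_concat_le)
  also have "length qs \<le> n"
    using distinct_card[OF qs(1)] card_mono[of "{..<n}" "set qs"] q by auto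
  then have "length qs * (s + 2) \<le> s * (s + 2)"
    using n by (intro mult_le_mono1) simp
  finally have 2: "length (concat (map (\<lambda>q. write_nat q @ [Semicolon]) qs)) \<le> s * (s + 2)" .
  have "length (write_rat \<nu>) \<le> s + 2"
    using length_write_rat[of \<nu>] size(2) by linarith
  moreover have "length (write_nat (card (states A))) \<le> s + 1" "length (write_nat (card (alphabet A))) \<le> s + 1"
    unfolding nk card_lessThan by (rule nat, rule n)+
  ultimately show ?thesis
    using 1 2 by (simp add: write_instance_def algebra_simps)
qed

text \<open>Ensures that the first bar met by the scan is the one behind the threshold.\<close>

lemma bar_notin_write_rat: "7 \<notin> set (map symbol_code (write_rat r))"
proof -
  have "symbol_code (Digit b) \<noteq> 7" for b by (cases b) simp_all
  then show ?thesis
    by (auto simp: write_rat_def write_nat_def split: prod.splits)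
qed

lemma symbol_code_range: "symbol_code x \<in> {1..<8}"
  by (cases x rule: symbol_code.cases) auto

theorem theorem5p6:
  "decidable_in_polytime
     {(A, \<nu>). integral_nmda A \<and> numbered A}
     input_size
     encodes
     (\<lambda>(A, \<nu>). \<exists>u. u \<noteq> [] \<and> set u \<subseteq> alphabet A \<and> nmda_value A u \<le> ereal (of_rat \<nu>))"
proof -
  obtain M p where M: "is_tm M" "num_symbols M = 8"
    and early: "\<And>a r n. 7 \<notin> set a \<Longrightarrow> top_of r = 7 \<Longrightarrow> poly p (length a) \<le> n \<Longrightarrow>
       rejects_within M (a @ 7 # r) n"
    and late: "\<And>a r w n. 7 \<notin> set a \<Longrightarrow> top_of r \<noteq> 7 \<Longrightarrow> w = a @ 7 # r \<Longrightarrow> set w \<subseteq> {1..<8} \<Longrightarrow>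
       poly p (length w) \<le> n \<Longrightarrow> if decide w then accepts_within M w n else rejects_within M w n"
    using polytime_machine[OF polytime_decide] by metis
  have "poly_bounded (\<lambda>s. poly p (s + 2) + poly p (6 * (s * s) + 20 * s + 20))"
    by (intro poly_bounded_intros)
  then obtain P where P: "\<And>s. poly p (s + 2) + poly p (6 * (s * s) + 20 * s + 20) \<le> poly P s"
    unfolding poly_bounded_def by blast
  have main: "set w \<subseteq> {1..<8} \<and>
      (if \<exists>u. u \<noteq> [] \<and> set u \<subseteq> alphabet A \<and> nmda_value A u \<le> ereal (of_rat \<nu>)
       then accepts_within M w (poly P (input_size (A, \<nu>)))
       else rejects_within M w (poly P (input_size (A, \<nu>))))"
    if A: "integral_nmda A" "numbered A" and w: "encodes (A, \<nu>) w" for A \<nu> w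
  proof
    from w obtain ts qs where ts: "distinct ts" "set ts = trans A" and qs: "distinct qs" "set qs = initial A"
      and weq: "w = map symbol_code (write_instance A \<nu> ts qs)"
      by auto
    show range: "set w \<subseteq> {1..<8}"
      using symbol_code_range by (auto simp only: weq set_map)
    let ?s = "input_size (A, \<nu>)"
    define a where "a = map symbol_code (write_rat \<nu>)"
    define r where "r = map symbol_code (concat (map (write_trans A) ts) @ [Bar] @
      concat (map (\<lambda>q. write_nat q @ [Semicolon]) qs) @ [Bar] @
      write_nat (card (states A)) @ [Bar] @ write_nat (card (alphabet A)))"
    have split: "w = a @ 7 # r"
      by (simp add: weq write_instance_def a_def r_def)
    have a7: "7 \<notin> set a" unfolding a_def by (rule bar_notin_write_rat)
    have nmda: "is_nmda A" using A(1) by (simp add: integral_nmda_def)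
    have fin: "finite (trans A)" using ts(2) by (metis finite_set)
    show "if \<exists>u. u \<noteq> [] \<and> set u \<subseteq> alphabet A \<and> nmda_value A u \<le> ereal (of_rat \<nu>)
       then accepts_within M w (poly P ?s) else rejects_within M w (poly P ?s)"
    proof (cases "trans A = {}")
      \<comment> \<open>No nonempty run exists, so the answer is no. The time has to be bounded
        through the threshold, since the numbers of states and letters are not controlled by the
        input size here.\<close>
      case True
      then have "top_of r = 7" using ts(2) by (simp add: r_def)
      moreover have "length a \<le> ?s + 2"
        using length_write_rat[of \<nu>] input_size_ge(2)[OF fin, of \<nu>] unfolding a_def length_map by linarith
      then have "poly p (length a) \<le> poly P ?s"
        using P[of ?s] poly_mono_nat[of "length a" "?s + 2" p] by linarith
      ultimately have "rejects_within M w (poly P ?s)"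
        unfolding split by (rule early[OF a7])
      moreover have no: "\<not> (\<exists>u. u \<noteq> [] \<and> set u \<subseteq> alphabet A \<and> nmda_value A u \<le> ereal (of_rat \<nu>))"
        unfolding ex_word_iff_chain[OF nmda] using True by (auto simp: trans_chain_def)
      ultimately show ?thesis unfolding if_not_P[OF no] by blast
    next
      case False
      then obtain t ts' where t: "ts = t # ts'" using ts(2) by (cases ts) auto
      obtain p' a' q' where t3: "t = (p', a', q')" by (cases t)
      obtain b bs where b: "binary p' = b # bs" using binary_nonempty[of p'] by (cases "binary p'") auto
      \<comment> \<open>Behind the first bar comes the leading digit of the source of the first
        transition, so the machine does not reject early.\<close>
      have "top_of r = symbol_code (Digit b)"
        by (simp add: r_def t t3 write_nat_def b)
      then have "top_of r \<noteq> 7" by (cases b) simp_all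
      moreover have "length w \<le> 6 * (?s * ?s) + 20 * ?s + 20"
        unfolding weq length_map by (rule length_write_instance[OF nmda A(2) False ts qs])
      then have "poly p (length w) \<le> poly P ?s"
        using P[of ?s] poly_mono_nat[of "length w" _ p] by (meson add_leD2 order_trans)
      ultimately have "if decide w then accepts_within M w (poly P ?s) else rejects_within M w (poly P ?s)"
        using late[OF a7 _ split range] by blast
      then show ?thesis
        unfolding decide_correct[OF A(1) ts(2) qs(2) weq] .
    qed
  qed
  show ?thesis
    unfolding decidable_in_polytime_def
  proof (intro exI conjI ballI allI impI)
    show "is_tm M" by (rule M(1))
    fix x w assume "x \<in> {(A, \<nu>). integral_nmda A \<and> numbered A}" "encodes x w"
    then obtain A \<nu> where x: "x = (A, \<nu>)" and A: "integral_nmda A" "numbered A" "encodes (A, \<nu>) w"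
      by blast
    show "set w \<subseteq> {1..<num_symbols M}"
      using main[OF A] unfolding M(2) by blast
    show "if case x of (A, \<nu>) \<Rightarrow> \<exists>u. u \<noteq> [] \<and> set u \<subseteq> alphabet A \<and> nmda_value A u \<le> ereal (of_rat \<nu>)
      then accepts_within M w (poly P (input_size x)) else rejects_within M w (poly P (input_size x))"
      using main[OF A] unfolding x prod.case by (rule conjunct2)
  qed
qed

end
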